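(* Let $\Gamma$ be a compact Lie group acting linearly on a symplectic vector space $(V,\omega)$, and let $\sigma_1,\sigma_2:\Gamma\to\mathbb{Z}_2=\{\pm1\}$ be group homomorphisms. Suppose that the action of $\Gamma$ on $(V,\omega)$ is $\sigma_1$-semisymplectic, and let $X:V\to V$ be an $\omega$-Hamiltonian and $\Gamma_{\sigma_2}$-equivariant vector field such that $X(0)=0$ and $L=dX_0$. Let $\mathbf{S}=\overline{\{e^{sL^T}:s\in\mathbb{R}\}}$ and let $r\ge 3$. If $\mathbf{S}$ acts symplectically on $(V,\omega)$, then there exist $K^k\in\mathcal{P}^k_{\tilde\sigma_1\tilde\sigma_2}(\mathbf{S}\rtimes\Gamma)$, $k=3,\ldots,r$, such that $X$ is formally conjugated to a vector field of the form $$Y(y)=Ly+X_{K^3}(y)+\cdots+X_{K^r}(y)+O(|y|^r).$$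
   Context: $V$ is a real vector space of dimension $2n$ with an alternating non-degenerate bilinear form $\omega$. For a smooth $H:V\to\mathbb{R}$, the $\omega$-Hamiltonian vector field $X_H$ is defined by $\omega(X_H(x),\cdot)=dH_x$ for all $x\in V$; a vector field is $\omega$-Hamiltonian if it equals $X_H$ for some smooth $H$. All vector fields are smooth. Write $\rho_\gamma(x)=\gamma x$. The (linear) action of $\Gamma$ is $\sigma_1$-semisymplectic if $\omega(\gamma u,\gamma v)=\sigma_1(\gamma)\omega(u,v)$ for all $\gamma\in\Gamma$, $u,v\in V$. $X$ is $\Gamma_{\sigma_2}$-equivariant if $X(\gamma x)=\sigma_2(\gamma)\gamma X(x)$ for all $\gamma\in\Gamma$, $x\in V$. Matrices and transposes are taken with respect to a fixed basis of $V$ that is orthonormal for some $\Gamma$-invariant inner product (one exists as $\Gamma$ is compact). The closure defining $\mathbf{S}$ is taken in $GL(2n)$, so $\mathbf{S}$ is a linear Lie group; it acts on $V$ by matrix multiplication, and it acts symplectically if $\omega(Au,Av)=\omega(u,v)$ for all $A\in\mathbf{S}$, $u,v\in V$. The semidirect product $\mathbf{S}\rtimes\Gamma$ acts on $V$ by $(e^{sL^T},\gamma)x=e^{sL^T}(\gamma x)=\gamma e^{\sigma_2(\gamma)sL^T}x$ (and in general $(A,\gamma)x=A(\gamma x)$ for $A\in\mathbf{S}$). The homomorphisms $\tilde\sigma_j:\mathbf{S}\rtimes\Gamma\to\mathbb{Z}_2$ are $\tilde\sigma_j(A,\gamma)=\sigma_j(\gamma)$, $j=1,2$, and $\tilde\sigma_1\tilde\sigma_2$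 is their pointwise product. $\mathcal{P}^k$ is the space of homogeneous polynomial functions $V\to\mathbb{R}$ of degree $k$. For a group $G$ acting on $V$ and a homomorphism $\sigma:G\to\mathbb{Z}_2$, $\mathcal{P}^k_\sigma(G)=\{f\in\mathcal{P}^k: f(gx)=\sigma(g)f(x)\ \forall g\in G,x\in V\}$. A vector field $Y$ (defined near the origin, vanishing there) is formally conjugated to $X$ if a power series of $Y$ is conjugated to a power series of $X$ as formal vector fields, i.e. there is a formal power series map $\hat\xi$ with zero constant term and invertible linear part such that $d\hat\xi\cdot\hat Y=\hat X\circ\hat\xi$, where $\hat X,\hat Y$ are the Taylor series at $0$. *)

theory Defs
  imports "HOL-Analysis.Analysis" "HOL-Library.Landau_Symbols" "HOL-Algebra.Group_Action"
begin

section \<open>Smooth maps\<close>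

text \<open>Only meant for open \<open>S\<close>; \<open>smooth_on\<close> is then the usual notion of a \<open>C\<close>-infinity map on \<open>S\<close>.\<close>

fun Ck_on :: "nat \<Rightarrow> 'a set \<Rightarrow> ('a::euclidean_space \<Rightarrow> 'b::real_normed_vector) \<Rightarrow> bool" where
  "Ck_on 0 S f \<longleftrightarrow> continuous_on S f"
| "Ck_on (Suc k) S f \<longleftrightarrow> (\<forall>x\<in>S. f differentiable (at x)) \<and>
     (\<forall>v. Ck_on k S (\<lambda>x. frechet_derivative f (at x) v))"

definition smooth_on :: "'a set \<Rightarrow> ('a::euclidean_space \<Rightarrow> 'b::real_normed_vector) \<Rightarrow> bool" where
  "smooth_on S f \<longleftrightarrow> (\<forall>k. Ck_on k S f)"

text \<open>Smoothness on an arbitrary set, by local smooth extension. It is used below for relatively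
  open subsets of a linear subspace, where it agrees with smoothness inside that subspace.\<close>

definition locally_extends_smooth :: "'a set \<Rightarrow> ('a::euclidean_space \<Rightarrow> 'b::real_normed_vector) \<Rightarrow> bool" where
  "locally_extends_smooth S f \<longleftrightarrow>
     (\<forall>x\<in>S. \<exists>U h. open U \<and> x \<in> U \<and> smooth_on U h \<and> (\<forall>y\<in>S \<inter> U. h y = f y))"


section \<open>Lie groups\<close>

text \<open>The model space of a manifold is a linear subspace \<open>E\<close> of a Euclidean space rather than the whole
  type, because types in class \<open>euclidean_space\<close> have positive dimension, while finite groups are
  Lie groups of dimension 0.\<close>

type_synonym ('g, 'e) chart = "'g set \<times> ('g \<Rightarrow> 'e)"

definition smooth_manifold :: "'e::euclidean_space set \<Rightarrow> 'g topology \<Rightarrow> ('g, 'e) chart set \<Rightarrow> bool" where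
  "smooth_manifold E T \<A> \<longleftrightarrow>
     subspace E \<and> Hausdorff_space T \<and> second_countable T \<and>
     (\<Union>(U, \<phi>)\<in>\<A>. U) = topspace T \<and>
     (\<forall>(U, \<phi>)\<in>\<A>. openin T U \<and> openin (top_of_set E) (\<phi> ` U) \<and>
        homeomorphic_map (subtopology T U) (top_of_set (\<phi> ` U)) \<phi>) \<and>
     (\<forall>(U, \<phi>)\<in>\<A>. \<forall>(W, \<psi>)\<in>\<A>. locally_extends_smooth (\<phi> ` (U \<inter> W)) (\<psi> \<circ> inv_into U \<phi>))"

definition smooth_map_between ::
  "'g topology \<Rightarrow> ('g, 'e::euclidean_space) chart set \<Rightarrow> 'h topology \<Rightarrow> ('h, 'f::euclidean_space) chart set
     \<Rightarrow> ('g \<Rightarrow> 'h) \<Rightarrow> bool" where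
  "smooth_map_between T \<A> T' \<A>' f \<longleftrightarrow> continuous_map T T' f \<and>
     (\<forall>(U, \<phi>)\<in>\<A>. \<forall>(W, \<psi>)\<in>\<A>'.
        locally_extends_smooth (\<phi> ` (U \<inter> f -` W)) (\<psi> \<circ> f \<circ> inv_into U \<phi>))"

definition product_atlas ::
  "('g, 'e) chart set \<Rightarrow> ('h, 'f) chart set \<Rightarrow> ('g \<times> 'h, 'e \<times> 'f) chart set" where
  "product_atlas \<A> \<B> = {(U \<times> W, map_prod \<phi> \<psi>) | U \<phi> W \<psi>. (U, \<phi>) \<in> \<A> \<and> (W, \<psi>) \<in> \<B>}"

definition Lie_group ::
  "('g, 'z) monoid_scheme \<Rightarrow> 'e::euclidean_space set \<Rightarrow> 'g topology \<Rightarrow> ('g, 'e) chart set \<Rightarrow> bool" where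
  "Lie_group \<Gamma> E T \<A> \<longleftrightarrow>
     group \<Gamma> \<and> topspace T = carrier \<Gamma> \<and> smooth_manifold E T \<A> \<and>
     smooth_map_between (prod_topology T T) (product_atlas \<A> \<A>) T \<A> (\<lambda>(g, h). g \<otimes>\<^bsub>\<Gamma>\<^esub> h) \<and>
     smooth_map_between T \<A> T \<A> (\<lambda>g. inv\<^bsub>\<Gamma>\<^esub> g)"

definition compact_Lie_group ::
  "('g, 'z) monoid_scheme \<Rightarrow> 'e::euclidean_space set \<Rightarrow> 'g topology \<Rightarrow> ('g, 'e) chart set \<Rightarrow> bool" where
  "compact_Lie_group \<Gamma> E T \<A> \<longleftrightarrow> Lie_group \<Gamma> E T \<A> \<and> compact_space T"

definition linear_Lie_action ::
  "('g, 'z) monoid_scheme \<Rightarrow> 'g topology \<Rightarrow> ('g \<Rightarrow> 'v \<Rightarrow> 'v::euclidean_space) \<Rightarrow> bool" where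
  "linear_Lie_action \<Gamma> T \<rho> \<longleftrightarrow> group_action \<Gamma> UNIV \<rho> \<and> (\<forall>\<gamma>\<in>carrier \<Gamma>. linear (\<rho> \<gamma>)) \<and>
     continuous_map (prod_topology T euclidean) euclidean (\<lambda>(\<gamma>, x). \<rho> \<gamma> x)"

text \<open>The multiplicative group \<open>{1, -1}\<close>.\<close>

definition Z2 :: "real monoid" where
  "Z2 = \<lparr>carrier = {1, -1}, mult = (*), one = 1\<rparr>"


section \<open>Symplectic linear algebra and Hamiltonian vector fields\<close>

definition symplectic_form :: "('v::euclidean_space \<Rightarrow> 'v \<Rightarrow> real) \<Rightarrow> bool" where
  "symplectic_form \<omega> \<longleftrightarrow> bilinear \<omega> \<and> (\<forall>u. \<omega> u u = 0) \<and> (\<forall>u. (\<forall>v. \<omega> u v = 0) \<longrightarrow> u = 0)"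

text \<open>The vector \<open>w\<close> with \<open>\<omega>(w, \<cdot>) = dH\<^sub>x\<close>; unique by non-degeneracy.\<close>

definition ham_field :: "('v::euclidean_space \<Rightarrow> 'v \<Rightarrow> real) \<Rightarrow> ('v \<Rightarrow> real) \<Rightarrow> 'v \<Rightarrow> 'v" where
  "ham_field \<omega> H x = (THE w. (H has_derivative \<omega> w) (at x))"

definition hamiltonian :: "('v::euclidean_space \<Rightarrow> 'v \<Rightarrow> real) \<Rightarrow> ('v \<Rightarrow> 'v) \<Rightarrow> bool" where
  "hamiltonian \<omega> X \<longleftrightarrow> (\<exists>H. smooth_on UNIV H \<and> X = ham_field \<omega> H)"

definition semisymplectic ::
  "('g, 'z) monoid_scheme \<Rightarrow> ('g \<Rightarrow> 'v \<Rightarrow> 'v::euclidean_space) \<Rightarrow> ('g \<Rightarrow> real) \<Rightarrow> ('v \<Rightarrow> 'v \<Rightarrow> real) \<Rightarrow> bool" where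
  "semisymplectic \<Gamma> \<rho> \<sigma> \<omega> \<longleftrightarrow> (\<forall>\<gamma>\<in>carrier \<Gamma>. \<forall>u v. \<omega> (\<rho> \<gamma> u) (\<rho> \<gamma> v) = \<sigma> \<gamma> * \<omega> u v)"

definition equivariant ::
  "('g, 'z) monoid_scheme \<Rightarrow> ('g \<Rightarrow> 'v \<Rightarrow> 'v::euclidean_space) \<Rightarrow> ('g \<Rightarrow> real) \<Rightarrow> ('v \<Rightarrow> 'v) \<Rightarrow> bool" where
  "equivariant \<Gamma> \<rho> \<sigma> X \<longleftrightarrow> (\<forall>\<gamma>\<in>carrier \<Gamma>. \<forall>x. X (\<rho> \<gamma> x) = \<sigma> \<gamma> *\<^sub>R \<rho> \<gamma> (X x))"

definition invariant_inner_product ::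
  "('g, 'z) monoid_scheme \<Rightarrow> ('g \<Rightarrow> 'v \<Rightarrow> 'v::euclidean_space) \<Rightarrow> ('v \<Rightarrow> 'v \<Rightarrow> real) \<Rightarrow> bool" where
  "invariant_inner_product \<Gamma> \<rho> ip \<longleftrightarrow>
     bilinear ip \<and> (\<forall>u v. ip u v = ip v u) \<and> (\<forall>u. u \<noteq> 0 \<longrightarrow> ip u u > 0) \<and>
     (\<forall>\<gamma>\<in>carrier \<Gamma>. \<forall>u v. ip (\<rho> \<gamma> u) (\<rho> \<gamma> v) = ip u v)"


section \<open>Matrices with respect to a basis, and the group \<open>S\<close>\<close>

definition indexed_basis :: "('m::finite \<Rightarrow> 'v::euclidean_space) \<Rightarrow> bool" where
  "indexed_basis b \<longleftrightarrow> inj b \<and> independent (range b) \<and> span (range b) = UNIV"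

definition coords :: "('m::finite \<Rightarrow> 'v::euclidean_space) \<Rightarrow> 'v \<Rightarrow> real ^ 'm" where
  "coords b x = (\<chi> i. representation (range b) x (b i))"

definition matrix_of :: "('m::finite \<Rightarrow> 'v::euclidean_space) \<Rightarrow> ('v \<Rightarrow> 'v) \<Rightarrow> real ^ 'm ^ 'm" where
  "matrix_of b f = (\<chi> i j. coords b (f (b j)) $ i)"

definition mat_act :: "('m::finite \<Rightarrow> 'v::euclidean_space) \<Rightarrow> real ^ 'm ^ 'm \<Rightarrow> 'v \<Rightarrow> 'v" where
  "mat_act b A x = (\<Sum>i\<in>UNIV. (A *v coords b x) $ i *\<^sub>R b i)"

definition mat_exp :: "real ^ 'm ^ 'm \<Rightarrow> real ^ 'm::finite ^ 'm" where
  "mat_exp A = (\<Sum>k. (((**) A ^^ k) (mat 1)) /\<^sub>R fact k)"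

text \<open>The closure is relative to the general linear group, hence the intersection.\<close>

definition S_group :: "('m::finite \<Rightarrow> 'v::euclidean_space) \<Rightarrow> ('v \<Rightarrow> 'v) \<Rightarrow> (real ^ 'm ^ 'm) set" where
  "S_group b L =
     closure {mat_exp (s *\<^sub>R transpose (matrix_of b L)) | s. s \<in> (UNIV :: real set)} \<inter> {A. invertible A}"

definition acts_symplectically ::
  "('m::finite \<Rightarrow> 'v::euclidean_space) \<Rightarrow> (real ^ 'm ^ 'm) set \<Rightarrow> ('v \<Rightarrow> 'v \<Rightarrow> real) \<Rightarrow> bool" where
  "acts_symplectically b S \<omega> \<longleftrightarrow> (\<forall>A\<in>S. \<forall>u v. \<omega> (mat_act b A u) (mat_act b A v) = \<omega> u v)"

text \<open>\<open>\<Gamma>\<close> acts on \<open>S\<close> by conjugation, which is the product for which \<open>(A, \<gamma>) x = A (\<gamma> x)\<close> is an action.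
  The relation \<open>\<gamma> e\<^bsup>tL'\<^esup> \<gamma>\<^sup>-\<^sup>1 = e\<^bsup>\<sigma>\<^sub>2(\<gamma>)tL'\<^esup>\<close> (\<open>L'\<close> the transpose of \<open>L\<close>) is a consequence of
  the equivariance of \<open>X\<close> and of the orthogonality of the basis.\<close>

definition semidirect ::
  "('m::finite \<Rightarrow> 'v::euclidean_space) \<Rightarrow> ('g \<Rightarrow> 'v \<Rightarrow> 'v) \<Rightarrow> (real ^ 'm ^ 'm) set \<Rightarrow> ('g, 'z) monoid_scheme
     \<Rightarrow> ((real ^ 'm ^ 'm) \<times> 'g) monoid" where
  "semidirect b \<rho> S \<Gamma> =
     \<lparr>carrier = S \<times> carrier \<Gamma>,
      mult = (\<lambda>(A, \<gamma>) (B, \<delta>).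
        (A ** (matrix_of b (\<rho> \<gamma>) ** B ** matrix_of b (\<rho> (inv\<^bsub>\<Gamma>\<^esub> \<gamma>))), \<gamma> \<otimes>\<^bsub>\<Gamma>\<^esub> \<delta>)),
      one = (mat 1, \<one>\<^bsub>\<Gamma>\<^esub>)\<rparr>"

definition semidirect_act ::
  "('m::finite \<Rightarrow> 'v::euclidean_space) \<Rightarrow> ('g \<Rightarrow> 'v \<Rightarrow> 'v) \<Rightarrow> (real ^ 'm ^ 'm) \<times> 'g \<Rightarrow> 'v \<Rightarrow> 'v" where
  "semidirect_act b \<rho> = (\<lambda>(A, \<gamma>) x. mat_act b A (\<rho> \<gamma> x))"

definition tilde :: "('g \<Rightarrow> real) \<Rightarrow> (real ^ 'm ^ 'm) \<times> 'g \<Rightarrow> real" where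
  "tilde \<sigma> = (\<lambda>(A, \<gamma>). \<sigma> \<gamma>)"


section \<open>Homogeneous polynomials and formal power series maps\<close>

definition homogeneous_poly :: "nat \<Rightarrow> ('v::euclidean_space \<Rightarrow> 'w::real_normed_vector) \<Rightarrow> bool" where
  "homogeneous_poly k f \<longleftrightarrow> polynomial_function f \<and> (\<forall>c x. f (c *\<^sub>R x) = c ^ k *\<^sub>R f x)"

definition sym_poly ::
  "nat \<Rightarrow> ('g, 'z) monoid_scheme \<Rightarrow> ('g \<Rightarrow> 'v \<Rightarrow> 'v::euclidean_space) \<Rightarrow> ('g \<Rightarrow> real) \<Rightarrow> ('v \<Rightarrow> real) set" where
  "sym_poly k G \<rho> \<sigma> = {f. homogeneous_poly k f \<and> (\<forall>g\<in>carrier G. \<forall>x. f (\<rho> g x) = \<sigma> g * f x)}"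

text \<open>A formal power series map is given by the sequence of its homogeneous components.\<close>

type_synonym 'v formal_map = "nat \<Rightarrow> 'v \<Rightarrow> 'v"

definition formal_map :: "'v::euclidean_space formal_map \<Rightarrow> bool" where
  "formal_map F \<longleftrightarrow> (\<forall>k. homogeneous_poly k (F k))"

text \<open>The degree \<open>k\<close> component \<open>D\<^sup>k f(0)(x, \<dots>, x) / k!\<close> of the Taylor series at \<open>0\<close>.\<close>

definition taylor :: "('v::euclidean_space \<Rightarrow> 'v) \<Rightarrow> 'v formal_map" where
  "taylor f k x = ((\<lambda>h y. frechet_derivative h (at y) x) ^^ k) f 0 /\<^sub>R fact k"

text \<open>For \<open>G 0 = 0\<close>, the terms of \<open>F\<close> and \<open>G\<close> of degree above \<open>m\<close> do not contribute to the
  degree \<open>m\<close> component of \<open>F \<circ> G\<close>.\<close>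

definition formal_compose :: "'v::euclidean_space formal_map \<Rightarrow> 'v formal_map \<Rightarrow> 'v formal_map" where
  "formal_compose F G m = taylor (\<lambda>x. \<Sum>j\<le>m. F j (\<Sum>k\<le>m. G k x)) m"

text \<open>\<open>d\<xi> \<cdot> Y\<close>: the derivative of the degree \<open>i + 1\<close> component is homogeneous of degree \<open>i\<close>.\<close>

definition formal_deriv_apply :: "'v::euclidean_space formal_map \<Rightarrow> 'v formal_map \<Rightarrow> 'v formal_map" where
  "formal_deriv_apply \<xi> Y m x = (\<Sum>i\<le>m. frechet_derivative (\<xi> (Suc i)) (at x) (Y (m - i) x))"

definition formally_conjugate :: "('v::euclidean_space \<Rightarrow> 'v) \<Rightarrow> ('v \<Rightarrow> 'v) \<Rightarrow> bool" where
  "formally_conjugate Y X \<longleftrightarrow>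
     (\<exists>\<xi>. formal_map \<xi> \<and> \<xi> 0 = (\<lambda>x. 0) \<and> bij (\<xi> 1) \<and>
        formal_deriv_apply \<xi> (taylor Y) = formal_compose (taylor X) \<xi>)"

end

theory Submission
  imports Defs
begin

text \<open>
  Let \<open>X = X\<^sub>H\<close> with \<open>H(0) = 0\<close>; then \<open>H \<circ> \<gamma> = \<sigma>\<^sub>1(\<gamma>) \<sigma>\<^sub>2(\<gamma>) H\<close>. For a function \<open>P = O(|x|\<^sup>3)\<close> put
  \<open>A\<^sub>\<plusminus>(x) = x \<plusminus> X\<^sub>P(x)/2\<close>. As the Hessian of \<open>P\<close> is symmetric, \<open>A\<^sub>+\<close> and \<open>A\<^sub>-\<close> pull \<open>\<omega>\<close> back to
  the same form, so \<open>\<phi> = A\<^sub>+ \<circ> A\<^sub>-\<^sup>-\<^sup>1\<close> (the implicit midpoint rule) is a symplectic local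
  diffeomorphism and conjugates \<open>X\<close> to \<open>Y = X\<^bsub>H\<circ>\<phi>\<^esub>\<close>. It thus suffices to find \<open>P\<close> and polynomials \<open>K\<^sup>k\<close>
  with \<open>H \<circ> A\<^sub>+ = (H\<^sub>2 + K\<^sup>3 + \<dots> + K\<^sup>r) \<circ> A\<^sub>- + O(|x|\<^sup>r\<^sup>+\<^sup>1)\<close>, where \<open>H\<^sub>2(x) = \<omega>(Lx, x)/2\<close>, which is done degree by degree.
  Adding a homogeneous \<open>Q\<close> to \<open>P\<close> changes the lowest-order part of the difference of the two sides by
  \<open>-dQ(x)(Lx)\<close>. The operators \<open>Q \<mapsto> dQ(x)(Lx)\<close> and \<open>Q \<mapsto> dQ(x)(L\<^sup>Tx)\<close> are adjoint for
  the Fischer product, so this part is \<open>dQ(x)(Lx) + K(x)\<close> with \<open>Q\<close> in the image and \<open>K\<close> in the kernel of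
  the second operator. Both are unique, so they inherit the \<open>\<Gamma>\<close>-symmetry, and \<open>K\<close> is constant
  along the flow of \<open>L\<^sup>T\<close>, hence \<open>\<^bold>S\<close>-invariant.
\<close>

section \<open>Directional derivatives and smooth functions\<close>

text \<open>The coordinate change has to be exactly symplectic: a truncated one would in general
  destroy the Hamiltonian form of the transformed field. The time-one flow of \<open>P\<close> would
  serve, but needs smooth dependence of flows on initial values; the midpoint map needs only the
  inverse function theorem. Comparing the two Hamiltonians before the inverse of A_- is applied
  keeps the induction among globally defined functions, and that inverse is formed once, at the end.
  The factor 1/2 occurs with both signs, and each side contributes half of the correction
  -dQ(x)(Lx).

  \<open>P\<close> transforms with \<sigma>1 and \<open>H\<close> with \<sigma>1 \<sigma>2: then X_P
  commutes with the action, and the operator dQ(x)(Lx), to which L adds a factor \<sigma>2, maps the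
  first class into the second. Errors are orders of vanishing (\<open>flat\<close>) of actual smooth
  functions; formal series appear only when the conjugacy is read off from Taylor terms. Order r+1
  for the Hamiltonian becomes order r for the field.\<close>

definition dird :: "'a \<Rightarrow> ('a::euclidean_space \<Rightarrow> 'b::real_normed_vector) \<Rightarrow> 'a \<Rightarrow> 'b" where
  "dird v f = (\<lambda>x. frechet_derivative f (at x) v)"

lemma dird_eq: "(f has_derivative f') (at x) \<Longrightarrow> dird v f x = f' v"
  unfolding dird_def by (metis frechet_derivative_at)

lemma has_derivative_dird:
  "f differentiable (at x) \<Longrightarrow> (f has_derivative (\<lambda>v. dird v f x)) (at x)"
  unfolding dird_def by (simp add: frechet_derivative_works)

lemma linear_dird: "f differentiable (at x) \<Longrightarrow> linear (\<lambda>v. dird v f x)"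
  unfolding dird_def by (simp add: linear_frechet_derivative)

text \<open>Stands in for the recursive equation of \<open>Ck_on\<close>, which leaves the simp set
  below, so that all derivatives stay in the form \<open>dird\<close>.\<close>

lemma Ck_on_Suc_iff:
  "Ck_on (Suc k) S f \<longleftrightarrow> (\<forall>x\<in>S. f differentiable (at x)) \<and> (\<forall>v. Ck_on k S (dird v f))"
  by (simp add: dird_def)

declare Ck_on.simps(2) [simp del]

text \<open>\<open>f\<close> and \<open>g\<close> have the same derivatives at \<open>x\<close>, so
  the choice operator in \<open>frechet_derivative\<close> picks the same one.\<close>

lemma dird_cong_open:
  assumes "open S" "\<And>x. x \<in> S \<Longrightarrow> f x = g x" "x \<in> S"
  shows "dird v f x = dird v g x"
proof -
  have "(f has_derivative D) (at x) \<longleftrightarrow> (g has_derivative D) (at x)" for D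
    using has_derivative_transform_within_open[of f D x UNIV S g]
      has_derivative_transform_within_open[of g D x UNIV S f] assms by auto
  then show ?thesis by (simp add: dird_def frechet_derivative_def)
qed

lemma differentiable_cong_open:
  assumes "open S" "\<And>x. x \<in> S \<Longrightarrow> f x = g x" "x \<in> S" "f differentiable (at x)"
  shows "g differentiable (at x)"
  using assms has_derivative_transform_within_open unfolding differentiable_def by blast

section \<open>Closure properties of C^k maps on open sets\<close>

lemma Ck_on_cong:
  assumes "open S" "\<And>x. x \<in> S \<Longrightarrow> f x = g x" "Ck_on k S f"
  shows "Ck_on k S g"
  using assms(2,3)
proof (induction k arbitrary: f g)
  case 0
  then show ?case using continuous_on_cong by force
next
  case (Suc k)
  have "Ck_on k S (dird v g)" for v
    by (rule Suc.IH[of "dird v f"]) (use Suc.prems dird_cong_open[OF assms(1), of f g] in \<open>auto simp: Ck_on_Suc_iff\<close>)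
  then show ?case
    using Suc.prems differentiable_cong_open[OF assms(1), of f g] by (auto simp: Ck_on_Suc_iff)
qed

lemma Ck_on_SucD: "Ck_on (Suc k) S f \<Longrightarrow> Ck_on k S f"
proof (induction k arbitrary: f)
  case 0
  then show ?case
    by (auto simp: Ck_on_Suc_iff intro!: continuous_at_imp_continuous_on differentiable_imp_continuous_within)
next
  case (Suc k)
  then show ?case by (metis Ck_on_Suc_iff)
qed

lemma Ck_on_subset: "Ck_on k S f \<Longrightarrow> T \<subseteq> S \<Longrightarrow> Ck_on k T f"
  by (induction k arbitrary: f) (auto simp: Ck_on_Suc_iff intro: continuous_on_subset)

lemma Ck_on_const: "Ck_on k S (\<lambda>x. c)"
proof (induction k arbitrary: c)
  case (Suc k)
  have "dird v (\<lambda>x. c) = (\<lambda>x. 0)" for v :: 'a by (simp add: dird_def)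
  then show ?case using Suc by (simp add: Ck_on_Suc_iff)
qed auto

lemma dird_bounded_linear: "bounded_linear f \<Longrightarrow> dird v f = (\<lambda>x. f v)"
  by (rule ext, rule dird_eq, rule bounded_linear_imp_has_derivative)

lemma Ck_on_bounded_linear: "bounded_linear f \<Longrightarrow> Ck_on k S f"
  by (cases k) (auto simp: Ck_on_Suc_iff dird_bounded_linear Ck_on_const
      intro: linear_continuous_on bounded_linear_imp_differentiable)

lemma dird_add:
  "f differentiable (at x) \<Longrightarrow> g differentiable (at x) \<Longrightarrow>
    dird v (\<lambda>x. f x + g x) x = dird v f x + dird v g x"
  by (rule dird_eq) (intro has_derivative_add has_derivative_dird)

lemma Ck_on_add:
  assumes "open S" "Ck_on k S f" "Ck_on k S g"
  shows "Ck_on k S (\<lambda>x. f x + g x)"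
  using assms(2,3)
proof (induction k arbitrary: f g)
  case 0
  then show ?case by (auto intro: continuous_on_add)
next
  case (Suc k)
  have "Ck_on k S (dird v (\<lambda>x. f x + g x))" for v
    by (rule Ck_on_cong[OF assms(1), of "\<lambda>x. dird v f x + dird v g x"])
      (use Suc in \<open>auto simp: dird_add Ck_on_Suc_iff\<close>)
  then show ?case using Suc.prems by (auto simp: Ck_on_Suc_iff)
qed

lemma dird_linear_compose:
  assumes "bounded_linear h" "f differentiable (at x)"
  shows "dird v (\<lambda>x. h (f x)) x = h (dird v f x)"
  by (rule dird_eq) (intro bounded_linear.has_derivative[OF assms(1)] has_derivative_dird assms)

lemma dird_bilinear:
  assumes "bounded_bilinear B" "f differentiable (at x)" "g differentiable (at x)"
  shows "dird v (\<lambda>x. B (f x) (g x)) x = B (f x) (dird v g x) + B (dird v f x) (g x)"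
  by (rule dird_eq) (intro bounded_bilinear.FDERIV[OF assms(1)] has_derivative_dird assms)

lemma Ck_on_bilinear:
  assumes B: "bounded_bilinear B" and "open S" "Ck_on k S f" "Ck_on k S g"
  shows "Ck_on k S (\<lambda>x. B (f x) (g x))"
  using assms(3,4)
proof (induction k arbitrary: f g)
  case 0
  then show ?case by (auto intro: bounded_bilinear.continuous_on[OF B])
next
  case (Suc k)
  have "Ck_on k S (dird v (\<lambda>x. B (f x) (g x)))" for v
    by (rule Ck_on_cong[OF assms(2), of "\<lambda>x. B (f x) (dird v g x) + B (dird v f x) (g x)"])
      (use Suc Ck_on_SucD[OF Suc.prems(1)] Ck_on_SucD[OF Suc.prems(2)] in
        \<open>auto simp: dird_bilinear[OF B] Ck_on_Suc_iff intro!: Ck_on_add assms\<close>)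
  then show ?case using Suc.prems
    by (auto simp: Ck_on_Suc_iff differentiable_def dest!: bspec intro: bounded_bilinear.FDERIV[OF B])
qed

lemma Ck_on_linear_compose:
  assumes h: "bounded_linear h" and "open S" "Ck_on k S f"
  shows "Ck_on k S (\<lambda>x. h (f x))"
  using assms(3)
proof (induction k arbitrary: f)
  case 0
  then show ?case by (auto intro: bounded_linear.continuous_on[OF h])
next
  case (Suc k)
  have "Ck_on k S (dird v (\<lambda>x. h (f x)))" for v
    by (rule Ck_on_cong[OF assms(2), of "\<lambda>x. h (dird v f x)"])
      (use Suc in \<open>auto simp: dird_linear_compose[OF h] Ck_on_Suc_iff\<close>)
  then show ?case using Suc.prems
    by (auto simp: Ck_on_Suc_iff differentiable_def dest!: bspec intro: bounded_linear.has_derivative[OF h])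
qed

lemma Ck_on_sum:
  assumes "open S" "\<And>i. i \<in> I \<Longrightarrow> Ck_on k S (f i)"
  shows "Ck_on k S (\<lambda>x. \<Sum>i\<in>I. f i x)"
  using assms(2) by (induction I rule: infinite_finite_induct) (auto intro: Ck_on_const Ck_on_add assms(1))

text \<open>Serves to trade a direction that varies with the point for finitely many fixed basis
  directions with scalar coefficients.\<close>

lemma linear_expand:
  fixes f :: "'a::euclidean_space \<Rightarrow> 'b::real_vector"
  assumes "linear f"
  shows "f x = (\<Sum>i\<in>Basis. (x \<bullet> i) *\<^sub>R f i)"
  by (subst (1) euclidean_representation[of x, symmetric])
    (simp add: linear_sum[OF assms] linear_cmul[OF assms])

lemma dird_compose:
  fixes g :: "'a::euclidean_space \<Rightarrow> 'b::euclidean_space"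
  assumes "g differentiable (at x)" "f differentiable (at (g x))"
  shows "dird v (\<lambda>x. f (g x)) x = dird (dird v g x) f (g x)"
  using diff_chain_at[OF has_derivative_dird[OF assms(1)] has_derivative_dird[OF assms(2)]]
  by (intro dird_eq[of _ "\<lambda>v. dird (dird v g x) f (g x)"]) (simp add: o_def)

lemma dird_expand:
  "f differentiable (at x) \<Longrightarrow> dird v f x = (\<Sum>i\<in>Basis. (v \<bullet> i) *\<^sub>R dird i f x)"
  by (rule linear_expand[OF linear_dird])

text \<open>The chain rule differentiates \<open>f\<close> in the direction
  \<open>dird v g x\<close>, which moves with \<open>x\<close>; expanding it in the basis leaves
  fixed directions, to which the induction hypothesis applies.\<close>

lemma Ck_on_compose:
  fixes g :: "'a::euclidean_space \<Rightarrow> 'b::euclidean_space"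
  assumes S: "open S" and T: "open T" and "g ` S \<subseteq> T" "Ck_on k T f" "Ck_on k S g"
  shows "Ck_on k S (\<lambda>x. f (g x))"
  using assms(3,4,5)
proof (induction k arbitrary: f)
  case 0
  then show ?case by (auto intro: continuous_on_compose2)
next
  case (Suc k)
  then have d: "\<And>x. x \<in> S \<Longrightarrow> g differentiable (at x)" "\<And>x. x \<in> S \<Longrightarrow> f differentiable (at (g x))"
    by (auto simp: Ck_on_Suc_iff)
  have "Ck_on k S (dird v (\<lambda>x. f (g x)))" for v
  proof (rule Ck_on_cong[OF S])
    show "(\<Sum>i\<in>Basis. (dird v g x \<bullet> i) *\<^sub>R dird i f (g x)) = dird v (\<lambda>x. f (g x)) x" if "x \<in> S" for x
      using d[OF that] by (simp add: dird_compose dird_expand[of f "g x" "dird v g x"])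
    have "Ck_on k S (\<lambda>x. dird i f (g x))" for i
      by (rule Suc.IH) (use Suc.prems Ck_on_SucD[OF Suc.prems(3)] in \<open>auto simp: Ck_on_Suc_iff\<close>)
    moreover have "Ck_on k S (\<lambda>x. dird v g x \<bullet> i)" for i
      by (rule Ck_on_linear_compose[OF bounded_linear_inner_left S]) (use Suc.prems in \<open>auto simp: Ck_on_Suc_iff\<close>)
    ultimately show "Ck_on k S (\<lambda>x. \<Sum>i\<in>Basis. (dird v g x \<bullet> i) *\<^sub>R dird i f (g x))"
      by (intro Ck_on_sum S Ck_on_bilinear[OF bounded_bilinear_scaleR S])
  qed
  moreover have "\<forall>x\<in>S. (\<lambda>x. f (g x)) differentiable (at x)"
    using d differentiable_chain_at[of g _ f] by (auto simp: o_def)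
  ultimately show ?case by (simp add: Ck_on_Suc_iff)
qed

section \<open>Calculus of smooth maps and of their directional derivatives\<close>

lemma smooth_on_dird: "smooth_on S f \<Longrightarrow> smooth_on S (dird v f)"
  unfolding smooth_on_def by (metis Ck_on_Suc_iff)

lemma smooth_on_differentiable: "smooth_on S f \<Longrightarrow> x \<in> S \<Longrightarrow> f differentiable (at x)"
  unfolding smooth_on_def by (metis Ck_on_Suc_iff)

lemma smooth_on_continuous: "smooth_on S f \<Longrightarrow> continuous_on S f"
  unfolding smooth_on_def by (metis Ck_on.simps(1))

lemma smooth_on_cong:
  "smooth_on S f \<Longrightarrow> open S \<Longrightarrow> (\<And>x. x \<in> S \<Longrightarrow> f x = g x) \<Longrightarrow> smooth_on S g"
  unfolding smooth_on_def using Ck_on_cong by blast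

lemma smooth_on_subset: "smooth_on S f \<Longrightarrow> T \<subseteq> S \<Longrightarrow> smooth_on T f"
  unfolding smooth_on_def using Ck_on_subset by blast

lemma smooth_on_const: "smooth_on S (\<lambda>x. c)"
  unfolding smooth_on_def using Ck_on_const by blast

lemma smooth_on_bounded_linear: "bounded_linear f \<Longrightarrow> smooth_on S f"
  unfolding smooth_on_def using Ck_on_bounded_linear by blast

lemma smooth_on_ident: "smooth_on S (\<lambda>x. x)"
  by (rule smooth_on_bounded_linear) (rule bounded_linear_ident)

lemma smooth_on_add: "open S \<Longrightarrow> smooth_on S f \<Longrightarrow> smooth_on S g \<Longrightarrow> smooth_on S (\<lambda>x. f x + g x)"
  unfolding smooth_on_def using Ck_on_add by blast

lemma smooth_on_bilinear:
  "bounded_bilinear B \<Longrightarrow> open S \<Longrightarrow> smooth_on S f \<Longrightarrow> smooth_on S g \<Longrightarrow> smooth_on S (\<lambda>x. B (f x) (g x))"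
  unfolding smooth_on_def using Ck_on_bilinear by blast

lemma smooth_on_linear_compose:
  "bounded_linear h \<Longrightarrow> open S \<Longrightarrow> smooth_on S f \<Longrightarrow> smooth_on S (\<lambda>x. h (f x))"
  unfolding smooth_on_def using Ck_on_linear_compose by blast

lemma smooth_on_sum:
  "open S \<Longrightarrow> (\<And>i. i \<in> I \<Longrightarrow> smooth_on S (f i)) \<Longrightarrow> smooth_on S (\<lambda>x. \<Sum>i\<in>I. f i x)"
  unfolding smooth_on_def using Ck_on_sum[of S I _ f] by blast

lemma smooth_on_compose:
  fixes g :: "'a::euclidean_space \<Rightarrow> 'b::euclidean_space"
  shows "smooth_on T f \<Longrightarrow> smooth_on S g \<Longrightarrow> open S \<Longrightarrow> open T \<Longrightarrow> g ` S \<subseteq> T \<Longrightarrow> smooth_on S (\<lambda>x. f (g x))"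
  unfolding smooth_on_def using Ck_on_compose by blast

lemma smooth_on_scaleR:
  "open S \<Longrightarrow> smooth_on S f \<Longrightarrow> smooth_on S (\<lambda>x. c *\<^sub>R f x)"
  by (rule smooth_on_linear_compose[OF bounded_linear_scaleR_right])

lemma smooth_on_diff: "open S \<Longrightarrow> smooth_on S f \<Longrightarrow> smooth_on S g \<Longrightarrow> smooth_on S (\<lambda>x. f x - g x)"
  using smooth_on_add[of S f "\<lambda>x. (-1) *\<^sub>R g x"] smooth_on_scaleR[of S g "-1"] by simp

lemma dird_scaleR:
  "f differentiable (at x) \<Longrightarrow> dird v (\<lambda>x. c *\<^sub>R f x) x = c *\<^sub>R dird v f x"
  by (rule dird_linear_compose[OF bounded_linear_scaleR_right])

lemma dird_diff:
  "f differentiable (at x) \<Longrightarrow> g differentiable (at x) \<Longrightarrow>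
    dird v (\<lambda>x. f x - g x) x = dird v f x - dird v g x"
  by (rule dird_eq) (intro has_derivative_diff has_derivative_dird)

lemma dird_sum:
  "(\<And>i. i \<in> I \<Longrightarrow> f i differentiable (at x)) \<Longrightarrow>
    dird v (\<lambda>x. \<Sum>i\<in>I. f i x) x = (\<Sum>i\<in>I. dird v (f i) x)"
  by (rule dird_eq) (intro has_derivative_sum has_derivative_dird)

lemma dird_arg:
  assumes "f differentiable (at x)"
  shows dird_add_arg: "dird (v + w) f x = dird v f x + dird w f x"
    and dird_scaleR_arg: "dird (c *\<^sub>R v) f x = c *\<^sub>R dird v f x"
    and dird_sum_arg: "dird (\<Sum>i\<in>I. a i *\<^sub>R b i) f x = (\<Sum>i\<in>I. a i *\<^sub>R dird (b i) f x)"
proof -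
  interpret linear "\<lambda>v. dird v f x" by (rule linear_dird[OF assms])
  show "dird (v + w) f x = dird v f x + dird w f x" "dird (c *\<^sub>R v) f x = c *\<^sub>R dird v f x"
    "dird (\<Sum>i\<in>I. a i *\<^sub>R b i) f x = (\<Sum>i\<in>I. a i *\<^sub>R dird (b i) f x)"
    by (simp_all only: add scale sum)
qed

lemma smooth_on_real_polynomial: "real_polynomial_function f \<Longrightarrow> smooth_on UNIV f"
  by (induction rule: real_polynomial_function.induct)
    (auto intro: smooth_on_const smooth_on_add smooth_on_bounded_linear smooth_on_bilinear[OF bounded_bilinear_mult])

lemma smooth_on_euclidean:
  fixes f :: "'a::euclidean_space \<Rightarrow> 'b::euclidean_space"
  assumes "open S" "\<And>i. i \<in> Basis \<Longrightarrow> smooth_on S (\<lambda>x. f x \<bullet> i)"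
  shows "smooth_on S f"
proof -
  have "smooth_on S (\<lambda>x. \<Sum>i\<in>Basis. (f x \<bullet> i) *\<^sub>R i)"
    by (intro smooth_on_sum assms smooth_on_linear_compose[OF bounded_linear_scaleR_left])
  then show ?thesis by (simp add: euclidean_representation)
qed

lemma smooth_on_polynomial:
  fixes f :: "'a::euclidean_space \<Rightarrow> 'b::euclidean_space"
  assumes "polynomial_function f"
  shows "smooth_on UNIV f"
proof (rule smooth_on_euclidean)
  show "smooth_on UNIV (\<lambda>x. f x \<bullet> i)" for i
    using assms bounded_linear_inner_left[of i] unfolding polynomial_function_def o_def
    by (blast intro: smooth_on_real_polynomial)
qed auto

section \<open>Symmetry of second derivatives and Taylor terms\<close>

lemma dird_along_line:
  assumes "f differentiable (at (x + t *\<^sub>R u))"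
  shows "((\<lambda>t. f (x + t *\<^sub>R u)) has_vector_derivative dird u f (x + t *\<^sub>R u)) (at t)"
proof -
  have "((\<lambda>t. x + t *\<^sub>R u) has_derivative (\<lambda>h. h *\<^sub>R u)) (at t)"
    by (auto intro!: derivative_eq_intros)
  from diff_chain_at[OF this has_derivative_dird[OF assms]]
  show ?thesis
    using assms by (simp add: o_def has_vector_derivative_def dird_scaleR_arg)
qed

text \<open>Mean value theorem twice: in direction \<open>u\<close> for the difference of two
  parallel segments, then in direction \<open>v\<close> for \<open>dird u f\<close>.\<close>

lemma second_difference_mvt:
  fixes f :: "'a::euclidean_space \<Rightarrow> real"
  assumes f: "smooth_on S f" and s: "s > 0"
    and sub: "\<And>p q. p \<in> {0..s} \<Longrightarrow> q \<in> {0..s} \<Longrightarrow> x + p *\<^sub>R u + q *\<^sub>R v \<in> S"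
  shows "\<exists>p\<in>{0..s}. \<exists>q\<in>{0..s}.
    f (x + s *\<^sub>R u + s *\<^sub>R v) - f (x + s *\<^sub>R u) - f (x + s *\<^sub>R v) + f x = s\<^sup>2 * dird v (dird u f) (x + p *\<^sub>R u + q *\<^sub>R v)"
proof -
  define a where "a = (\<lambda>t. f (x + s *\<^sub>R v + t *\<^sub>R u) - f (x + t *\<^sub>R u))"
  have m: "x + p *\<^sub>R u + q *\<^sub>R v \<in> S" "x + q *\<^sub>R v + p *\<^sub>R u \<in> S" "x + p *\<^sub>R u \<in> S" if "p \<in> {0..s}" "q \<in> {0..s}" for p q
    using sub[OF that] sub[of p 0] that s by (simp_all add: add_ac)
  have "DERIV a t :> dird u f (x + s *\<^sub>R v + t *\<^sub>R u) - dird u f (x + t *\<^sub>R u)" if "0 \<le> t" "t \<le> s" for t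
    unfolding a_def using m[of t s] that s
    by (intro DERIV_diff) (auto simp: has_real_derivative_iff_has_vector_derivative
        intro!: dird_along_line smooth_on_differentiable[OF f])
  from MVT2[OF s this] obtain p where p: "0 < p" "p < s"
    "a s - a 0 = s * (dird u f (x + s *\<^sub>R v + p *\<^sub>R u) - dird u f (x + p *\<^sub>R u))" by auto
  have "DERIV (\<lambda>t. dird u f (x + p *\<^sub>R u + t *\<^sub>R v)) t :> dird v (dird u f) (x + p *\<^sub>R u + t *\<^sub>R v)" if "0 \<le> t" "t \<le> s" for t
    using m[of p t] that p s
    by (auto simp: has_real_derivative_iff_has_vector_derivative
        intro!: dird_along_line smooth_on_differentiable[OF smooth_on_dird[OF f]])
  from MVT2[OF s this] obtain q where q: "0 < q" "q < s"
    "dird u f (x + p *\<^sub>R u + s *\<^sub>R v) - dird u f (x + p *\<^sub>R u) = s * dird v (dird u f) (x + p *\<^sub>R u + q *\<^sub>R v)" by auto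
  have "f (x + s *\<^sub>R u + s *\<^sub>R v) - f (x + s *\<^sub>R u) - f (x + s *\<^sub>R v) + f x = a s - a 0"
    by (simp add: a_def add_ac)
  also have "\<dots> = s\<^sup>2 * dird v (dird u f) (x + p *\<^sub>R u + q *\<^sub>R v)"
    using p(3) q(3) by (simp add: power2_eq_square add_ac)
  finally show ?thesis using p q by (intro bexI[of _ p] bexI[of _ q]) auto
qed

text \<open>The second difference is symmetric in \<open>u\<close> and \<open>v\<close>, so a value
  of one mixed derivative near \<open>x\<close> equals a value of the other near \<open>x\<close>;
  continuity does the rest.\<close>

lemma dird_commute_real:
  fixes f :: "'a::euclidean_space \<Rightarrow> real"
  assumes S: "open S" and x: "x \<in> S" and f: "smooth_on S f"
  shows "dird v (dird u f) x = dird u (dird v f) x"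
proof (rule ccontr)
  let ?F = "dird v (dird u f)" and ?G = "dird u (dird v f)"
  assume "?F x \<noteq> ?G x"
  define e where "e = \<bar>?F x - ?G x\<bar> / 2"
  have e: "e > 0" using \<open>?F x \<noteq> ?G x\<close> by (simp add: e_def)
  have "isCont ?F x" "isCont ?G x"
    using S x smooth_on_continuous[OF smooth_on_dird[OF smooth_on_dird[OF f]]]
    by (auto simp: continuous_on_eq_continuous_at)
  then obtain d1 d2 where d: "d1 > 0" "d2 > 0" "\<And>y. dist y x < d1 \<Longrightarrow> dist (?F y) (?F x) < e"
     "\<And>y. dist y x < d2 \<Longrightarrow> dist (?G y) (?G x) < e"
    using e unfolding continuous_at_eps_delta by (metis dist_norm)
  obtain d3 where d3: "d3 > 0" "ball x d3 \<subseteq> S" using S x open_contains_ball by blast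
  define d where "d = min d1 (min d2 d3)"
  \<comment> \<open>\<open>s\<close> is chosen with s M = d/2, which keeps the whole parallelogram
    with sides s u and s v within \<open>d\<close> of \<open>x\<close>; the 1 makes \<open>M\<close>
    positive.\<close>
  define M where "M = norm u + norm v + 1"
  define s where "s = d / (2 * M)"
  have M: "M > 0" by (simp add: M_def add_nonneg_pos)
  have dp: "d > 0" using d d3 by (simp add: d_def)
  have s: "s > 0" using M dp by (simp add: s_def)
  have near: "dist (x + p *\<^sub>R u + q *\<^sub>R v) x < d" if "p \<in> {0..s}" "q \<in> {0..s}" for p q
  proof -
    have "dist (x + p *\<^sub>R u + q *\<^sub>R v) x = norm (p *\<^sub>R u + q *\<^sub>R v)"
      by (simp add: dist_norm add.assoc)
    also have "\<dots> \<le> p * norm u + q * norm v"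
      using that by (intro order_trans[OF norm_triangle_ineq]) auto
    also have "\<dots> \<le> s * norm u + s * norm v" using that by (intro add_mono mult_right_mono) auto
    also have "\<dots> \<le> s * M" using s by (simp add: M_def distrib_left)
    also have "\<dots> < d" using M dp by (simp add: s_def)
    finally show ?thesis .
  qed
  have "x + p *\<^sub>R u + q *\<^sub>R v \<in> S" if "p \<in> {0..s}" "q \<in> {0..s}" for p q
    using near[OF that] d3 by (auto simp: d_def dist_commute subset_iff)
  from second_difference_mvt[OF f s, of x u v, OF this] second_difference_mvt[OF f s, of x v u]
  obtain p q p' q' where pq: "p \<in> {0..s}" "q \<in> {0..s}" "p' \<in> {0..s}" "q' \<in> {0..s}"
    "s\<^sup>2 * ?F (x + p *\<^sub>R u + q *\<^sub>R v) = s\<^sup>2 * ?G (x + q' *\<^sub>R u + p' *\<^sub>R v)"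
    using \<open>\<And>q p. p \<in> {0..s} \<Longrightarrow> q \<in> {0..s} \<Longrightarrow> x + p *\<^sub>R u + q *\<^sub>R v \<in> S\<close>
    by (smt (verit, ccfv_threshold) add.commute add.left_commute)
  then have "?F (x + p *\<^sub>R u + q *\<^sub>R v) = ?G (x + q' *\<^sub>R u + p' *\<^sub>R v)" using s by simp
  moreover have "dist (?F (x + p *\<^sub>R u + q *\<^sub>R v)) (?F x) < e"
    using near[OF pq(1,2)] by (intro d) (auto simp: d_def)
  moreover have "dist (?G (x + q' *\<^sub>R u + p' *\<^sub>R v)) (?G x) < e"
    using near[OF pq(4,3)] by (intro d) (auto simp: d_def)
  ultimately show False unfolding e_def dist_real_def by argo
qed

lemma dird_commute:
  fixes f :: "'a::euclidean_space \<Rightarrow> 'b::euclidean_space"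
  assumes S: "open S" and x: "x \<in> S" and f: "smooth_on S f"
  shows "dird v (dird u f) x = dird u (dird v f) x"
proof (rule euclidean_eqI)
  fix i :: 'b
  have fi: "smooth_on S (\<lambda>x. f x \<bullet> i)"
    by (rule smooth_on_linear_compose[OF bounded_linear_inner_left S f])
  have *: "dird v (dird u f) x \<bullet> i = dird v (dird u (\<lambda>x. f x \<bullet> i)) x" for u v
  proof -
    have "dird u (\<lambda>x. f x \<bullet> i) y = dird u f y \<bullet> i" if "y \<in> S" for y
      by (rule dird_linear_compose[OF bounded_linear_inner_left smooth_on_differentiable[OF f that]])
    from dird_cong_open[OF S this x] show ?thesis
      using dird_linear_compose[OF bounded_linear_inner_left smooth_on_differentiable[OF smooth_on_dird[OF f] x]]
      by simp
  qed
  show "dird v (dird u f) x \<bullet> i = dird u (dird v f) x \<bullet> i"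
    unfolding * by (rule dird_commute_real[OF S x fi])
qed

section \<open>Taylor terms as homogeneous polynomials\<close>

definition taylor_term :: "('a::euclidean_space \<Rightarrow> 'b::real_normed_vector) \<Rightarrow> nat \<Rightarrow> 'a \<Rightarrow> 'b" where
  "taylor_term f k x = (dird x ^^ k) f 0 /\<^sub>R fact k"

text \<open>\<open>taylor\<close> is confined to maps from the space to itself;
  \<open>taylor_term\<close> is the same formula for any codomain, as needed for Hamiltonians and
  coordinate functions.\<close>

lemma taylor_conv_taylor_term: "taylor f = taylor_term f"
  by (simp add: fun_eq_iff taylor_def taylor_term_def dird_def[abs_def])

lemma smooth_on_dird_funpow: "smooth_on S f \<Longrightarrow> smooth_on S ((dird x ^^ k) f)"
  by (induction k) (auto intro: smooth_on_dird)

lemma dird_funpow_cong: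
  assumes "open S" "\<And>y. y \<in> S \<Longrightarrow> f y = g y" "y \<in> S"
  shows "(dird x ^^ k) f y = (dird x ^^ k) g y"
  using assms(3) by (induction k arbitrary: y) (auto simp: assms intro: dird_cong_open[OF assms(1)])

lemma dird_funpow_sum:
  assumes S: "open S" and f: "\<And>i. i \<in> I \<Longrightarrow> smooth_on S (f i)" and "y \<in> S"
  shows "(dird x ^^ k) (\<lambda>z. \<Sum>i\<in>I. c i *\<^sub>R f i z) y = (\<Sum>i\<in>I. c i *\<^sub>R (dird x ^^ k) (f i) y)"
  using assms(3)
proof (induction k arbitrary: y)
  case (Suc k)
  have "(dird x ^^ Suc k) (\<lambda>z. \<Sum>i\<in>I. c i *\<^sub>R f i z) y = dird x (\<lambda>y. \<Sum>i\<in>I. c i *\<^sub>R (dird x ^^ k) (f i) y) y"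
    using Suc by (auto intro: dird_cong_open[OF S])
  also have "\<dots> = (\<Sum>i\<in>I. dird x (\<lambda>y. c i *\<^sub>R (dird x ^^ k) (f i) y) y)"
    using Suc.prems by (intro dird_sum smooth_on_differentiable[where S=S] smooth_on_scaleR S smooth_on_dird_funpow f)
  also have "\<dots> = (\<Sum>i\<in>I. c i *\<^sub>R (dird x ^^ Suc k) (f i) y)"
    using Suc.prems by (auto intro!: sum.cong dird_scaleR smooth_on_differentiable[where S=S] smooth_on_dird_funpow f)
  finally show ?case .
qed auto

text \<open>In \<open>(dird x ^^ Suc k) f y\<close> the direction \<open>x\<close> occurs in every
  factor. Expanding the innermost one in the basis exposes the dependence on \<open>x\<close>, which
  the inductions below exploit.\<close>

lemma dird_funpow_expand:
  assumes S: "open S" and f: "smooth_on S f" and "y \<in> S"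
  shows "(dird x ^^ Suc k) f y = (\<Sum>i\<in>Basis. (x \<bullet> i) *\<^sub>R (dird x ^^ k) (dird i f) y)"
proof -
  have "(dird x ^^ Suc k) f y = (dird x ^^ k) (dird x f) y"
    by (simp add: funpow_swap1)
  also have "\<dots> = (dird x ^^ k) (\<lambda>y. \<Sum>i\<in>Basis. (x \<bullet> i) *\<^sub>R dird i f y) y"
    using assms by (intro dird_funpow_cong[OF S]) (auto intro: dird_expand smooth_on_differentiable)
  also have "\<dots> = (\<Sum>i\<in>Basis. (x \<bullet> i) *\<^sub>R (dird x ^^ k) (dird i f) y)"
    using assms by (intro dird_funpow_sum[OF S] smooth_on_dird)
  finally show ?thesis .
qed

lemma dird_funpow_scaleR_arg:
  assumes S: "open S" and f: "smooth_on S f" and "y \<in> S"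
  shows "(dird (c *\<^sub>R x) ^^ k) f y = c ^ k *\<^sub>R (dird x ^^ k) f y"
  using f
proof (induction k arbitrary: f)
  case (Suc k)
  have "(dird (c *\<^sub>R x) ^^ Suc k) f y = (\<Sum>i\<in>Basis. ((c *\<^sub>R x) \<bullet> i) *\<^sub>R (c ^ k *\<^sub>R (dird x ^^ k) (dird i f) y))"
    by (simp only: dird_funpow_expand[OF S Suc.prems assms(3)] Suc.IH smooth_on_dird[OF Suc.prems])
  also have "\<dots> = c ^ Suc k *\<^sub>R (dird x ^^ Suc k) f y"
    by (simp only: dird_funpow_expand[OF S Suc.prems assms(3)]) (simp add: scaleR_sum_right mult_ac)
  finally show ?case .
qed simp

lemma polynomial_dird_funpow:
  fixes f :: "'a::euclidean_space \<Rightarrow> 'b::real_normed_vector"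
  assumes S: "open S" and f: "smooth_on S f" and "y \<in> S"
  shows "polynomial_function (\<lambda>x. (dird x ^^ k) f y)"
  using f
proof (induction k arbitrary: f)
  case (Suc k)
  show ?case unfolding dird_funpow_expand[OF S Suc.prems assms(3)]
    by (intro polynomial_function_sum polynomial_function_mult Suc.IH smooth_on_dird Suc.prems
        polynomial_function_bounded_linear bounded_linear_inner_left) auto
qed auto

lemma homogeneous_poly_taylor_term:
  assumes "open S" "smooth_on S f" "0 \<in> S"
  shows "homogeneous_poly k (taylor_term f k)"
  unfolding homogeneous_poly_def taylor_term_def[abs_def]
  by (auto simp: dird_funpow_scaleR_arg[OF assms] intro!: polynomial_function_cmul polynomial_dird_funpow[OF assms])

text \<open>Product rule in the expansion over the basis: one copy comes from the coefficients,
  \<open>Suc k\<close> copies from the induction hypothesis, and the symmetry of second derivatives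
  makes them equal.\<close>

lemma has_derivative_dird_funpow:
  fixes f :: "'a::euclidean_space \<Rightarrow> 'b::euclidean_space"
  assumes S: "open S" and f: "smooth_on S f" and y: "y \<in> S"
  shows "((\<lambda>x. (dird x ^^ Suc k) f y) has_derivative (\<lambda>v. real (Suc k) *\<^sub>R (dird x ^^ k) (dird v f) y)) (at x)"
  using f
proof (induction k arbitrary: f)
  case 0
  have "linear (\<lambda>x. dird x f y)"
    using 0 y by (intro linear_dird smooth_on_differentiable)
  then show ?case by (simp add: linear_imp_has_derivative)
next
  case (Suc k)
  have 1: "((\<lambda>x. \<Sum>i\<in>Basis. (x \<bullet> i) *\<^sub>R (dird x ^^ Suc k) (dird i f) y) has_derivative
      (\<lambda>v. \<Sum>i\<in>Basis. (x \<bullet> i) *\<^sub>R (real (Suc k) *\<^sub>R (dird x ^^ k) (dird v (dird i f)) y) + (v \<bullet> i) *\<^sub>R (dird x ^^ Suc k) (dird i f) y)) (at x)"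
    by (intro has_derivative_sum has_derivative_scaleR has_derivative_inner_left has_derivative_ident Suc.IH smooth_on_dird Suc.prems)
  have 2: "(\<Sum>i\<in>Basis. (x \<bullet> i) *\<^sub>R (real (Suc k) *\<^sub>R (dird x ^^ k) (dird v (dird i f)) y) + (v \<bullet> i) *\<^sub>R (dird x ^^ Suc k) (dird i f) y)
     = real (Suc (Suc k)) *\<^sub>R (dird x ^^ Suc k) (dird v f) y" for v
  proof -
    have "(dird x ^^ k) (dird v (dird i f)) y = (dird x ^^ k) (dird i (dird v f)) y" for i
      using y by (intro dird_funpow_cong[OF S] dird_commute[OF S] Suc.prems) auto
    then have "(\<Sum>i\<in>Basis. (x \<bullet> i) *\<^sub>R (real (Suc k) *\<^sub>R (dird x ^^ k) (dird v (dird i f)) y))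
       = real (Suc k) *\<^sub>R (dird x ^^ Suc k) (dird v f) y"
      by (simp only: dird_funpow_expand[OF S smooth_on_dird[OF Suc.prems] y]) (simp add: scaleR_sum_right mult_ac)
    moreover have "(\<Sum>i\<in>Basis. (v \<bullet> i) *\<^sub>R (dird x ^^ Suc k) (dird i f) y) = (dird x ^^ Suc k) (dird v f) y"
    proof -
      have "(dird x ^^ Suc k) (dird v f) y = (dird x ^^ Suc k) (\<lambda>z. \<Sum>i\<in>Basis. (v \<bullet> i) *\<^sub>R dird i f z) y"
        using y Suc.prems by (intro dird_funpow_cong[OF S]) (auto intro: dird_expand smooth_on_differentiable)
      also have "\<dots> = (\<Sum>i\<in>Basis. (v \<bullet> i) *\<^sub>R (dird x ^^ Suc k) (dird i f) y)"
        using y Suc.prems by (intro dird_funpow_sum[OF S] smooth_on_dird)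
      finally show ?thesis ..
    qed
    ultimately show ?thesis
      by (simp only: sum.distrib of_nat_Suc[of "Suc k"] scaleR_add_left scaleR_one add.commute)
  qed
  have "(\<lambda>x. (dird x ^^ Suc (Suc k)) f y) = (\<lambda>x. \<Sum>i\<in>Basis. (x \<bullet> i) *\<^sub>R (dird x ^^ Suc k) (dird i f) y)"
    by (rule ext) (rule dird_funpow_expand[OF S Suc.prems y])
  then show ?case using 1 unfolding 2 by (simp only:)
qed

text \<open>The factor \<open>Suc k\<close> from the derivative turns \<open>fact (Suc k)\<close>
  into \<open>fact k\<close>. Induction on the Taylor order rests on this relation.\<close>

lemma dird_taylor_term:
  fixes f :: "'a::euclidean_space \<Rightarrow> 'b::euclidean_space"
  assumes "open S" "smooth_on S f" "0 \<in> S"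
  shows "dird v (taylor_term f (Suc k)) x = taylor_term (dird v f) k x"
proof -
  have "((\<lambda>x. (dird x ^^ Suc k) f 0 /\<^sub>R fact (Suc k)) has_derivative
    (\<lambda>v. (real (Suc k) *\<^sub>R (dird x ^^ k) (dird v f) 0) /\<^sub>R fact (Suc k))) (at x)"
    by (rule has_derivative_scaleR_right[OF has_derivative_dird_funpow[OF assms]])
  from dird_eq[OF this, of v]
  have "dird v (taylor_term f (Suc k)) x = (real (Suc k) *\<^sub>R (dird x ^^ k) (dird v f) 0) /\<^sub>R fact (Suc k)"
    by (simp add: taylor_term_def[abs_def])
  also have "\<dots> = taylor_term (dird v f) k x"
    by (simp add: taylor_term_def field_simps del: of_nat_Suc)
  finally show ?thesis .
qed

lemma smooth_on_taylor_term:
  fixes f :: "'a::euclidean_space \<Rightarrow> 'b::euclidean_space"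
  assumes "open S" "smooth_on S f" "0 \<in> S"
  shows "smooth_on UNIV (taylor_term f k)"
  using homogeneous_poly_taylor_term[OF assms] smooth_on_polynomial unfolding homogeneous_poly_def by blast

section \<open>Taylor's theorem at the origin\<close>

text \<open>Vanishing of order \<open>m\<close> at 0. The filter \<open>nhds 0\<close> includes the
  point 0 itself, so \<open>f 0 = 0\<close> for positive \<open>m\<close>; order 0 means local
  boundedness.\<close>

definition flat :: "nat \<Rightarrow> ('a::real_normed_vector \<Rightarrow> 'b::real_normed_vector) \<Rightarrow> bool" where
  "flat m f \<longleftrightarrow> (\<exists>C. \<forall>\<^sub>F x in nhds 0. norm (f x) \<le> C * norm x ^ m)"

lemma flatE:
  assumes "flat m f"
  obtains C where "C \<ge> 0" "\<forall>\<^sub>F x in nhds 0. norm (f x) \<le> C * norm x ^ m"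
proof -
  obtain C where C: "\<forall>\<^sub>F x in nhds 0. norm (f x) \<le> C * norm x ^ m"
    using assms flat_def by blast
  have "\<forall>\<^sub>F x in nhds 0. norm (f x) \<le> max C 0 * norm x ^ m"
    using C by eventually_elim (smt (verit) mult_right_mono norm_ge_zero zero_le_power)
  then show ?thesis by (intro that[of "max C 0"]) auto
qed

lemma flat_cong_eventually:
  "flat m f \<Longrightarrow> \<forall>\<^sub>F x in nhds 0. f x = g x \<Longrightarrow> flat m g"
  unfolding flat_def by (elim exE, rule_tac x=C in exI) (auto elim: eventually_elim2)

lemma flat_cong: "flat m f \<Longrightarrow> (\<And>x. f x = g x) \<Longrightarrow> flat m g"
  using ext[of f g] by simp

lemma flat_cong_open: "flat m f \<Longrightarrow> open S \<Longrightarrow> 0 \<in> S \<Longrightarrow> (\<And>x. x \<in> S \<Longrightarrow> f x = g x) \<Longrightarrow> flat m g"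
  by (erule flat_cong_eventually) (auto simp: eventually_nhds)

lemma eventually_norm_less_nhds_0: "d > 0 \<Longrightarrow> \<forall>\<^sub>F x in nhds 0. norm x < d"
  by (auto simp: eventually_nhds_metric)

lemma flat_mono:
  assumes "flat n f" "m \<le> n"
  shows "flat m f"
proof -
  obtain C where C: "C \<ge> 0" "\<forall>\<^sub>F x in nhds 0. norm (f x) \<le> C * norm x ^ n"
    by (rule flatE[OF assms(1)])
  have "\<forall>\<^sub>F x in nhds 0. norm (f x) \<le> C * norm x ^ m"
    using C(2) eventually_norm_less_nhds_0[of 1, simplified]
  proof eventually_elim
    case (elim x)
    have "norm x ^ n \<le> norm x ^ m" using elim assms(2) by (intro power_decreasing) auto
    then show ?case using elim C(1) by (meson mult_left_mono order_trans)
  qed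
  then show ?thesis unfolding flat_def by blast
qed

lemma flat_zero [simp]: "flat m (\<lambda>x. 0)"
  unfolding flat_def by (auto intro!: exI[of _ 0])

lemma flat_add:
  assumes "flat m f" "flat m g"
  shows "flat m (\<lambda>x. f x + g x)"
proof -
  obtain C D where "\<forall>\<^sub>F x in nhds 0. norm (f x) \<le> C * norm x ^ m" "\<forall>\<^sub>F x in nhds 0. norm (g x) \<le> D * norm x ^ m"
    using assms unfolding flat_def by blast
  then have "\<forall>\<^sub>F x in nhds 0. norm (f x + g x) \<le> (C + D) * norm x ^ m"
    by eventually_elim (simp add: distrib_right norm_triangle_le)
  then show ?thesis unfolding flat_def by blast
qed

lemma flat_sum: "(\<And>i. i \<in> I \<Longrightarrow> flat m (f i)) \<Longrightarrow> flat m (\<lambda>x. \<Sum>i\<in>I. f i x)"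
  by (induction I rule: infinite_finite_induct) (auto intro: flat_add)

lemma flat_bilinear:
  assumes "bounded_bilinear B" "flat m f" "flat n g"
  shows "flat (m + n) (\<lambda>x. B (f x) (g x))"
proof -
  obtain C where C: "C \<ge> 0" "\<forall>\<^sub>F x in nhds 0. norm (f x) \<le> C * norm x ^ m" by (rule flatE[OF assms(2)])
  obtain D where D: "D \<ge> 0" "\<forall>\<^sub>F x in nhds 0. norm (g x) \<le> D * norm x ^ n" by (rule flatE[OF assms(3)])
  obtain K where K: "K \<ge> 0" "\<And>a b. norm (B a b) \<le> norm a * norm b * K"
    using bounded_bilinear.nonneg_bounded[OF assms(1)] by blast
  have "\<forall>\<^sub>F x in nhds 0. norm (B (f x) (g x)) \<le> (C * D * K) * norm x ^ (m + n)"
    using C(2) D(2)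
  proof eventually_elim
    case (elim x)
    have "norm (B (f x) (g x)) \<le> norm (f x) * norm (g x) * K" by (rule K)
    also have "\<dots> \<le> (C * norm x ^ m) * (D * norm x ^ n) * K"
      using elim C D K by (intro mult_right_mono mult_mono) auto
    finally show ?case by (simp add: power_add mult_ac)
  qed
  then show ?thesis unfolding flat_def by blast
qed

lemma flat_linear:
  assumes "bounded_linear h" "flat m f"
  shows "flat m (\<lambda>x. h (f x))"
proof -
  obtain C where C: "\<forall>\<^sub>F x in nhds 0. norm (f x) \<le> C * norm x ^ m" using assms unfolding flat_def by blast
  obtain K where K: "K \<ge> 0" "\<And>a. norm (h a) \<le> norm a * K"
    using bounded_linear.nonneg_bounded[OF assms(1)] by blast
  have "\<forall>\<^sub>F x in nhds 0. norm (h (f x)) \<le> (C * K) * norm x ^ m"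
    using C by eventually_elim (smt (verit) K mult.commute mult.left_commute mult_right_mono)
  then show ?thesis unfolding flat_def by blast
qed

lemma flat_scaleR: "flat m f \<Longrightarrow> flat m (\<lambda>x. c *\<^sub>R f x)"
  by (rule flat_linear[OF bounded_linear_scaleR_right])

lemma flat_diff: "flat m f \<Longrightarrow> flat m g \<Longrightarrow> flat m (\<lambda>x. f x - g x)"
  using flat_add[of m f "\<lambda>x. (-1) *\<^sub>R g x"] flat_scaleR[of m g "-1"] by simp

lemma flat_tendsto:
  assumes "flat 1 g"
  shows "filterlim g (nhds 0) (nhds 0)"
proof -
  obtain C where C: "\<forall>\<^sub>F x in nhds 0. norm (g x) \<le> C * norm x ^ 1" using assms unfolding flat_def by blast
  have "((\<lambda>x. norm x) \<longlongrightarrow> norm (0::'a)) (nhds (0::'a))" by (rule tendsto_norm[OF filterlim_ident])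
  then have "((\<lambda>x. C * norm x ^ 1) \<longlongrightarrow> 0) (nhds (0::'a))" by (auto intro: tendsto_mult_right_zero)
  from Lim_null_comparison[OF C this] show ?thesis .
qed

lemma flat_compose:
  assumes "flat m f" "flat 1 g"
  shows "flat m (\<lambda>x. f (g x))"
proof -
  obtain C where C: "C \<ge> 0" "\<forall>\<^sub>F x in nhds 0. norm (f x) \<le> C * norm x ^ m" by (rule flatE[OF assms(1)])
  obtain D where D: "D \<ge> 0" "\<forall>\<^sub>F x in nhds 0. norm (g x) \<le> D * norm x ^ 1" by (rule flatE[OF assms(2)])
  have "\<forall>\<^sub>F x in nhds 0. norm (f (g x)) \<le> C * norm (g x) ^ m"
    using C(2) flat_tendsto[OF assms(2)] by (auto simp: filterlim_iff)
  then have "\<forall>\<^sub>F x in nhds 0. norm (f (g x)) \<le> (C * D ^ m) * norm x ^ m"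
    using D(2)
  proof eventually_elim
    case (elim x)
    have "norm (g x) ^ m \<le> (D * norm x) ^ m" using elim by (intro power_mono) auto
    then show ?case using elim C(1) by (simp add: power_mult_distrib mult.assoc) (meson mult_left_mono order_trans)
  qed
  then show ?thesis unfolding flat_def by blast
qed

lemma flat_continuous:
  fixes f :: "'a::real_normed_vector \<Rightarrow> 'b::real_normed_vector"
  assumes "isCont f 0"
  shows "flat 0 f"
proof -
  have "((\<lambda>x. norm (f x)) \<longlongrightarrow> norm (f 0)) (nhds 0)"
    using assms by (intro tendsto_norm) (simp add: isCont_def tendsto_at_iff_tendsto_nhds)
  then have "\<forall>\<^sub>F x in nhds 0. norm (f x) < norm (f 0) + 1" by (rule order_tendstoD) auto
  then have "\<forall>\<^sub>F x in nhds 0. norm (f x) \<le> (norm (f 0) + 1) * norm x ^ 0" by eventually_elim auto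
  then show ?thesis unfolding flat_def by blast
qed

text \<open>Compactness of the unit sphere bounds \<open>p\<close> there, and homogeneity scales the
  bound.\<close>

lemma flat_homogeneous_poly:
  fixes p :: "'a::euclidean_space \<Rightarrow> 'b::euclidean_space"
  assumes "homogeneous_poly k p"
  shows "flat k p"
proof -
  have "continuous_on (sphere 0 1) p"
    using assms smooth_on_continuous[OF smooth_on_polynomial] continuous_on_subset unfolding homogeneous_poly_def by blast
  then have "bounded (p ` sphere 0 1)" by (intro compact_imp_bounded compact_continuous_image) auto
  then obtain C where "\<forall>y\<in>p ` sphere 0 1. norm y \<le> C" using bounded_iff by blast
  then have C: "\<And>x. norm x = 1 \<Longrightarrow> norm (p x) \<le> C" by auto
  \<comment> \<open>The summand \<open>norm (p 0)\<close> settles \<open>x = 0\<close> in degree 0,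
    where the power is 1.\<close>
  have "norm (p x) \<le> (C + norm (p 0)) * norm x ^ k" for x
  proof (cases "x = 0")
    case True
    have "p 0 = 0 ^ k *\<^sub>R p 0" using assms unfolding homogeneous_poly_def by (metis scaleR_zero_left)
    moreover have "C \<ge> 0" by (rule order_trans[OF norm_ge_zero C[OF norm_Basis[OF SOME_Basis]]])
    ultimately show ?thesis using True by (cases k) auto
  next
    case False
    then have "norm (p (x /\<^sub>R norm x)) \<le> C" by (intro C) auto
    moreover have "p x = norm x ^ k *\<^sub>R p (x /\<^sub>R norm x)"
      using assms False unfolding homogeneous_poly_def by (metis divideR_right norm_eq_zero)
    ultimately have "norm (p x) \<le> norm x ^ k * C" by (simp add: mult_left_mono)
    also have "\<dots> \<le> (C + norm (p 0)) * norm x ^ k"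
      by (simp add: algebra_simps)
    finally show ?thesis .
  qed
  then show ?thesis unfolding flat_def by (auto intro!: exI[of _ "C + norm (p 0)"] always_eventually)
qed

text \<open>Along a ray t x the hypothesis reads t^k |p x| \<le> const t^(k+1); divide by t^k and
  let t tend to 0.\<close>

lemma flat_homogeneous_zero:
  fixes p :: "'a::real_normed_vector \<Rightarrow> 'b::real_normed_vector"
  assumes "flat (Suc k) p" and h: "\<And>c x. p (c *\<^sub>R x) = c ^ k *\<^sub>R p x"
  shows "p x = 0"
proof -
  obtain C where C: "C \<ge> 0" "\<forall>\<^sub>F x in nhds 0. norm (p x) \<le> C * norm x ^ Suc k" by (rule flatE[OF assms(1)])
  have "((\<lambda>t. t *\<^sub>R x) \<longlongrightarrow> 0 *\<^sub>R x) (at_right (0::real))" by (intro tendsto_intros)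
  then have "\<forall>\<^sub>F t in at_right (0::real). norm (p (t *\<^sub>R x)) \<le> C * norm (t *\<^sub>R x) ^ Suc k"
    using C(2) by (auto simp: filterlim_iff)
  then have "\<forall>\<^sub>F t in at_right (0::real). norm (p x) \<le> t * (C * norm x ^ Suc k)"
    using eventually_at_right_less[of "0::real"]
  proof eventually_elim
    case (elim t)
    then have "t ^ k * norm (p x) \<le> t ^ k * (t * (C * norm x ^ Suc k))"
      by (simp add: h power_mult_distrib mult_ac)
    then show ?case using elim by (simp add: mult_le_cancel_left_pos)
  qed
  moreover have "((\<lambda>t. t * (C * norm x ^ Suc k)) \<longlongrightarrow> 0 * (C * norm x ^ Suc k)) (at_right (0::real))"
    by (intro tendsto_intros)
  ultimately have "norm (p x) \<le> 0"
    using tendsto_lowerbound[of "\<lambda>t. t * (C * norm x ^ Suc k)" 0 "at_right 0" "norm (p x)"] by auto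
  then show ?thesis by simp
qed

text \<open>Once the components below degree \<open>k\<close> are known to vanish, those above are
  of higher order, so component \<open>k\<close> vanishes to order k+1 and is zero.\<close>

lemma flat_sum_homogeneous_zero:
  fixes p :: "nat \<Rightarrow> 'a::euclidean_space \<Rightarrow> 'b::euclidean_space"
  assumes h: "\<And>k. k \<le> m \<Longrightarrow> homogeneous_poly k (p k)" and f: "flat (Suc m) (\<lambda>x. \<Sum>k\<le>m. p k x)" and "k \<le> m"
  shows "p k x = 0"
  using assms(3)
proof (induction k arbitrary: x rule: less_induct)
  case (less k)
  have "(\<Sum>j\<le>m. p j x) - (\<Sum>j=Suc k..m. p j x) = p k x" for x
  proof -
    have *: "{..m} = {..<k} \<union> ({k} \<union> {Suc k..m})" using less.prems by auto
    have "(\<Sum>j\<le>m. p j x) = (\<Sum>j<k. p j x) + (p k x + (\<Sum>j=Suc k..m. p j x))"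
      unfolding * by (subst sum.union_disjoint) auto
    then show ?thesis using less.IH less.prems by simp
  qed
  moreover have "flat (Suc k) (\<lambda>x. (\<Sum>j\<le>m. p j x) - (\<Sum>j=Suc k..m. p j x))"
    using less.prems by (intro flat_diff flat_sum flat_mono[OF f] flat_mono[OF flat_homogeneous_poly[OF h]]) auto
  ultimately have "flat (Suc k) (p k)" using flat_cong by simp
  then show ?case using h[OF less.prems] flat_homogeneous_zero unfolding homogeneous_poly_def by blast
qed

section \<open>Mean value estimates and the Taylor remainder\<close>

lemma onorm_dird_le:
  assumes "f differentiable (at x)"
  shows "onorm (\<lambda>v. dird v f x) \<le> (\<Sum>i\<in>Basis. norm (dird i f x))"
proof (rule onorm_bound)
  fix v
  have "norm (dird v f x) \<le> (\<Sum>i\<in>Basis. norm ((v \<bullet> i) *\<^sub>R dird i f x))"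
    by (subst dird_expand[OF assms]) (rule norm_sum)
  also have "\<dots> \<le> (\<Sum>i\<in>Basis. norm v * norm (dird i f x))"
    by (intro sum_mono) (simp add: Basis_le_norm mult_right_mono)
  finally show "norm (dird v f x) \<le> (\<Sum>i\<in>Basis. norm (dird i f x)) * norm v"
    by (simp add: sum_distrib_left mult.commute)
qed (auto intro: sum_nonneg)

text \<open>Mean value inequality on the ball of radius \<open>s\<close>, where the derivative is at
  most C s^m. The constant does not depend on \<open>s\<close>, so \<open>s\<close> may later shrink
  with the argument.\<close>

lemma flat_derivative_increment:
  fixes f :: "'a::euclidean_space \<Rightarrow> 'b::real_normed_vector"
  assumes S: "open S" "0 \<in> S" and f: "smooth_on S f" and d: "\<And>i. i \<in> Basis \<Longrightarrow> flat m (dird i f)"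
  obtains C r where "C \<ge> 0" "r > 0"
    "\<And>s p q. s < r \<Longrightarrow> norm p \<le> s \<Longrightarrow> norm q \<le> s \<Longrightarrow> norm (f p - f q) \<le> C * s ^ m * norm (p - q)"
proof -
  have "\<forall>i\<in>Basis. \<exists>C. C \<ge> 0 \<and> (\<forall>\<^sub>F x in nhds 0. norm (dird i f x) \<le> C * norm x ^ m)"
    by (intro ballI) (rule flatE[OF d], auto)
  then obtain C where C: "\<And>i. i \<in> Basis \<Longrightarrow> C i \<ge> 0" "\<And>i. i \<in> Basis \<Longrightarrow> \<forall>\<^sub>F x in nhds 0. norm (dird i f x) \<le> C i * norm x ^ m"
    by metis
  have "\<forall>\<^sub>F x in nhds 0. x \<in> S \<and> (\<forall>i\<in>Basis. norm (dird i f x) \<le> C i * norm x ^ m)"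
    by (rule eventually_conj[OF eventually_nhds_in_open[OF S] eventually_ball_finite[OF finite_Basis]])
      (use C(2) in blast)
  then obtain r where r: "r > 0" "\<And>x. norm x < r \<Longrightarrow> x \<in> S"
    "\<And>x i. norm x < r \<Longrightarrow> i \<in> Basis \<Longrightarrow> norm (dird i f x) \<le> C i * norm x ^ m"
    unfolding eventually_nhds_metric dist_norm diff_zero by metis
  show ?thesis
  proof (rule that[of "sum C Basis" r])
    fix s p q assume s: "s < r" "norm (p::'a) \<le> s" "norm (q::'a) \<le> s"
    show "norm (f p - f q) \<le> sum C Basis * s ^ m * norm (p - q)"
    proof (rule differentiable_bound[of "cball 0 s" f "\<lambda>x v. dird v f x"])
      show "(f has_derivative (\<lambda>v. dird v f x)) (at x within cball 0 s)" if "x \<in> cball 0 s" for x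
        using that s r by (auto intro!: has_derivative_at_withinI[OF has_derivative_dird[OF smooth_on_differentiable[OF f]]])
      show "onorm (\<lambda>v. dird v f x) \<le> sum C Basis * s ^ m" if "x \<in> cball 0 s" for x
      proof -
        have "onorm (\<lambda>v. dird v f x) \<le> (\<Sum>i\<in>Basis. norm (dird i f x))"
          using that s r by (intro onorm_dird_le smooth_on_differentiable[OF f]) auto
        also have "\<dots> \<le> (\<Sum>i\<in>Basis. C i * s ^ m)"
        proof (rule sum_mono)
          fix i :: 'a assume i: "i \<in> Basis"
          have "norm (dird i f x) \<le> C i * norm x ^ m" using that s r i by auto
          also have "\<dots> \<le> C i * s ^ m" using that C(1)[OF i] by (intro mult_left_mono power_mono) auto
          finally show "norm (dird i f x) \<le> C i * s ^ m" .
        qed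
        finally show ?thesis by (simp add: sum_distrib_right)
      qed
    qed (use s in auto)
  qed (use r C in \<open>auto intro: sum_nonneg\<close>)
qed

text \<open>\<open>p\<close> and \<open>q\<close> lie in a ball of radius O(|x|), where the
  derivative of \<open>f\<close> is O(|x|^m). Perturbed arguments of smooth functions are estimated
  in this way.\<close>

lemma flat_increment:
  fixes f :: "'a::euclidean_space \<Rightarrow> 'b::real_normed_vector" and p q :: "'c::real_normed_vector \<Rightarrow> 'a"
  assumes "open S" "0 \<in> S" "smooth_on S f" "\<And>i. i \<in> Basis \<Longrightarrow> flat m (dird i f)"
    and p: "flat 1 p" and q: "flat 1 q" and pq: "flat n (\<lambda>x. p x - q x)"
  shows "flat (m + n) (\<lambda>x. f (p x) - f (q x))"
proof -
  obtain C r where C: "C \<ge> 0" "r > 0"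
    "\<And>s p q. s < r \<Longrightarrow> norm p \<le> s \<Longrightarrow> norm q \<le> s \<Longrightarrow> norm (f p - f q) \<le> C * s ^ m * norm (p - q)"
    using flat_derivative_increment[OF assms(1-4)] by blast
  obtain A where A: "A \<ge> 0" "\<forall>\<^sub>F x in nhds 0. norm (p x) \<le> A * norm x ^ 1" by (rule flatE[OF p])
  obtain B where B: "B \<ge> 0" "\<forall>\<^sub>F x in nhds 0. norm (q x) \<le> B * norm x ^ 1" by (rule flatE[OF q])
  obtain D where D: "D \<ge> 0" "\<forall>\<^sub>F x in nhds 0. norm (p x - q x) \<le> D * norm x ^ n" by (rule flatE[OF pq])
  \<comment> \<open>The 1 avoids division by zero when \<open>A\<close> and \<open>B\<close>
    vanish.\<close>
  have pos: "r / (A + B + 1) > 0" using A B C by auto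
  have "\<forall>\<^sub>F x in nhds 0. norm (f (p x) - f (q x)) \<le> (C * (A + B) ^ m * D) * norm x ^ (m + n)"
    using A(2) B(2) D(2) eventually_norm_less_nhds_0[OF pos]
  proof eventually_elim
    case (elim x)
    have "(A + B + 1) * norm x < r" using elim A B by (simp add: field_simps)
    then have "(A + B) * norm x < r" by (simp add: distrib_right) (smt (verit) norm_ge_zero)
    moreover have "norm (p x) \<le> (A + B) * norm x" "norm (q x) \<le> (A + B) * norm x"
      using elim A B by (simp_all add: distrib_right add_increasing add_increasing2)
    ultimately have "norm (f (p x) - f (q x)) \<le> C * ((A + B) * norm x) ^ m * norm (p x - q x)" by (rule C(3))
    also have "\<dots> \<le> C * ((A + B) * norm x) ^ m * (D * norm x ^ n)"
      using elim A B C by (intro mult_left_mono) auto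
    finally show ?case by (simp add: power_mult_distrib power_add mult_ac)
  qed
  then show ?thesis unfolding flat_def by blast
qed

lemma flat_ident [simp]: "flat 1 (\<lambda>x. x)"
  unfolding flat_def by (auto intro!: exI[of _ 1])

lemma flat_of_dird:
  fixes f :: "'a::euclidean_space \<Rightarrow> 'b::real_normed_vector"
  assumes "open S" "0 \<in> S" "smooth_on S f" "\<And>i. i \<in> Basis \<Longrightarrow> flat m (dird i f)" "f 0 = 0"
  shows "flat (Suc m) f"
proof -
  have "flat (m + 1) (\<lambda>x. f x - f 0)"
    by (rule flat_increment[OF assms(1-4)]) (auto simp del: One_nat_def)
  then show ?thesis by (simp add: assms(5))
qed

lemma taylor_term_zero [simp]: "taylor_term f 0 x = f 0"
  by (simp add: taylor_term_def)

text \<open>Induction on the order: the derivative of the remainder is the remainder of the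
  derivative, one order lower, and \<open>flat_of_dird\<close> integrates the estimate.\<close>

theorem taylor_remainder:
  fixes f :: "'a::euclidean_space \<Rightarrow> 'b::euclidean_space"
  assumes S: "open S" "0 \<in> S" and f: "smooth_on S f"
  shows "flat (Suc m) (\<lambda>x. f x - (\<Sum>k\<le>m. taylor_term f k x))"
  using f
proof (induction m arbitrary: f)
  case 0
  have "flat 0 (dird i (\<lambda>x. f x - f 0))" for i
    using S smooth_on_continuous[OF smooth_on_dird[OF smooth_on_diff[OF S(1) 0 smooth_on_const]]]
    by (auto intro!: flat_continuous simp: continuous_on_eq_continuous_at)
  then show ?case
    using flat_of_dird[OF S smooth_on_diff[OF S(1) 0 smooth_on_const]] by simp
next
  case (Suc m)
  let ?T = "\<lambda>x. \<Sum>k\<le>Suc m. taylor_term f k x"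
  note T = smooth_on_taylor_term[OF S(1) Suc.prems S(2)]
  have sT: "smooth_on S ?T"
    by (intro smooth_on_sum S smooth_on_subset[OF T]) auto
  have "flat (Suc m) (dird i (\<lambda>x. f x - ?T x))" for i
  proof (rule flat_cong_open[OF Suc.IH[OF smooth_on_dird[OF Suc.prems]] S])
    fix x assume x: "x \<in> S"
    have "taylor_term f 0 = (\<lambda>x. f 0)" by auto
    then have "dird i (taylor_term f 0) x = 0" by (simp add: dird_def)
    moreover have "dird i ?T x = (\<Sum>k\<le>Suc m. dird i (taylor_term f k) x)"
      by (intro dird_sum smooth_on_differentiable[OF T]) auto
    ultimately have "dird i ?T x = (\<Sum>k\<le>m. taylor_term (dird i f) k x)"
      unfolding sum.atMost_Suc_shift by (simp add: dird_taylor_term[OF S(1) Suc.prems S(2)])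
    then show "dird i f x - (\<Sum>k\<le>m. taylor_term (dird i f) k x) = dird i (\<lambda>x. f x - ?T x) x"
      using x by (simp add: dird_diff smooth_on_differentiable[OF Suc.prems] smooth_on_differentiable[OF sT] del: sum.atMost_Suc)
  qed
  moreover have "f 0 - ?T 0 = 0"
  proof -
    have "taylor_term f (Suc k) 0 = 0" for k
      using homogeneous_poly_taylor_term[OF S(1) Suc.prems S(2), of "Suc k"] unfolding homogeneous_poly_def
      by (metis power_0_Suc scaleR_zero_left)
    then show ?thesis unfolding sum.atMost_Suc_shift by simp
  qed
  ultimately show ?case
    by (intro flat_of_dird[OF S smooth_on_diff[OF S(1) Suc.prems sT]])
qed

section \<open>Uniqueness of Taylor expansions and its consequences\<close>

lemma homogeneous_poly_diff:
  "homogeneous_poly k p \<Longrightarrow> homogeneous_poly k q \<Longrightarrow> homogeneous_poly k (\<lambda>x. p x - q x)"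
  unfolding homogeneous_poly_def by (auto simp: scaleR_diff_right)

text \<open>Two expansions differ by a sum of homogeneous terms that vanishes to too high an order,
  hence they agree term by term. Taylor terms are computed below by exhibiting an expansion rather
  than by differentiating.\<close>

theorem taylor_term_unique:
  fixes f :: "'a::euclidean_space \<Rightarrow> 'b::euclidean_space"
  assumes S: "open S" "0 \<in> S" and f: "smooth_on S f"
    and p: "\<And>k. k \<le> m \<Longrightarrow> homogeneous_poly k (p k)" and r: "flat (Suc m) (\<lambda>x. f x - (\<Sum>k\<le>m. p k x))"
    and "k \<le> m"
  shows "taylor_term f k = p k"
proof
  fix x
  have "flat (Suc m) (\<lambda>x. \<Sum>k\<le>m. p k x - taylor_term f k x)"
    by (rule flat_cong[OF flat_diff[OF taylor_remainder[OF S f] r]]) (simp add: sum_subtractf)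
  from flat_sum_homogeneous_zero[OF _ this assms(6)]
  have "p k x - taylor_term f k x = 0"
    using p homogeneous_poly_taylor_term[OF S(1) f S(2)] homogeneous_poly_diff by blast
  then show "taylor_term f k x = p k x" by simp
qed

lemma taylor_term_homogeneous:
  fixes p :: "'a::euclidean_space \<Rightarrow> 'b::euclidean_space"
  assumes "homogeneous_poly k p"
  shows "taylor_term p k = p"
proof -
  have "homogeneous_poly j (if j = k then p else (\<lambda>x. 0))" for j
    using assms by (auto simp: homogeneous_poly_def)
  moreover have "(\<Sum>j\<le>k. (if j = k then p else (\<lambda>x. 0)) x) = p x" for x
    by (simp add: if_distribR sum.delta)
  moreover have "smooth_on UNIV p" using assms smooth_on_polynomial unfolding homogeneous_poly_def by blast
  ultimately show ?thesis
    using taylor_term_unique[of UNIV p k "\<lambda>j. if j = k then p else (\<lambda>x. 0)" k] by simp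
qed

lemma taylor_term_eq:
  fixes f g :: "'a::euclidean_space \<Rightarrow> 'b::euclidean_space"
  assumes S: "open S" "0 \<in> S" "smooth_on S f" and T: "open T" "0 \<in> T" "smooth_on T g"
    and "flat (Suc m) (\<lambda>x. f x - g x)" "k \<le> m"
  shows "taylor_term f k = taylor_term g k"
proof (rule taylor_term_unique[OF S])
  show "homogeneous_poly k (taylor_term g k)" for k by (rule homogeneous_poly_taylor_term[OF T(1,3,2)])
  show "flat (Suc m) (\<lambda>x. f x - (\<Sum>k\<le>m. taylor_term g k x))"
    by (rule flat_cong[OF flat_add[OF assms(7) taylor_remainder[OF T]]]) auto
qed fact

lemma flat_iff_taylor_term:
  fixes f :: "'a::euclidean_space \<Rightarrow> 'b::euclidean_space"
  assumes S: "open S" "0 \<in> S" "smooth_on S f"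
  shows "flat (Suc m) f \<longleftrightarrow> (\<forall>k\<le>m. \<forall>x. taylor_term f k x = 0)"
proof
  assume "flat (Suc m) f"
  moreover have "homogeneous_poly k (\<lambda>x::'a. 0::'b)" for k by (simp add: homogeneous_poly_def)
  ultimately show "\<forall>k\<le>m. \<forall>x. taylor_term f k x = 0"
    using taylor_term_unique[OF S, of m "\<lambda>k x. 0"] by auto
next
  assume "\<forall>k\<le>m. \<forall>x. taylor_term f k x = 0"
  then show "flat (Suc m) f" using taylor_remainder[OF S, of m] by simp
qed

text \<open>Bounds do not pass to derivatives in general. For smooth maps they amount to the
  vanishing of low Taylor terms, which does pass, by \<open>dird_taylor_term\<close>.\<close>

lemma flat_dird:
  fixes f :: "'a::euclidean_space \<Rightarrow> 'b::euclidean_space"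
  assumes S: "open S" "0 \<in> S" "smooth_on S f" and "flat (Suc m) f"
  shows "flat m (dird v f)"
proof (cases m)
  case 0
  then show ?thesis
    using S smooth_on_continuous[OF smooth_on_dird[OF S(3)]]
    by (auto intro!: flat_continuous simp: continuous_on_eq_continuous_at)
next
  case (Suc n)
  have "taylor_term (dird v f) k x = 0" if "k \<le> n" for k x
  proof -
    have "taylor_term f (Suc k) = (\<lambda>x. 0)"
      using flat_iff_taylor_term[OF S, of m] assms(4) that Suc by auto
    then show ?thesis using dird_taylor_term[OF S(1,3,2), of v k x] by (simp add: dird_def)
  qed
  then show ?thesis using flat_iff_taylor_term[OF S(1,2) smooth_on_dird[OF S(3)]] Suc by auto
qed

lemma smooth_on_homogeneous_poly:
  fixes p :: "'a::euclidean_space \<Rightarrow> 'b::euclidean_space"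
  shows "homogeneous_poly k p \<Longrightarrow> smooth_on UNIV p"
  unfolding homogeneous_poly_def by (blast intro: smooth_on_polynomial)

text \<open>\<open>p\<close> is its own Taylor term of degree \<open>Suc k\<close>, so its
  derivative is a Taylor term of degree \<open>k\<close>.\<close>

lemma homogeneous_poly_dird:
  fixes p :: "'a::euclidean_space \<Rightarrow> 'b::euclidean_space"
  assumes "homogeneous_poly (Suc k) p"
  shows "homogeneous_poly k (dird v p)"
proof -
  note s = smooth_on_homogeneous_poly[OF assms]
  have "dird v p = taylor_term (dird v p) k"
    using dird_taylor_term[OF open_UNIV s UNIV_I, of v k] by (simp add: taylor_term_homogeneous[OF assms] fun_eq_iff)
  then show ?thesis using homogeneous_poly_taylor_term[OF open_UNIV smooth_on_dird[OF s] UNIV_I] by metis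
qed

section \<open>Homogeneous polynomials and the Fischer product\<close>

lemma homogeneous_poly_add:
  "homogeneous_poly k p \<Longrightarrow> homogeneous_poly k q \<Longrightarrow> homogeneous_poly k (\<lambda>x. p x + q x)"
  unfolding homogeneous_poly_def by (auto simp: scaleR_add_right)

lemma homogeneous_poly_scaleR:
  "homogeneous_poly k p \<Longrightarrow> homogeneous_poly k (\<lambda>x. c *\<^sub>R p x)"
  unfolding homogeneous_poly_def by auto

lemma homogeneous_poly_zero: "homogeneous_poly k (\<lambda>x. 0)"
  unfolding homogeneous_poly_def by auto

lemma homogeneous_poly_sum:
  "(\<And>i. i \<in> I \<Longrightarrow> homogeneous_poly k (p i)) \<Longrightarrow> homogeneous_poly k (\<lambda>x. \<Sum>i\<in>I. p i x)"
  by (induction I rule: infinite_finite_induct) (auto intro: homogeneous_poly_zero homogeneous_poly_add)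

lemma homogeneous_poly_lincomb:
  fixes p :: "'i \<Rightarrow> 'a::euclidean_space \<Rightarrow> real"
  assumes "\<And>i. i \<in> I \<Longrightarrow> homogeneous_poly k (p i)"
  shows "homogeneous_poly k (\<lambda>x. \<Sum>i\<in>I. c i * p i x)"
  unfolding real_scaleR_def[symmetric] by (intro homogeneous_poly_sum homogeneous_poly_scaleR assms)

lemma homogeneous_poly_linear: "linear f \<Longrightarrow> homogeneous_poly 1 (f :: 'a::euclidean_space \<Rightarrow> _)"
  unfolding homogeneous_poly_def
  by (auto simp: linear_cmul linear_conv_bounded_linear intro: polynomial_function_bounded_linear)

lemma homogeneous_poly_mult:
  fixes p q :: "'a::euclidean_space \<Rightarrow> real"
  shows "homogeneous_poly k p \<Longrightarrow> homogeneous_poly l q \<Longrightarrow> homogeneous_poly (k + l) (\<lambda>x. p x * q x)"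
  unfolding homogeneous_poly_def using polynomial_function_mult[of p q] by (auto simp: power_add)

lemma real_polynomial_function_linear_compose:
  assumes "real_polynomial_function p" "bounded_linear g"
  shows "real_polynomial_function (\<lambda>x. p (g x))"
  using assms(1)
  by induction (auto intro: real_polynomial_function.intros bounded_linear_compose[OF _ assms(2)])

lemma homogeneous_poly_compose_linear:
  assumes "homogeneous_poly k p" "bounded_linear g"
  shows "homogeneous_poly k (\<lambda>x. p (g x))"
proof -
  have "real_polynomial_function (\<lambda>x. f (p (g x)))" if "bounded_linear f" for f
    using assms(1) that real_polynomial_function_linear_compose[OF _ assms(2), of "f \<circ> p"]
    unfolding homogeneous_poly_def polynomial_function_def by (auto simp: o_def)
  then show ?thesis using assms(1) linear_cmul[OF bounded_linear.linear[OF assms(2)]]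
    unfolding homogeneous_poly_def polynomial_function_def by (auto simp: o_def)
qed

text \<open>Euler's identity, from differentiating p(t x) = t^k p(x) at t = 1.\<close>

lemma dird_homogeneous_self:
  fixes p :: "'a::euclidean_space \<Rightarrow> 'b::euclidean_space"
  assumes "homogeneous_poly k p"
  shows "dird x p x = real k *\<^sub>R p x"
proof -
  have s: "smooth_on UNIV p" by (rule smooth_on_homogeneous_poly[OF assms])
  have "((\<lambda>t. p (0 + t *\<^sub>R x)) has_vector_derivative dird x p (0 + 1 *\<^sub>R x)) (at 1)"
    by (rule dird_along_line) (rule smooth_on_differentiable[OF s UNIV_I])
  moreover have "((\<lambda>t. p (0 + t *\<^sub>R x)) has_vector_derivative real k *\<^sub>R p x) (at 1)"
  proof -
    have "((\<lambda>t. t ^ k *\<^sub>R p x) has_vector_derivative real k *\<^sub>R p x) (at 1)"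
      by (auto intro!: derivative_eq_intros simp: has_vector_derivative_def)
    moreover have "(\<lambda>t. p (0 + t *\<^sub>R x)) = (\<lambda>t. t ^ k *\<^sub>R p x)"
      using assms unfolding homogeneous_poly_def by auto
    ultimately show ?thesis by simp
  qed
  ultimately show ?thesis using vector_derivative_unique_at by fastforce
qed

lemma dird_homogeneous_zero:
  fixes p :: "'a::euclidean_space \<Rightarrow> 'b::euclidean_space"
  assumes "homogeneous_poly 0 p"
  shows "dird v p x = 0"
proof -
  have "p = (\<lambda>x. p 0)"
    using assms unfolding homogeneous_poly_def by (metis power_0 scaleR_one scaleR_zero_left)
  then have "dird v p = dird v (\<lambda>x. p 0)" by simp
  then show ?thesis by (simp add: dird_def)
qed

text \<open>For homogeneous \<open>p\<close>, \<open>q\<close> of degree \<open>k\<close> this is \<open>k!\<close> times Fischer's product \<open>p(\<partial>) q\<close> in the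
  coordinates of \<open>b\<close>.\<close>

fun fischer :: "('m::finite \<Rightarrow> 'v::euclidean_space) \<Rightarrow> nat \<Rightarrow> ('v \<Rightarrow> real) \<Rightarrow> ('v \<Rightarrow> real) \<Rightarrow> real" where
  "fischer b 0 p q = p 0 * q 0"
| "fischer b (Suc k) p q = (\<Sum>i\<in>UNIV. fischer b k (dird (b i) p) (dird (b i) q))"

lemma fischer_commute: "fischer b k p q = fischer b k q p"
  by (induction k arbitrary: p q) auto

lemma fischer_nonneg: "fischer b k p p \<ge> 0"
  by (induction k arbitrary: p) (auto intro: sum_nonneg)

lemma fischer_add_left:
  assumes "smooth_on UNIV p" "smooth_on UNIV q"
  shows "fischer b k (\<lambda>x. p x + q x) r = fischer b k p r + fischer b k q r"
  using assms
proof (induction k arbitrary: p q r)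
  case (Suc k)
  have "dird v (\<lambda>x. p x + q x) = (\<lambda>x. dird v p x + dird v q x)" for v
    using Suc.prems by (auto intro!: dird_add smooth_on_differentiable)
  then show ?case using Suc by (simp add: smooth_on_dird sum.distrib)
qed (simp add: distrib_right)

lemma fischer_mult_left:
  assumes "smooth_on UNIV p"
  shows "fischer b k (\<lambda>x. c * p x) r = c * fischer b k p r"
  using assms
proof (induction k arbitrary: p r)
  case (Suc k)
  have "dird v (\<lambda>x. c * p x) = (\<lambda>x. c * dird v p x)" for v
    using Suc.prems dird_scaleR[of p _ v c] by (auto intro!: smooth_on_differentiable)
  then show ?case using Suc by (simp add: smooth_on_dird sum_distrib_left)
qed simp

lemma smooth_on_mult_left: "open S \<Longrightarrow> smooth_on S p \<Longrightarrow> smooth_on S (\<lambda>x. (c::real) * p x)"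
  using smooth_on_scaleR[of S p c] by simp

lemma fischer_zero_left [simp]: "fischer b k (\<lambda>x. 0) r = 0"
  using fischer_mult_left[OF smooth_on_const, of b k 0 0 r] by simp

lemma fischer_diff_left:
  assumes "smooth_on UNIV p" "smooth_on UNIV q"
  shows "fischer b k (\<lambda>x. p x - q x) r = fischer b k p r - fischer b k q r"
  using fischer_add_left[OF assms(1) smooth_on_mult_left[OF _ assms(2)], of b k "-1" r]
    fischer_mult_left[OF assms(2), of b k "-1" r] by simp

lemma fischer_sum_left:
  assumes "\<And>i. i \<in> I \<Longrightarrow> smooth_on UNIV (p i)"
  shows "fischer b k (\<lambda>x. \<Sum>i\<in>I. c i * p i x) r = (\<Sum>i\<in>I. c i * fischer b k (p i) r)"
  using assms
proof (induction I rule: infinite_finite_induct)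
  case (insert i I)
  then have "fischer b k (\<lambda>x. c i * p i x + (\<Sum>i\<in>I. c i * p i x)) r
      = fischer b k (\<lambda>x. c i * p i x) r + fischer b k (\<lambda>x. \<Sum>i\<in>I. c i * p i x) r"
    by (intro fischer_add_left smooth_on_sum smooth_on_mult_left) auto
  then show ?case using insert by (simp add: fischer_mult_left)
qed auto

lemma dird_zero_if_basis:
  assumes b: "span (range b) = UNIV" and p: "p differentiable (at x)" and z: "\<And>i. dird (b i) p x = 0"
  shows "dird v p x = 0"
proof -
  have "v \<in> span (range b)" using b by simp
  from linear_eq_0_on_span[OF linear_dird[OF p] _ this] show ?thesis using z by auto
qed

text \<open>A vanishing sum of nonnegative terms makes all first derivatives zero by induction, and
  Euler's identity returns to \<open>p\<close>.\<close>

lemma fischer_definite: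
  assumes b: "span (range b) = UNIV" and "homogeneous_poly k p" "fischer b k p p = 0"
  shows "p = (\<lambda>x. 0)"
  using assms(2,3)
proof (induction k arbitrary: p)
  case 0
  then show ?case unfolding homogeneous_poly_def
    by (metis fischer.simps(1) mult_eq_0_iff power_0 scaleR_one scaleR_zero_left)
next
  case (Suc k)
  have "fischer b k (dird (b i) p) (dird (b i) p) = 0" for i
    using Suc.prems(2) by (simp add: sum_nonneg_eq_0_iff fischer_nonneg)
  then have "dird (b i) p = (\<lambda>x. 0)" for i
    by (intro Suc.IH homogeneous_poly_dird Suc.prems)
  then have 0: "dird (b i) p x = 0" for i x by simp
  have "dird x p x = 0" for x
    by (rule dird_zero_if_basis[OF b smooth_on_differentiable[OF smooth_on_homogeneous_poly[OF Suc.prems(1)] UNIV_I] 0])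
  then show ?case using dird_homogeneous_self[OF Suc.prems(1)] by (auto simp: fun_eq_iff)
qed

section \<open>The derivative along a linear vector field and its Fischer adjoint\<close>

definition lie_deriv :: "('v::euclidean_space \<Rightarrow> 'v) \<Rightarrow> ('v \<Rightarrow> real) \<Rightarrow> 'v \<Rightarrow> real" where
  "lie_deriv L p = (\<lambda>x. dird (L x) p x)"

lemma lie_deriv_expand:
  assumes "smooth_on UNIV p"
  shows "lie_deriv L p = (\<lambda>x. \<Sum>i\<in>Basis. (L x \<bullet> i) * dird i p x)"
proof
  show "lie_deriv L p x = (\<Sum>i\<in>Basis. (L x \<bullet> i) * dird i p x)" for x
    unfolding lie_deriv_def using dird_expand[OF smooth_on_differentiable[OF assms UNIV_I], of "L x" x] by simp
qed

lemma smooth_on_lie_deriv: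
  assumes "linear L" "smooth_on UNIV p"
  shows "smooth_on UNIV (lie_deriv L p)"
  unfolding lie_deriv_expand[OF assms(2)]
  using assms bounded_linear_compose[OF bounded_linear_inner_left, of L] unfolding linear_conv_bounded_linear
  by (intro smooth_on_sum open_UNIV smooth_on_bilinear[OF bounded_bilinear_mult])
    (auto intro: smooth_on_dird smooth_on_bounded_linear)

lemma homogeneous_poly_lie_deriv:
  assumes "linear L" "homogeneous_poly k p"
  shows "homogeneous_poly k (lie_deriv L p)"
proof (cases k)
  case 0
  then have "lie_deriv L p = (\<lambda>x. 0)"
    using assms(2) by (simp add: lie_deriv_def fun_eq_iff dird_homogeneous_zero)
  then show ?thesis by (simp add: homogeneous_poly_zero)
next
  case (Suc n)
  have "homogeneous_poly 1 (\<lambda>x. L x \<bullet> i)" for i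
    using assms(1) bounded_linear_compose[OF bounded_linear_inner_left, of L i]
    by (intro homogeneous_poly_linear) (simp add: linear_conv_bounded_linear)
  then have "homogeneous_poly (1 + n) (\<lambda>x. (L x \<bullet> i) * dird i p x)" for i
    using assms(2) unfolding Suc by (rule homogeneous_poly_mult[OF _ homogeneous_poly_dird])
  then show ?thesis
    unfolding lie_deriv_expand[OF smooth_on_homogeneous_poly[OF assms(2)]]
    using homogeneous_poly_sum[of Basis "1 + n" "\<lambda>i x. (L x \<bullet> i) * dird i p x"] Suc by simp
qed

text \<open>Product rule: differentiation along \<open>v\<close> and along the field
  \<open>L\<close> commute up to differentiation along \<open>L v\<close>.\<close>

lemma dird_lie_deriv:
  assumes L: "linear L" and p: "smooth_on UNIV p"
  shows "dird v (lie_deriv L p) = (\<lambda>x. lie_deriv L (dird v p) x + dird (L v) p x)"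
proof
  fix x
  have bl: "bounded_linear (\<lambda>x. L x \<bullet> i)" for i
    using L bounded_linear_compose[OF bounded_linear_inner_left, of L i] by (simp add: linear_conv_bounded_linear)
  have "dird v (lie_deriv L p) x = (\<Sum>i\<in>Basis. dird v (\<lambda>x. (L x \<bullet> i) * dird i p x) x)"
    unfolding lie_deriv_expand[OF p]
    by (intro dird_sum smooth_on_differentiable[of UNIV] smooth_on_bilinear[OF bounded_bilinear_mult]
        smooth_on_bounded_linear bl smooth_on_dird p) auto
  also have "\<dots> = (\<Sum>i\<in>Basis. (L x \<bullet> i) * dird v (dird i p) x + (L v \<bullet> i) * dird i p x)"
    using dird_bilinear[OF bounded_bilinear_mult bounded_linear_imp_differentiable[OF bl] smooth_on_differentiable[OF smooth_on_dird[OF p] UNIV_I]]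
      dird_bounded_linear[OF bl]
    by (intro sum.cong) auto
  also have "\<dots> = (\<Sum>i\<in>Basis. (L x \<bullet> i) * dird i (dird v p) x) + (\<Sum>i\<in>Basis. (L v \<bullet> i) * dird i p x)"
    by (simp add: sum.distrib dird_commute[OF open_UNIV UNIV_I p, of v])
  also have "\<dots> = lie_deriv L (dird v p) x + dird (L v) p x"
    using dird_expand[OF smooth_on_differentiable[OF p UNIV_I], of "L v" x]
    by (simp add: lie_deriv_expand[OF smooth_on_dird[OF p]])
  finally show "dird v (lie_deriv L p) x = lie_deriv L (dird v p) x + dird (L v) p x" .
qed

text \<open>A relation symmetric in \<open>L\<close> and \<open>L'\<close>, so that the
  decomposition below can also be applied with the two exchanged.\<close>

definition transposed :: "('m::finite \<Rightarrow> 'v::euclidean_space) \<Rightarrow> ('v \<Rightarrow> 'v) \<Rightarrow> ('v \<Rightarrow> 'v) \<Rightarrow> bool" where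
  "transposed b L L' \<longleftrightarrow> linear L \<and> linear L' \<and>
    (\<exists>M. (\<forall>j. L (b j) = (\<Sum>i\<in>UNIV. M i j *\<^sub>R b i)) \<and> (\<forall>j. L' (b j) = (\<Sum>i\<in>UNIV. M j i *\<^sub>R b i)))"

lemma transposed_sym: "transposed b L L' \<Longrightarrow> transposed b L' L"
  unfolding transposed_def by (elim conjE exE, intro conjI, assumption+, rule_tac x="\<lambda>i j. M j i" in exI) auto

text \<open>Induction on \<open>k\<close> through \<open>dird_lie_deriv\<close>: the commutator
  terms form a double sum with coefficients \<open>M i j\<close>, and exchanging the indices turns
  it into the one for the transpose.\<close>

lemma fischer_lie_deriv:
  assumes T: "transposed b L L'" and "smooth_on UNIV p" "smooth_on UNIV q"
  shows "fischer b k (lie_deriv L p) q = fischer b k p (lie_deriv L' q)"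
  using assms(2,3)
proof (induction k arbitrary: p q)
  case 0
  have "L 0 = 0" "L' 0 = 0" using T by (auto simp: transposed_def linear_0)
  moreover have "dird 0 p 0 = 0" "dird 0 q 0 = 0"
    using dird_scaleR_arg[OF smooth_on_differentiable[OF 0(1) UNIV_I], of 0 0 0]
      dird_scaleR_arg[OF smooth_on_differentiable[OF 0(2) UNIV_I], of 0 0 0] by auto
  ultimately show ?case by (simp add: lie_deriv_def)
next
  case (Suc k)
  obtain M where M: "\<And>j. L (b j) = (\<Sum>i\<in>UNIV. M i j *\<^sub>R b i)" "\<And>j. L' (b j) = (\<Sum>i\<in>UNIV. M j i *\<^sub>R b i)"
    and lin: "linear L" "linear L'"
    using T unfolding transposed_def by blast
  have e: "dird (\<Sum>i\<in>UNIV. a i *\<^sub>R b i) p = (\<lambda>x. \<Sum>i\<in>UNIV. a i * dird (b i) p x)" if "smooth_on UNIV p" for a p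
    by (rule ext) (simp add: dird_sum_arg[OF smooth_on_differentiable[OF that UNIV_I]])
  \<comment> \<open>Stated for arbitrary \<open>L\<close>, \<open>M\<close>, \<open>p\<close>,
    \<open>q\<close>, since it is applied once to each side of the adjointness relation.\<close>
  have eq: "fischer b k (dird (b j) (lie_deriv L p)) (dird (b j) q)
     = fischer b k (lie_deriv L (dird (b j) p)) (dird (b j) q) + (\<Sum>i\<in>UNIV. M i j * fischer b k (dird (b i) p) (dird (b j) q))"
    if "linear L" "\<And>j. L (b j) = (\<Sum>i\<in>UNIV. M i j *\<^sub>R b i)" "smooth_on UNIV p" "smooth_on UNIV q" for j p q L M
    unfolding dird_lie_deriv[OF that(1,3)] that(2) e[OF that(3)]
    using that(1,3) by (subst fischer_add_left)
       (auto simp: fischer_sum_left smooth_on_dird intro!: smooth_on_sum smooth_on_mult_left smooth_on_lie_deriv smooth_on_dird)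
  have "fischer b (Suc k) (lie_deriv L p) q = (\<Sum>j\<in>UNIV. fischer b k (lie_deriv L (dird (b j) p)) (dird (b j) q))
      + (\<Sum>j\<in>UNIV. \<Sum>i\<in>UNIV. M i j * fischer b k (dird (b i) p) (dird (b j) q))"
    by (simp add: eq[OF lin(1) M(1) Suc.prems] sum.distrib)
  also have "\<dots> = (\<Sum>j\<in>UNIV. fischer b k (lie_deriv L' (dird (b j) q)) (dird (b j) p))
      + (\<Sum>j\<in>UNIV. \<Sum>i\<in>UNIV. M j i * fischer b k (dird (b i) q) (dird (b j) p))"
  proof (intro arg_cong2[where f="(+)"])
    have "fischer b k (lie_deriv L (dird (b j) p)) (dird (b j) q) = fischer b k (lie_deriv L' (dird (b j) q)) (dird (b j) p)" for j
      using Suc.IH[OF smooth_on_dird[OF Suc.prems(1)] smooth_on_dird[OF Suc.prems(2)]] fischer_commute by metis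
    then show "(\<Sum>j\<in>UNIV. fischer b k (lie_deriv L (dird (b j) p)) (dird (b j) q)) = (\<Sum>j\<in>UNIV. fischer b k (lie_deriv L' (dird (b j) q)) (dird (b j) p))"
      by simp
    show "(\<Sum>j\<in>UNIV. \<Sum>i\<in>UNIV. M i j * fischer b k (dird (b i) p) (dird (b j) q)) = (\<Sum>j\<in>UNIV. \<Sum>i\<in>UNIV. M j i * fischer b k (dird (b i) q) (dird (b j) p))"
      by (subst sum.swap, intro sum.cong refl, subst fischer_commute, rule refl)
  qed
  also have "\<dots> = fischer b (Suc k) (lie_deriv L' q) p"
    by (simp add: eq[OF lin(2) M(2) Suc.prems(2,1)] sum.distrib)
  finally show ?case by (simp only: fischer_commute)
qed

section \<open>Orthogonal decomposition of homogeneous polynomials\<close>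

lemma fischer_projection:
  assumes b: "span (range b) = UNIV" and "finite I" "\<And>i. i \<in> I \<Longrightarrow> homogeneous_poly k (f i)" "homogeneous_poly k h"
  shows "\<exists>c. \<forall>i\<in>I. fischer b k (\<lambda>x. h x - (\<Sum>j\<in>I. c j * f j x)) (f i) = 0"
  using assms(2-)
proof (induction I arbitrary: h)
  case (insert i0 I)
  have comb: "homogeneous_poly k (\<lambda>x. \<Sum>j\<in>I. c j * f j x)" for c :: "_ \<Rightarrow> real"
    using insert.prems by (intro homogeneous_poly_lincomb) auto
  \<comment> \<open>Gram-Schmidt: \<open>h\<close> and the new member \<open>f i0\<close> are both
    made orthogonal to the old family, and what remains of \<open>h\<close> is projected along what
    remains of \<open>f i0\<close>.\<close>
  obtain c1 where c1: "\<And>i. i \<in> I \<Longrightarrow> fischer b k (\<lambda>x. h x - (\<Sum>j\<in>I. c1 j * f j x)) (f i) = 0"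
    using insert.IH[of h] insert.prems by auto
  obtain c2 where c2: "\<And>i. i \<in> I \<Longrightarrow> fischer b k (\<lambda>x. f i0 x - (\<Sum>j\<in>I. c2 j * f j x)) (f i) = 0"
    using insert.IH[of "f i0"] insert.prems by auto
  define r where "r = (\<lambda>x. h x - (\<Sum>j\<in>I. c1 j * f j x))"
  define g where "g = (\<lambda>x. f i0 x - (\<Sum>j\<in>I. c2 j * f j x))"
  have hr: "homogeneous_poly k r" and hg: "homogeneous_poly k g"
    unfolding r_def g_def using insert.prems comb by (auto intro: homogeneous_poly_diff)
  \<comment> \<open>If \<open>fischer b k g g = 0\<close>, the division gives \<open>t = 0\<close>,
    and \<open>g\<close> itself vanishes by definiteness.\<close>
  define t where "t = fischer b k r g / fischer b k g g"
  define s where "s = (\<lambda>x. r x - t * g x)"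
  define c where "c = (\<lambda>j. if j = i0 then t else c1 j - t * c2 j)"
  note sm = smooth_on_homogeneous_poly
  have fs: "fischer b k s q = fischer b k r q - t * fischer b k g q" for q
    unfolding s_def using sm[OF hr] sm[OF hg] by (simp add: fischer_diff_left fischer_mult_left smooth_on_mult_left)
  have s: "h x - (\<Sum>j\<in>insert i0 I. c j * f j x) = s x" for x
  proof -
    have "(\<Sum>j\<in>I. c j * f j x) = (\<Sum>j\<in>I. c1 j * f j x) - t * (\<Sum>j\<in>I. c2 j * f j x)"
      unfolding sum_distrib_left sum_subtractf[symmetric] using insert.hyps
      by (intro sum.cong) (auto simp: c_def algebra_simps)
    then show ?thesis using insert.hyps by (simp add: c_def s_def r_def g_def algebra_simps)
  qed
  have 1: "fischer b k s (f i) = 0" if "i \<in> I" for i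
    unfolding fs using c1[OF that] c2[OF that] by (simp add: r_def g_def)
  have "fischer b k s g = 0"
  proof (cases "fischer b k g g = 0")
    case True
    then have "g = (\<lambda>x. 0)" by (rule fischer_definite[OF b hg])
    then show ?thesis by (simp add: fischer_commute[of b k s])
  qed (simp add: fs t_def)
  moreover have "fischer b k s (f i0) = fischer b k s g + (\<Sum>j\<in>I. c2 j * fischer b k s (f j))"
  proof -
    have "f i0 = (\<lambda>x. g x + (\<Sum>j\<in>I. c2 j * f j x))" by (auto simp: g_def)
    then have "fischer b k (f i0) s = fischer b k (\<lambda>x. g x + (\<Sum>j\<in>I. c2 j * f j x)) s" by simp
    also have "\<dots> = fischer b k g s + (\<Sum>j\<in>I. c2 j * fischer b k (f j) s)"
      using insert.prems sm by (subst fischer_add_left[OF sm[OF hg] sm[OF comb]], subst fischer_sum_left) auto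
    finally show ?thesis by (simp only: fischer_commute[of b k s])
  qed
  ultimately have "fischer b k s (f i0) = 0" using 1 by simp
  then show ?case unfolding s using 1 by (intro exI[of _ c]) (simp add: s)
qed auto

text \<open>Euler's identity expresses a polynomial of degree k+1 by products of coordinates with
  its first derivatives, which lie in the span for degree \<open>k\<close>.\<close>

lemma homogeneous_poly_finite_span:
  "\<exists>M. finite M \<and> (\<forall>m\<in>M. homogeneous_poly k m) \<and>
    (\<forall>p::'v::euclidean_space \<Rightarrow> real. homogeneous_poly k p \<longrightarrow> (\<exists>c. \<forall>x. p x = (\<Sum>m\<in>M. c m * m x)))"
proof (induction k)
  case 0
  have "p x = p 0" if "homogeneous_poly 0 p" for p :: "'v \<Rightarrow> real" and x
    using that unfolding homogeneous_poly_def by (metis power_0 scaleR_one scaleR_zero_left)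
  then have "\<exists>c. \<forall>x. p x = (\<Sum>m\<in>{\<lambda>x. 1}. c m * m x)" if "homogeneous_poly 0 p" for p :: "'v \<Rightarrow> real"
    using that by (intro exI[of _ "\<lambda>m. p 0"]) auto
  moreover have "homogeneous_poly 0 (\<lambda>x::'v. 1::real)" by (simp add: homogeneous_poly_def)
  ultimately show ?case
    by (intro exI[of _ "{\<lambda>x. 1}"]) blast
next
  case (Suc k)
  then obtain M :: "('v \<Rightarrow> real) set" where M: "finite M" "\<And>m. m \<in> M \<Longrightarrow> homogeneous_poly k m"
    "\<And>p. homogeneous_poly k p \<Longrightarrow> \<exists>c. \<forall>x. p x = (\<Sum>m\<in>M. c m * m x)" by blast
  define F where "F = (\<lambda>(i::'v, m) x. (x \<bullet> i) * (m x :: real))"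
  define Z where "Z = (Basis :: 'v set) \<times> M"
  have "finite Z" using M by (simp add: Z_def)
  have "\<exists>c. \<forall>x. p x = (\<Sum>m\<in>F ` Z. c m * m x)" if p: "homogeneous_poly (Suc k) p" for p
  proof -
    have "\<forall>i. \<exists>c. \<forall>x. dird i p x = (\<Sum>m\<in>M. c m * m x)"
      using M(3) homogeneous_poly_dird[OF p] by blast
    then obtain c where c: "\<And>i x. dird i p x = (\<Sum>m\<in>M. c i m * m x)" by metis
    define a where "a = (\<lambda>(i, m). c i m / real (Suc k))"
    \<comment> \<open>Different pairs may give the same function, so the coefficients are summed
      over the fibres of \<open>F\<close>.\<close>
    have "p x = (\<Sum>m\<in>F ` Z. (\<Sum>z\<in>{z\<in>Z. F z = m}. a z) * m x)" for x
    proof -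
      have "real (Suc k) * p x = (\<Sum>i\<in>Basis. (x \<bullet> i) * dird i p x)"
        using dird_homogeneous_self[OF p, of x] dird_expand[OF smooth_on_differentiable[OF smooth_on_homogeneous_poly[OF p]], of x x] by simp
      then have "p x = (\<Sum>i\<in>Basis. (x \<bullet> i) * dird i p x) / real (Suc k)" by (simp add: field_simps del: of_nat_Suc)
      also have "\<dots> = (\<Sum>i\<in>Basis. \<Sum>m\<in>M. a (i, m) * F (i, m) x)"
        by (simp add: c sum_divide_distrib sum_distrib_left a_def F_def mult_ac del: of_nat_Suc)
      also have "\<dots> = (\<Sum>z\<in>Z. a z * F z x)"
        unfolding Z_def by (simp add: sum.cartesian_product)
      also have "\<dots> = (\<Sum>m\<in>F ` Z. \<Sum>z\<in>{z\<in>Z. F z = m}. a z * F z x)"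
        by (rule sum.image_gen[OF \<open>finite Z\<close>])
      also have "\<dots> = (\<Sum>m\<in>F ` Z. (\<Sum>z\<in>{z\<in>Z. F z = m}. a z) * m x)"
        unfolding sum_distrib_right by (intro sum.cong) auto
      finally show ?thesis .
    qed
    then show ?thesis by (intro exI[of _ "\<lambda>m. \<Sum>z\<in>{z\<in>Z. F z = m}. a z"] allI)
  qed
  moreover have "homogeneous_poly (Suc k) (F z)" if "z \<in> Z" for z
  proof -
    have "homogeneous_poly (1 + k) (\<lambda>x. (x \<bullet> fst z) * snd z x)"
      by (rule homogeneous_poly_mult[OF homogeneous_poly_linear[OF bounded_linear.linear[OF bounded_linear_inner_left]]])
        (use that M(2) in \<open>auto simp: Z_def\<close>)
    then show ?thesis by (simp add: F_def split_beta)
  qed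
  ultimately show ?case using \<open>finite Z\<close> by (intro exI[of _ "F ` Z"]) auto
qed

lemma lie_deriv_add:
  assumes "smooth_on UNIV p" "smooth_on UNIV q"
  shows "lie_deriv L (\<lambda>x. p x + c * q x) x = lie_deriv L p x + c * lie_deriv L q x"
  unfolding lie_deriv_def using assms dird_scaleR[of q x "L x" c]
  by (subst dird_add) (auto intro!: smooth_on_differentiable smooth_on_mult_left)

lemma lie_deriv_sum:
  assumes "\<And>i. i \<in> I \<Longrightarrow> smooth_on UNIV (p i)"
  shows "lie_deriv L (\<lambda>x. \<Sum>i\<in>I. c i * p i x) x = (\<Sum>i\<in>I. c i * lie_deriv L (p i) x)"
  unfolding lie_deriv_def using assms dird_scaleR[of "p _" x "L x" "c _"]
  by (subst dird_sum) (auto intro!: smooth_on_differentiable smooth_on_mult_left sum.cong)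

text \<open>Project \<open>h\<close> onto the image of \<open>lie_deriv L\<close>. The remainder
  \<open>K\<close> is orthogonal to it, so by adjointness \<open>lie_deriv L' K\<close> is
  orthogonal to every homogeneous polynomial of degree \<open>k\<close>, itself included.\<close>

lemma fischer_decomposition:
  fixes h :: "'v::euclidean_space \<Rightarrow> real"
  assumes b: "span (range b) = UNIV" and T: "transposed b L L'" and h: "homogeneous_poly k h"
  obtains Q K where "homogeneous_poly k Q" "homogeneous_poly k K" "lie_deriv L' K = (\<lambda>x. 0)"
    "\<And>x. h x = lie_deriv L Q x + K x"
proof -
  obtain M :: "('v \<Rightarrow> real) set" where M: "finite M" "\<And>m. m \<in> M \<Longrightarrow> homogeneous_poly k m"
    "\<And>p. homogeneous_poly k p \<Longrightarrow> \<exists>c. \<forall>x. p x = (\<Sum>m\<in>M. c m * m x)"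
    using homogeneous_poly_finite_span[of k] by metis
  note sm = smooth_on_homogeneous_poly
  have lin: "linear L" "linear L'" using T by (auto simp: transposed_def)
  obtain c where c: "\<And>m. m \<in> M \<Longrightarrow> fischer b k (\<lambda>x. h x - (\<Sum>j\<in>M. c j * lie_deriv L j x)) (lie_deriv L m) = 0"
    using fischer_projection[OF b M(1), of k "lie_deriv L" h] M(2) homogeneous_poly_lie_deriv[OF lin(1)] h by blast
  define Q where "Q = (\<lambda>x. \<Sum>m\<in>M. c m * m x)"
  define K where "K = (\<lambda>x. h x - lie_deriv L Q x)"
  have Q: "homogeneous_poly k Q"
    unfolding Q_def using M by (intro homogeneous_poly_lincomb) auto
  have K: "homogeneous_poly k K"
    unfolding K_def by (intro homogeneous_poly_diff h homogeneous_poly_lie_deriv lin Q)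
  have "K = (\<lambda>x. h x - (\<Sum>j\<in>M. c j * lie_deriv L j x))"
    unfolding K_def Q_def using M(2) sm by (subst lie_deriv_sum) auto
  then have 0: "fischer b k m (lie_deriv L' K) = 0" if "m \<in> M" for m
    using c[OF that] fischer_lie_deriv[OF T sm[OF M(2)[OF that]] sm[OF K]] by (simp add: fischer_commute)
  have hK: "homogeneous_poly k (lie_deriv L' K)" by (intro homogeneous_poly_lie_deriv lin K)
  then obtain d where d: "lie_deriv L' K = (\<lambda>x. \<Sum>m\<in>M. d m * m x)" using M(3) by (metis ext)
  have "fischer b k (lie_deriv L' K) (lie_deriv L' K) = (\<Sum>m\<in>M. d m * fischer b k m (lie_deriv L' K))"
    by (subst (1) d) (rule fischer_sum_left[where p="\<lambda>m. m", OF sm[OF M(2)]])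
  also have "\<dots> = 0" by (rule sum.neutral) (simp add: 0)
  finally have "lie_deriv L' K = (\<lambda>x. 0)" by (rule fischer_definite[OF b hK])
  from that[OF Q K this] show ?thesis by (simp add: K_def)
qed

text \<open>Pairing \<open>u\<close> with itself and moving \<open>lie_deriv L\<close> to the other
  side gives zero. This yields uniqueness in the decomposition.\<close>

lemma image_kernel_lie_deriv_trivial:
  assumes b: "span (range b) = UNIV" and T: "transposed b L L'" and "homogeneous_poly k u"
    "smooth_on UNIV a" "u = lie_deriv L a" "lie_deriv L' u = (\<lambda>x. 0)"
  shows "u = (\<lambda>x. 0)"
proof (rule fischer_definite[OF b assms(3)])
  have "fischer b k (lie_deriv L a) u = fischer b k a (lie_deriv L' u)"
    by (rule fischer_lie_deriv[OF T assms(4) smooth_on_homogeneous_poly[OF assms(3)]])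
  then show "fischer b k u u = 0" using assms(5,6) by (simp add: fischer_commute[of b k a])
qed

text \<open>Chain rule for a \<open>g\<close> that intertwines \<open>L\<close> up to the sign
  \<open>s\<close>; \<open>s * s = 1\<close> brings the sign to the other side.\<close>

lemma lie_deriv_compose_linear:
  assumes "linear g" "smooth_on UNIV p" "\<And>x. L (g x) = s *\<^sub>R g (L x)" "s * s = 1"
  shows "lie_deriv L (\<lambda>x. p (g x)) x = s * lie_deriv L p (g x)"
proof -
  have g: "bounded_linear g" using assms(1) by (simp add: linear_conv_bounded_linear)
  have pd: "p differentiable (at (g x))" by (rule smooth_on_differentiable[OF assms(2) UNIV_I])
  have "lie_deriv L (\<lambda>x. p (g x)) x = dird (g (L x)) p (g x)"
    unfolding lie_deriv_def using dird_compose[OF bounded_linear_imp_differentiable[OF g] pd]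
    by (simp add: dird_bounded_linear[OF g])
  also have "g (L x) = s *\<^sub>R L (g x)" using assms(3,4) by simp
  finally show ?thesis by (simp add: lie_deriv_def dird_scaleR_arg[OF pd])
qed

text \<open>\<open>K\<close> and the representative \<open>Q\<close> in the image of \<open>lie_deriv L'\<close> are unique, hence inherit the symmetry of \<open>h\<close>.\<close>

lemma equivariant_fischer_decomposition:
  fixes h :: "'v::euclidean_space \<Rightarrow> real" and g :: "'i \<Rightarrow> 'v \<Rightarrow> 'v" and s1 s2 :: "'i \<Rightarrow> real"
  assumes b: "span (range b) = UNIV" and T: "transposed b L L'" and h: "homogeneous_poly k h"
    and g: "\<And>i. i \<in> G \<Longrightarrow> linear (g i)"
    and s1: "\<And>i. i \<in> G \<Longrightarrow> s1 i * s1 i = 1" and s2: "\<And>i. i \<in> G \<Longrightarrow> s2 i * s2 i = 1"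
    and L: "\<And>i x. i \<in> G \<Longrightarrow> L (g i x) = s2 i *\<^sub>R g i (L x)" and L': "\<And>i x. i \<in> G \<Longrightarrow> L' (g i x) = s2 i *\<^sub>R g i (L' x)"
    and hg: "\<And>i x. i \<in> G \<Longrightarrow> h (g i x) = s1 i * s2 i * h x"
  obtains Q K where "homogeneous_poly k Q" "homogeneous_poly k K" "lie_deriv L' K = (\<lambda>x. 0)"
    "\<And>x. h x = lie_deriv L Q x + K x"
    "\<And>i x. i \<in> G \<Longrightarrow> Q (g i x) = s1 i * Q x" "\<And>i x. i \<in> G \<Longrightarrow> K (g i x) = s1 i * s2 i * K x"
proof -
  obtain Q0 K where K: "homogeneous_poly k Q0" "homogeneous_poly k K" "lie_deriv L' K = (\<lambda>x. 0)"
    "\<And>x. h x = lie_deriv L Q0 x + K x"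
    using fischer_decomposition[OF b T h] by blast
  \<comment> \<open>The decomposition with \<open>L\<close> and \<open>L'\<close> exchanged splits
    off the part \<open>Q1\<close> of \<open>Q0\<close> killed by \<open>lie_deriv L\<close>;
    dropping it leaves \<open>lie_deriv L Q0\<close> unchanged.\<close>
  obtain Z Q1 where Z: "homogeneous_poly k Z" "homogeneous_poly k Q1" "lie_deriv L Q1 = (\<lambda>x. 0)"
    "\<And>x. Q0 x = lie_deriv L' Z x + Q1 x"
    using fischer_decomposition[OF b transposed_sym[OF T] K(1)] by blast
  define Q where "Q = lie_deriv L' Z"
  have lin: "linear L" "linear L'" using T by (auto simp: transposed_def)
  note sm = smooth_on_homogeneous_poly
  have Q: "homogeneous_poly k Q" unfolding Q_def by (intro homogeneous_poly_lie_deriv lin Z)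
  have hQ: "h x = lie_deriv L Q x + K x" for x
  proof -
    have "Q0 = (\<lambda>x. Q x + 1 * Q1 x)" using Z(4) by (auto simp: Q_def)
    then show ?thesis using K(4)[of x] Z(3) lie_deriv_add[OF sm[OF Q] sm[OF Z(2)], of L 1 x] by simp
  qed
  have "K (g i x) = s1 i * s2 i * K x \<and> Q (g i x) = s1 i * Q x" if i: "i \<in> G" for i x
  proof -
    have bg: "bounded_linear (g i)" using g[OF i] by (simp add: linear_conv_bounded_linear)
    have cg: "homogeneous_poly k (\<lambda>x. p (g i x))" if "homogeneous_poly k p" for p :: "'v \<Rightarrow> real"
      by (rule homogeneous_poly_compose_linear[OF that bg])
    have sc: "homogeneous_poly k (\<lambda>x. p x + c * q x)" if "homogeneous_poly k p" "homogeneous_poly k q" for p q :: "'v \<Rightarrow> real" and c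
      using homogeneous_poly_add[OF that(1) homogeneous_poly_scaleR[OF that(2)]] by simp
    note LC = lie_deriv_compose_linear[where g="g i" and s="s2 i", OF g[OF i] _ _ s2[OF i]]
    \<comment> \<open>\<open>u\<close> and \<open>a\<close> are the defects of symmetry.
      \<open>u\<close> lies in the image of \<open>lie_deriv L\<close> and is killed by
      \<open>lie_deriv L'\<close>; for \<open>a\<close> the roles are exchanged, so both
      vanish.\<close>
    define u where "u = (\<lambda>x. K (g i x) + (- (s1 i * s2 i)) * K x)"
    define a where "a = (\<lambda>x. Q x + (- s1 i) * Q (g i x))"
    have hu: "homogeneous_poly k u" unfolding u_def by (intro sc cg K)
    have ha: "homogeneous_poly k a" unfolding a_def by (intro sc cg Q)
    have La: "lie_deriv L a x = lie_deriv L Q x - s1 i * (s2 i * lie_deriv L Q (g i x))" for x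
      unfolding a_def lie_deriv_add[OF sm[OF Q] sm[OF cg[OF Q]]] by (simp add: LC[where L=L and p=Q, OF sm[OF Q] L[OF i]])
    have ua: "u x = s1 i * s2 i * lie_deriv L a x" for x
    proof -
      have "lie_deriv L Q (g i x) + K (g i x) = s1 i * s2 i * (lie_deriv L Q x + K x)"
        using hg[OF i, of x] by (simp add: hQ)
      moreover have "s1 i * s2 i * lie_deriv L a x = s1 i * s2 i * lie_deriv L Q x - (s1 i * s1 i) * (s2 i * s2 i) * lie_deriv L Q (g i x)"
        by (simp add: La algebra_simps)
      ultimately show ?thesis by (simp add: u_def s1[OF i] s2[OF i] algebra_simps)
    qed
    have u0: "u = (\<lambda>x. 0)"
    proof (rule image_kernel_lie_deriv_trivial[OF b T hu])
      show "smooth_on UNIV (\<lambda>x. 0 + (s1 i * s2 i) * a x)" by (simp add: smooth_on_mult_left sm[OF ha])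
      show "u = lie_deriv L (\<lambda>x. 0 + (s1 i * s2 i) * a x)"
        using lie_deriv_add[OF smooth_on_const sm[OF ha], of L 0 "s1 i * s2 i"] ua by (auto simp: lie_deriv_def dird_def)
      show "lie_deriv L' u = (\<lambda>x. 0)"
        unfolding u_def using lie_deriv_add[OF sm[OF cg[OF K(2)]] sm[OF K(2)], of L' "- (s1 i * s2 i)"]
          LC[where L=L' and p=K, OF sm[OF K(2)] L'[OF i]] K(3)
        by (simp only: fun_eq_iff mult_zero_right add_0_right simp_thms)
    qed
    have A1: "lie_deriv L a = (\<lambda>x. 0)"
    proof
      show "lie_deriv L a x = 0" for x using ua[of x] u0 s1[OF i] s2[OF i] by auto
    qed
    \<comment> \<open>Applying \<open>lie_deriv L'\<close> contributes a further
      \<open>s2 i\<close>, so the sign here is \<open>s1 i * s2 i\<close>, although \<open>Q\<close>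
      itself scales by \<open>s1 i\<close>.\<close>
    have A2: "a = lie_deriv L' (\<lambda>x. Z x + (- (s1 i * s2 i)) * Z (g i x))"
    proof
      fix x
      have "lie_deriv L' (\<lambda>x. Z x + (- (s1 i * s2 i)) * Z (g i x)) x = Q x - (s1 i * s2 i) * (s2 i * Q (g i x))"
        unfolding lie_deriv_add[OF sm[OF Z(1)] sm[OF cg[OF Z(1)]]] by (simp add: LC[where L=L' and p=Z, OF sm[OF Z(1)] L'[OF i]] Q_def)
      also have "(s1 i * s2 i) * (s2 i * Q (g i x)) = s1 i * (s2 i * s2 i) * Q (g i x)" by simp
      finally show "a x = lie_deriv L' (\<lambda>x. Z x + (- (s1 i * s2 i)) * Z (g i x)) x" by (simp add: a_def s2[OF i])
    qed
    have a0: "a = (\<lambda>x. 0)"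
      by (rule image_kernel_lie_deriv_trivial[OF b transposed_sym[OF T] ha sm[OF sc[OF Z(1) cg[OF Z(1)]]] A2 A1])
    have "Q x = s1 i * Q (g i x)" using fun_cong[OF a0, of x] by (simp add: a_def)
    then have "s1 i * Q x = (s1 i * s1 i) * Q (g i x)" by simp
    then show ?thesis using fun_cong[OF u0, of x] s1[OF i] by (simp add: u_def)
  qed
  then show ?thesis using that[OF Q K(2,3) hQ] by blast
qed

section \<open>Smooth inverses and Hamiltonian vector fields\<close>

lemma differentiable_bilinear:
  "bounded_bilinear B \<Longrightarrow> f differentiable (at x within S) \<Longrightarrow> g differentiable (at x within S) \<Longrightarrow>
    (\<lambda>x. B (f x) (g x)) differentiable (at x within S)"
  unfolding differentiable_def using bounded_bilinear.FDERIV by blast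

text \<open>A solution of a uniformly invertible linear system is as smooth as the data:
  differentiating gives a system with the same operator for \<open>dird w u\<close>, whose right
  side is C^k because \<open>u\<close> already is.\<close>

lemma Ck_on_solution:
  fixes A :: "'a::euclidean_space \<Rightarrow> 'b::euclidean_space \<Rightarrow> 'b"
  assumes V: "open V" and lin: "\<And>y. y \<in> V \<Longrightarrow> linear (A y)" and low: "\<And>y v. y \<in> V \<Longrightarrow> norm v \<le> 2 * norm (A y v)"
    and A: "\<And>v. Ck_on k V (\<lambda>y. A y v)" and h: "Ck_on k V h" and u: "\<And>y. y \<in> V \<Longrightarrow> A y (u y) = h y"
  shows "Ck_on k V u"
  using A h u
proof (induction k arbitrary: h u)
  case 0
  have "(u \<longlongrightarrow> u y0) (at y0)" if y0: "y0 \<in> V" for y0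
  proof -
    have "isCont (\<lambda>y. h y - A y (u y0)) y0"
      using 0 V y0 by (intro continuous_diff) (auto simp: continuous_on_eq_continuous_at)
    then have "((\<lambda>y. 2 * norm (h y - A y (u y0))) \<longlongrightarrow> 2 * norm (h y0 - A y0 (u y0))) (at y0)"
      unfolding isCont_def by (intro tendsto_mult_left tendsto_norm)
    then have *: "((\<lambda>y. 2 * norm (h y - A y (u y0))) \<longlongrightarrow> 0) (at y0)" using 0(3)[OF y0] by simp
    have "\<forall>\<^sub>F y in at y0. norm (u y - u y0) \<le> 2 * norm (h y - A y (u y0))"
      using eventually_at_in_open'[OF V y0]
    proof eventually_elim
      case (elim y)
      show ?case using low[OF elim, of "u y - u y0"] linear_diff[OF lin[OF elim]] 0(3)[OF elim] by simp
    qed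
    from Lim_null_comparison[OF this *] show ?thesis by (simp add: LIM_zero_iff)
  qed
  then show ?case using V by (simp add: continuous_on_eq_continuous_at isCont_def)
next
  case (Suc k)
  have uk: "Ck_on k V u"
    by (rule Suc.IH[OF Ck_on_SucD[OF Suc.prems(1)] Ck_on_SucD[OF Suc.prems(2)] Suc.prems(3)])
  have dA: "(\<lambda>y. A y v) differentiable (at y)" and dh: "h differentiable (at y)" if "y \<in> V" for y v
    using Suc.prems(1)[of v] Suc.prems(2) that by (auto simp: Ck_on_Suc_iff)
  have du: "u differentiable (at y0)" if y0: "y0 \<in> V" for y0
  proof -
    \<comment> \<open>\<open>A y (u y - u y0) = q y\<close>, so the derivative of \<open>u\<close>
      at \<open>y0\<close> should be the inverse of \<open>A y0\<close> applied to that of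
      \<open>q\<close>; this is \<open>D\<close> below.\<close>
    define q where "q = (\<lambda>y. h y - A y (u y0))"
    define q' where "q' = (\<lambda>v. dird v q y0)"
    have q: "(q has_derivative q') (at y0)" unfolding q'_def q_def
      by (intro has_derivative_dird differentiable_diff dA dh y0)
    have q0: "q y0 = 0" using Suc.prems(3)[OF y0] by (simp add: q_def)
    have "inj (A y0)"
    proof (rule iffD2[OF linear_injective_0[OF lin[OF y0]]], intro allI impI)
      show "x = 0" if "A y0 x = 0" for x using low[OF y0, of x] that by simp
    qed
    then have "surj (A y0)" by (rule linear_injective_imp_surjective[OF lin[OF y0]]) simp
    then obtain B where B: "linear B" "\<And>z. A y0 (B z) = z"
      using linear_surjective_right_inverse[OF lin[OF y0]] by (auto simp: fun_eq_iff)
    define D where "D = (\<lambda>w. B (q' w))"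
    have blD: "bounded_linear D"
      unfolding D_def using B(1) q by (auto intro: bounded_linear_compose has_derivative_bounded_linear simp: linear_conv_bounded_linear)
    then obtain K where K: "K \<ge> 0" "\<And>w. norm (D w) \<le> norm w * K" using bounded_linear.nonneg_bounded by blast
    \<comment> \<open>Measures the change of the operator from \<open>A y0\<close> to
      \<open>A y\<close> by its values on the basis; it tends to 0 since these are
      continuous.\<close>
    define S where "S = (\<lambda>y. \<Sum>i\<in>Basis. norm (A y i - A y0 i))"
    have "isCont S y0" unfolding S_def
      using differentiable_imp_continuous_within[OF dA[OF y0]] by (intro continuous_intros) auto
    moreover have "S y0 = 0" by (simp add: S_def)
    ultimately have S: "(S \<longlongrightarrow> 0) (at y0)" by (simp add: isCont_def)
    have est: "norm (u y - u y0 - D (y - y0)) \<le> 2 * (norm (q y - q' (y - y0)) + norm (y - y0) * K * S y)" if y: "y \<in> V" for y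
    proof -
      have "A y (u y - u y0 - D (y - y0)) = q y - A y (D (y - y0))"
        using Suc.prems(3)[OF y] by (simp add: linear_diff[OF lin[OF y]] q_def)
      also have "A y (D (y - y0)) = q' (y - y0) + (A y (D (y - y0)) - A y0 (D (y - y0)))"
        by (simp add: D_def B)
      also have "A y (D (y - y0)) - A y0 (D (y - y0)) = (\<Sum>i\<in>Basis. (D (y - y0) \<bullet> i) *\<^sub>R (A y i - A y0 i))"
        by (simp add: linear_expand[OF lin[OF y], of "D (y - y0)"] linear_expand[OF lin[OF y0], of "D (y - y0)"]
            sum_subtractf scaleR_diff_right)
      finally have 1: "A y (u y - u y0 - D (y - y0)) = (q y - q' (y - y0)) - (\<Sum>i\<in>Basis. (D (y - y0) \<bullet> i) *\<^sub>R (A y i - A y0 i))"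
        by simp
      have "norm (\<Sum>i\<in>Basis. (D (y - y0) \<bullet> i) *\<^sub>R (A y i - A y0 i)) \<le> (\<Sum>i\<in>Basis. (norm (y - y0) * K) * norm (A y i - A y0 i))"
        by (rule sum_norm_le) (auto intro!: mult_right_mono order_trans[OF Basis_le_norm K(2)])
      then have "norm (A y (u y - u y0 - D (y - y0))) \<le> norm (q y - q' (y - y0)) + norm (y - y0) * K * S y"
        unfolding 1 by (intro order_trans[OF norm_triangle_ineq4]) (simp add: S_def sum_distrib_left)
      then have "2 * norm (A y (u y - u y0 - D (y - y0))) \<le> 2 * (norm (q y - q' (y - y0)) + norm (y - y0) * K * S y)" by simp
      then show ?thesis by (rule order_trans[OF low[OF y]])
    qed
    have "((\<lambda>y. norm (u y - u y0 - D (y - y0)) / norm (y - y0)) \<longlongrightarrow> 0) (at y0)"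
    proof (rule Lim_null_comparison)
      have "((\<lambda>y. norm (q y - q y0 - q' (y - y0)) / norm (y - y0)) \<longlongrightarrow> 0) (at y0)"
        using q by (simp add: has_derivative_iff_norm)
      then have "((\<lambda>y. 2 * (norm (q y - q y0 - q' (y - y0)) / norm (y - y0) + K * S y)) \<longlongrightarrow> 2 * (0 + K * 0)) (at y0)"
        by (intro tendsto_intros S)
      then show "((\<lambda>y. 2 * (norm (q y - q' (y - y0)) / norm (y - y0) + K * S y)) \<longlongrightarrow> 0) (at y0)"
        by (simp add: q0)
      show "\<forall>\<^sub>F y in at y0. norm (norm (u y - u y0 - D (y - y0)) / norm (y - y0)) \<le> 2 * (norm (q y - q' (y - y0)) / norm (y - y0) + K * S y)"
        using eventually_at_in_open'[OF V y0] eventually_neq_at_within[of y0 y0 UNIV]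
      proof eventually_elim
        case (elim y)
        then show ?case using est[OF elim(1)] by (simp add: field_simps)
      qed
    qed
    then have "(u has_derivative D) (at y0)" using blD by (simp add: has_derivative_iff_norm)
    then show ?thesis by (auto simp: differentiable_def)
  qed
  \<comment> \<open>The right side comes from the product rule applied to A(y) u(y) = h(y), with
    \<open>u\<close> expanded in the basis.\<close>
  have "Ck_on k V (dird w u)" for w
  proof (rule Suc.IH[of "\<lambda>y. dird w h y - (\<Sum>i\<in>Basis. (u y \<bullet> i) *\<^sub>R dird w (\<lambda>y. A y i) y)"])
    show "Ck_on k V (\<lambda>y. A y v)" for v by (rule Ck_on_SucD[OF Suc.prems(1)])
    have "Ck_on k V (\<lambda>y. dird w h y + (-1) *\<^sub>R (\<Sum>i\<in>Basis. (u y \<bullet> i) *\<^sub>R dird w (\<lambda>y. A y i) y))"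
      using Suc.prems(1,2) by (intro Ck_on_add Ck_on_sum Ck_on_linear_compose[OF bounded_linear_scaleR_right] V
        Ck_on_bilinear[OF bounded_bilinear_scaleR V] Ck_on_linear_compose[OF bounded_linear_inner_left V uk])
        (auto simp: Ck_on_Suc_iff)
    then show "Ck_on k V (\<lambda>y. dird w h y - (\<Sum>i\<in>Basis. (u y \<bullet> i) *\<^sub>R dird w (\<lambda>y. A y i) y))" by simp
    fix y assume y: "y \<in> V"
    have dui: "(\<lambda>y. u y \<bullet> i) differentiable (at y)" for i
      using differentiable_compose[OF bounded_linear_imp_differentiable[OF bounded_linear_inner_left[of i]] du[OF y]] by simp
    have "dird w h y = dird w (\<lambda>y. \<Sum>i\<in>Basis. (u y \<bullet> i) *\<^sub>R A y i) y"
      using Suc.prems(3) linear_expand[OF lin] by (intro dird_cong_open[OF V _ y]) metis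
    also have "\<dots> = (\<Sum>i\<in>Basis. dird w (\<lambda>y. (u y \<bullet> i) *\<^sub>R A y i) y)"
      using dui dA[OF y] by (intro dird_sum) (rule differentiable_bilinear[OF bounded_bilinear_scaleR], auto)
    also have "\<dots> = (\<Sum>i\<in>Basis. (u y \<bullet> i) *\<^sub>R dird w (\<lambda>y. A y i) y + (dird w u y \<bullet> i) *\<^sub>R A y i)"
      using dird_bilinear[OF bounded_bilinear_scaleR dui dA[OF y], of w]
        dird_linear_compose[OF bounded_linear_inner_left du[OF y], of w]
      by simp
    also have "\<dots> = (\<Sum>i\<in>Basis. (u y \<bullet> i) *\<^sub>R dird w (\<lambda>y. A y i) y) + A y (dird w u y)"
      by (simp add: sum.distrib linear_expand[OF lin[OF y], of "dird w u y"])
    finally show "A y (dird w u y) = dird w h y - (\<Sum>i\<in>Basis. (u y \<bullet> i) *\<^sub>R dird w (\<lambda>y. A y i) y)" by simp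
  qed
  then show ?case using du by (simp add: Ck_on_Suc_iff)
qed

text \<open>The inverse function theorem yields a differentiable \<open>g\<close>. Its smoothness is
  bootstrapped: \<open>dird v g\<close> solves the linear system given by the derivative of
  \<open>F\<close> along \<open>g\<close>, so \<open>Ck_on_solution\<close> lifts \<open>g\<close>
  from C^k to C^(k+1).\<close>

lemma smooth_local_inverse:
  fixes F :: "'a::euclidean_space \<Rightarrow> 'a"
  assumes F: "smooth_on UNIV F" and F0: "F 0 = 0" and dF: "\<And>v. dird v F 0 = v"
  obtains V g where "open V" "0 \<in> V" "smooth_on V g" "g 0 = 0" "\<And>y. y \<in> V \<Longrightarrow> F (g y) = y"
    "\<And>y v. y \<in> V \<Longrightarrow> norm v \<le> 2 * norm (dird v F (g y))"
proof -
  have dd: "F differentiable (at x)" for x by (rule smooth_on_differentiable[OF F UNIV_I])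
  have cont: "isCont (dird i F) x" for i x
    using smooth_on_continuous[OF smooth_on_dird[OF F]] by (auto simp: continuous_on_eq_continuous_at)
  \<comment> \<open>Where \<open>S\<close> is below 1/2, the derivative of \<open>F\<close> moves a
    vector by at most half its norm; hence the factor 2 in the lower bound.\<close>
  define S where "S = (\<lambda>x. \<Sum>i\<in>Basis. norm (dird i F x - i))"
  have "isCont S 0"
    unfolding S_def using cont by (intro continuous_intros) auto
  then have "(S \<longlongrightarrow> S 0) (nhds 0)" by (simp only: isCont_def tendsto_at_iff_tendsto_nhds)
  then have "\<forall>\<^sub>F x in nhds 0. S x < 1 / 2" by (rule order_tendstoD) (simp add: S_def dF)
  then obtain U where U: "open U" "0 \<in> U" "\<And>x. x \<in> U \<Longrightarrow> (\<Sum>i\<in>Basis. norm (dird i F x - i)) < 1 / 2"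
    by (auto simp: eventually_nhds S_def)
  have low: "norm v \<le> 2 * norm (dird v F x)" if "x \<in> U" for v x
  proof -
    have "norm (v - dird v F x) = norm (\<Sum>i\<in>Basis. (v \<bullet> i) *\<^sub>R (i - dird i F x))"
      by (simp add: dird_expand[OF dd, of v x] euclidean_representation scaleR_diff_right sum_subtractf)
    also have "\<dots> \<le> (\<Sum>i\<in>Basis. norm v * norm (dird i F x - i))"
      by (rule sum_norm_le) (auto simp: norm_minus_commute intro!: mult_mono Basis_le_norm)
    also have "\<dots> \<le> norm v * (1 / 2)"
      unfolding sum_distrib_left[symmetric] using U(3)[OF that] by (intro mult_left_mono) auto
    finally have "norm (v - dird v F x) \<le> norm v / 2" by simp
    then show ?thesis using norm_triangle_sub[of v "dird v F x"] by linarith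
  qed
  define f' where "f' = (\<lambda>x. Blinfun (\<lambda>v. dird v F x))"
  have f': "blinfun_apply (f' x) = (\<lambda>v. dird v F x)" for x
    unfolding f'_def by (rule bounded_linear_Blinfun_apply) (rule has_derivative_bounded_linear[OF has_derivative_dird[OF dd]])
  obtain U' V g g' where V: "open U'" "U' \<subseteq> U" "0 \<in> U'" "open V" "F 0 \<in> V" "homeomorphism U' V F g"
    "\<And>y. y \<in> V \<Longrightarrow> (g has_derivative (g' y)) (at y)"
    "\<And>y. y \<in> V \<Longrightarrow> g' y = inv_into UNIV (blinfun_apply (f' (g y)))"
    "\<And>y. y \<in> V \<Longrightarrow> bij (blinfun_apply (f' (g y)))"
  proof (rule inverse_function_theorem[OF U(1), of F f' 0 id_blinfun])
    show "(F has_derivative blinfun_apply (f' x)) (at x)" for x unfolding f' by (rule has_derivative_dird[OF dd])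
    show "continuous_on U f'"
      using smooth_on_continuous[OF smooth_on_dird[OF F]]
      by (intro continuous_on_blinfun_componentwise) (auto simp: f' intro: continuous_on_subset)
    show "id_blinfun o\<^sub>L f' 0 = id_blinfun" by (rule blinfun_eqI) (simp add: f' dF)
  qed (use U in auto)
  have gU: "g y \<in> U" and Fg: "F (g y) = y" if "y \<in> V" for y
    using V(2,6) that by (auto simp: homeomorphism_def)
  have dg: "dird v g y = g' y v" if "y \<in> V" for v y by (rule dird_eq[OF V(7)[OF that]])
  have Ag: "dird (dird v g y) F (g y) = v" if "y \<in> V" for v y
    using surj_f_inv_f[OF bij_is_surj[OF V(9)[OF that]], of v] by (simp add: dg[OF that] V(8)[OF that] f')
  have "Ck_on k V g" for k
  proof (induction k)
    case 0
    then show ?case using V(6) by (simp add: homeomorphism_def)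
  next
    case (Suc k)
    have "Ck_on k V (dird v g)" for v
    proof (rule Ck_on_solution[OF V(4), of "\<lambda>y v. dird v F (g y)"])
      show "linear (\<lambda>v. dird v F (g y))" for y by (rule linear_dird[OF dd])
      show "Ck_on k V (\<lambda>y. dird v F (g y))" for v
        by (rule Ck_on_compose[OF V(4) open_UNIV subset_UNIV _ Suc])
          (use smooth_on_dird[OF F, of v] in \<open>simp add: smooth_on_def\<close>)
      show "Ck_on k V (\<lambda>y. v)" by (rule Ck_on_const)
      show "norm w \<le> 2 * norm (dird w F (g y))" if "y \<in> V" for y w by (rule low[OF gU[OF that]])
    qed (rule Ag)
    then show ?case using V(7) by (auto simp: Ck_on_Suc_iff differentiable_def)
  qed
  then have "smooth_on V g" by (simp add: smooth_on_def)
  moreover have "g 0 = 0" using V(3,6) F0 by (metis homeomorphism_apply1)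
  ultimately show ?thesis using that[of V g] V(4,5) F0 Fg low gU by simp
qed

section \<open>Symplectic duality and Hamiltonian vector fields\<close>

lemma symplectic_bilinear:
  assumes "symplectic_form \<omega>"
  shows "bounded_bilinear \<omega>"
  using assms unfolding symplectic_form_def by (simp add: bilinear_conv_bounded_bilinear)

text \<open>\<open>B\<close> inverts the map induced by \<omega>. It presents a Hamiltonian field as
  a fixed linear map of the gradient, so smoothness and orders of vanishing transfer from the
  derivatives of the Hamiltonian.\<close>

lemma symplectic_dual:
  fixes \<omega> :: "'v::euclidean_space \<Rightarrow> 'v \<Rightarrow> real"
  assumes w: "symplectic_form \<omega>"
  obtains B where "linear B" "\<And>g v. \<omega> (B g) v = g \<bullet> v"
proof -
  interpret bounded_bilinear \<omega> by (rule symplectic_bilinear[OF w])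
  define A where "A = (\<lambda>u. \<Sum>i\<in>Basis. \<omega> u i *\<^sub>R i)"
  have Av: "A u \<bullet> v = \<omega> u v" for u v
  proof -
    have "\<omega> u v = (\<Sum>i\<in>Basis. (v \<bullet> i) *\<^sub>R \<omega> u i)"
      by (rule linear_expand[OF bounded_linear.linear[OF bounded_linear_right]])
    then show ?thesis by (simp add: A_def inner_sum_left inner_commute[of v] mult.commute)
  qed
  have A: "linear A"
    unfolding A_def by (rule linearI) (auto simp: add_left scaleR_left scaleR_add_left sum.distrib scaleR_sum_right)
  have "inj A"
  proof (rule iffD2[OF linear_injective_0[OF A]], intro allI impI)
    fix u assume "A u = 0"
    then have "\<forall>v. \<omega> u v = 0" using Av[of u] by simp
    then show "u = 0" using w by (simp add: symplectic_form_def)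
  qed
  then have "surj A" by (rule linear_injective_imp_surjective[OF A]) simp
  then obtain B where "linear B" "\<And>z. A (B z) = z"
    using linear_surjective_right_inverse[OF A] by (auto simp: fun_eq_iff)
  then show ?thesis using that[of B] Av by metis
qed

lemma symplectic_nondegenerate:
  assumes w: "symplectic_form \<omega>" and "\<And>v. \<omega> u v = \<omega> u' v"
  shows "u = u'"
proof -
  interpret bounded_bilinear \<omega> by (rule symplectic_bilinear[OF w])
  have "\<forall>v. \<omega> (u - u') v = 0" by (simp add: diff_left assms(2))
  then show ?thesis using w unfolding symplectic_form_def by (metis eq_iff_diff_eq_0)
qed

lemma symplectic_skew:
  assumes w: "symplectic_form \<omega>"
  shows "\<omega> u v = - \<omega> v u"
proof -
  interpret bounded_bilinear \<omega> by (rule symplectic_bilinear[OF w])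
  have "\<omega> (u + v) (u + v) = 0" "\<omega> u u = 0" "\<omega> v v = 0" using w by (auto simp: symplectic_form_def)
  then show ?thesis by (simp add: add_left add_right)
qed

lemma ham_field_unique:
  assumes w: "symplectic_form \<omega>" and "(H has_derivative \<omega> u) (at x)"
  shows "ham_field \<omega> H x = u"
  unfolding ham_field_def
proof (rule the_equality)
  fix u' assume "(H has_derivative \<omega> u') (at x)"
  then have "\<omega> u' = \<omega> u" using assms(2) has_derivative_unique by blast
  then show "u' = u" using symplectic_nondegenerate[OF w] by metis
qed fact

lemma ham_field_conv_gradient:
  fixes \<omega> :: "'v::euclidean_space \<Rightarrow> 'v \<Rightarrow> real"
  assumes w: "symplectic_form \<omega>" and B: "\<And>g v. \<omega> (B g) v = g \<bullet> v" and H: "H differentiable (at x)"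
  shows "ham_field \<omega> H x = B (\<Sum>i\<in>Basis. dird i H x *\<^sub>R i)"
proof (rule ham_field_unique[OF w])
  have "\<omega> (B (\<Sum>i\<in>Basis. dird i H x *\<^sub>R i)) = (\<lambda>v. dird v H x)"
  proof
    show "\<omega> (B (\<Sum>i\<in>Basis. dird i H x *\<^sub>R i)) v = dird v H x" for v
      using dird_expand[OF H, of v] by (simp add: B inner_sum_left inner_commute[of v] mult.commute)
  qed
  then show "(H has_derivative \<omega> (B (\<Sum>i\<in>Basis. dird i H x *\<^sub>R i))) (at x)"
    using has_derivative_dird[OF H] by simp
qed

lemma ham_field_dird:
  assumes w: "symplectic_form \<omega>" and H: "H differentiable (at x)"
  shows "\<omega> (ham_field \<omega> H x) v = dird v H x"
proof -
  obtain B where B: "linear B" "\<And>g v. \<omega> (B g) v = g \<bullet> v" using symplectic_dual[OF w] by blast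
  then show ?thesis unfolding ham_field_conv_gradient[OF w B(2) H]
    using dird_expand[OF H, of v] by (simp add: inner_sum_left inner_commute[of v] mult.commute)
qed

lemma ham_field_eqI:
  assumes w: "symplectic_form \<omega>" and H: "H differentiable (at x)" and "\<And>v. \<omega> u v = dird v H x"
  shows "ham_field \<omega> H x = u"
  by (rule symplectic_nondegenerate[OF w]) (simp add: ham_field_dird[OF w H] assms)

lemma smooth_on_ham_field:
  fixes \<omega> :: "'v::euclidean_space \<Rightarrow> 'v \<Rightarrow> real"
  assumes w: "symplectic_form \<omega>" and S: "open S" and H: "smooth_on S H"
  shows "smooth_on S (ham_field \<omega> H)"
proof -
  obtain B where B: "linear B" "\<And>g v. \<omega> (B g) v = g \<bullet> v" using symplectic_dual[OF w] by blast
  have "smooth_on S (\<lambda>x. B (\<Sum>i\<in>Basis. dird i H x *\<^sub>R i))"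
    using B(1) by (intro smooth_on_linear_compose[where h=B] smooth_on_sum S smooth_on_linear_compose[OF bounded_linear_scaleR_left] smooth_on_dird H)
      (simp add: linear_conv_bounded_linear)
  then show ?thesis
    by (rule smooth_on_cong[OF _ S]) (simp add: ham_field_conv_gradient[OF w B(2) smooth_on_differentiable[OF H]])
qed

lemma flat_ham_field:
  fixes \<omega> :: "'v::euclidean_space \<Rightarrow> 'v \<Rightarrow> real"
  assumes w: "symplectic_form \<omega>" and S: "open S" "0 \<in> S" and H: "smooth_on S H" and f: "flat (Suc m) H"
  shows "flat m (ham_field \<omega> H)"
proof -
  obtain B where B: "linear B" "\<And>g v. \<omega> (B g) v = g \<bullet> v" using symplectic_dual[OF w] by blast
  have "flat m (\<lambda>x. B (\<Sum>i\<in>Basis. dird i H x *\<^sub>R i))"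
    using B(1) by (intro flat_linear[where h=B] flat_sum flat_linear[OF bounded_linear_scaleR_left] flat_dird[OF S H f])
      (simp add: linear_conv_bounded_linear)
  then show ?thesis
    by (rule flat_cong_open[OF _ S]) (simp add: ham_field_conv_gradient[OF w B(2) smooth_on_differentiable[OF H]])
qed

lemma ham_field_add:
  assumes w: "symplectic_form \<omega>" and "H differentiable (at x)" "G differentiable (at x)"
  shows "ham_field \<omega> (\<lambda>x. H x + G x) x = ham_field \<omega> H x + ham_field \<omega> G x"
proof (rule ham_field_eqI[OF w])
  interpret bounded_bilinear \<omega> by (rule symplectic_bilinear[OF w])
  show "\<omega> (ham_field \<omega> H x + ham_field \<omega> G x) v = dird v (\<lambda>x. H x + G x) x" for v
    using assms by (simp add: add_left ham_field_dird dird_add)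
qed (use assms in auto)

text \<open>The factor \<open>s\<close> appears in \<omega> and in \<open>P\<close> alike and
  cancels, so the field commutes with \<open>g\<close> without a sign, and so do the half steps x
  \<pm> X_P(x)/2.\<close>

lemma ham_field_equivariant:
  assumes w: "symplectic_form \<omega>" and P: "smooth_on UNIV P" and g: "linear g" "surj g"
    and wg: "\<And>u v. \<omega> (g u) (g v) = s * \<omega> u v" and Pg: "\<And>x. P (g x) = s * P x"
  shows "ham_field \<omega> P (g x) = g (ham_field \<omega> P x)"
proof (rule ham_field_eqI[OF w])
  have bg: "bounded_linear g" using g(1) by (simp add: linear_conv_bounded_linear)
  have Pd: "P differentiable (at x)" for x by (rule smooth_on_differentiable[OF P UNIV_I])
  show "P differentiable (at (g x))" by (rule Pd)
  fix v
  obtain v' where v: "v = g v'" using g(2) by (metis surjD)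
  have "dird v P (g x) = dird v' (\<lambda>x. P (g x)) x"
    using dird_compose[OF bounded_linear_imp_differentiable[OF bg] Pd, where v=v' and x=x] by (simp add: dird_bounded_linear[OF bg] v)
  also have "\<dots> = s * dird v' P x" using dird_scaleR[OF Pd, of v' s x] by (simp add: Pg)
  finally show "\<omega> (g (ham_field \<omega> P x)) v = dird v P (g x)"
    by (simp add: v wg ham_field_dird[OF w Pd])
qed

text \<open>The Hessian of \<open>P\<close> is symmetric, so the linear parts of the two pullbacks of \<open>\<omega>\<close> vanish.\<close>

lemma cayley_pullback:
  assumes w: "symplectic_form \<omega>" and P: "smooth_on UNIV P"
  shows "\<omega> (u + (1/2) *\<^sub>R dird u (ham_field \<omega> P) x) (v + (1/2) *\<^sub>R dird v (ham_field \<omega> P) x)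
       = \<omega> (u - (1/2) *\<^sub>R dird u (ham_field \<omega> P) x) (v - (1/2) *\<^sub>R dird v (ham_field \<omega> P) x)"
proof -
  interpret bounded_bilinear \<omega> by (rule symplectic_bilinear[OF w])
  let ?X = "ham_field \<omega> P"
  note sX = smooth_on_ham_field[OF w open_UNIV P]
  have *: "\<omega> (dird u ?X x) v = dird u (dird v P) x" for u v
  proof -
    have "dird v P = (\<lambda>x. \<omega> (?X x) v)"
      using ham_field_dird[OF w smooth_on_differentiable[OF P UNIV_I]] by (simp add: fun_eq_iff)
    then show ?thesis
      using dird_linear_compose[OF bounded_linear_left smooth_on_differentiable[OF sX UNIV_I]] by simp
  qed
  have "\<omega> u (dird v ?X x) = - \<omega> (dird u ?X x) v"
    using symplectic_skew[OF w, of u "dird v ?X x"] *[of u v] *[of v u] dird_commute[OF open_UNIV UNIV_I P, of u v x] by simp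
  then show ?thesis by (simp add: add_left add_right diff_left diff_right scaleR_left scaleR_right field_simps)
qed

section \<open>The closure of the matrix exponentials\<close>

lemma coords_sum:
  assumes "indexed_basis b"
  shows "(\<Sum>i\<in>UNIV. coords b x $ i *\<^sub>R b i) = x"
proof -
  have b: "inj b" "independent (range b)" "span (range b) = UNIV" using assms by (auto simp: indexed_basis_def)
  have "(\<Sum>i\<in>UNIV. coords b x $ i *\<^sub>R b i) = (\<Sum>v\<in>range b. representation (range b) x v *\<^sub>R v)"
    unfolding coords_def by (simp add: sum.reindex[OF b(1)])
  also have "\<dots> = x"
    using b by (intro real_vector.sum_representation_eq) auto
  finally show ?thesis .
qed

lemma coords_unique:
  assumes b: "indexed_basis b"
  shows "coords b (\<Sum>i\<in>UNIV. a $ i *\<^sub>R b i) = a"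
proof -
  have i: "inj b" "independent (range b)" using b by (auto simp: indexed_basis_def)
  define x where "x = (\<Sum>i\<in>UNIV. a $ i *\<^sub>R b i)"
  have "(\<Sum>i\<in>UNIV. (coords b x $ i - a $ i) *\<^sub>R b i) = 0"
    using coords_sum[OF b, of x] by (simp add: scaleR_diff_left sum_subtractf x_def)
  then have "(\<Sum>v\<in>range b. (\<lambda>v. coords b x $ inv_into UNIV b v - a $ inv_into UNIV b v) v *\<^sub>R v) = 0"
    by (simp add: sum.reindex[OF i(1)] i(1))
  from independentD[OF i(2) _ subset_refl this] have "coords b x $ j - a $ j = 0" for j
    using i(1) inv_f_f[OF i(1), of j] by fastforce
  then show ?thesis by (simp add: vec_eq_iff x_def)
qed

lemma mat_act_sum:
  "mat_act b A x = (\<Sum>i\<in>UNIV. \<Sum>j\<in>UNIV. (A $ i $ j * coords b x $ j) *\<^sub>R b i)"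
  by (simp add: mat_act_def matrix_vector_mult_def scaleR_sum_left)

lemma mat_act_basis:
  assumes b: "indexed_basis b"
  shows "mat_act b A (b j) = (\<Sum>i\<in>UNIV. A $ i $ j *\<^sub>R b i)"
proof -
  have "b j = (\<Sum>i\<in>UNIV. axis j (1::real) $ i *\<^sub>R b i)"
    by (simp add: axis_def if_distrib[where f="\<lambda>c. c *\<^sub>R _"] cong: if_cong)
  then have "coords b (b j) = axis j 1" using coords_unique[OF b, of "axis j 1"] by simp
  then show ?thesis by (simp add: mat_act_def matrix_vector_mult_basis column_def)
qed

lemma linear_coords:
  assumes b: "indexed_basis b"
  shows "linear (coords b)"
proof (rule linearI)
  fix x y :: 'b and c :: real
  have "coords b (x + y) = coords b (\<Sum>i\<in>UNIV. (coords b x + coords b y) $ i *\<^sub>R b i)"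
    by (simp add: scaleR_add_left sum.distrib coords_sum[OF b])
  then show "coords b (x + y) = coords b x + coords b y" by (simp only: coords_unique[OF b])
  have "coords b (c *\<^sub>R x) = coords b (\<Sum>i\<in>UNIV. (c *\<^sub>R coords b x) $ i *\<^sub>R b i)"
    using coords_sum[OF b, of x] by (simp flip: scaleR_scaleR scaleR_sum_right)
  then show "coords b (c *\<^sub>R x) = c *\<^sub>R coords b x" by (simp only: coords_unique[OF b])
qed

lemma linear_mat_act:
  assumes b: "indexed_basis b"
  shows "linear (mat_act b A)"
  using linear_coords[OF b] unfolding mat_act_sum[abs_def]
  by (intro linearI) (simp_all add: linear_add linear_cmul distrib_left scaleR_add_left sum.distrib scaleR_sum_right mult_ac)

lemma linear_matrix_of:
  assumes b: "indexed_basis b"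
  shows "L (b j) = (\<Sum>i\<in>UNIV. matrix_of b L $ i $ j *\<^sub>R b i)"
  using coords_sum[OF b, of "L (b j)"] by (simp add: matrix_of_def)

lemma transposed_transpose_matrix:
  assumes b: "indexed_basis b" and L: "linear L"
  shows "transposed b L (mat_act b (transpose (matrix_of b L)))"
  unfolding transposed_def using linear_matrix_of[OF b, of L] mat_act_basis[OF b] linear_mat_act[OF b] L
  by (intro conjI exI[of _ "\<lambda>i j. matrix_of b L $ i $ j"]) (auto simp: transpose_def)

lemma mat_act_mult:
  assumes b: "indexed_basis b"
  shows "mat_act b (A ** B) x = mat_act b A (mat_act b B x)"
proof -
  have "coords b (mat_act b B x) = B *v coords b x"
    unfolding mat_act_def by (rule coords_unique[OF b])
  then show ?thesis by (simp add: mat_act_def matrix_vector_mul_assoc)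
qed

lemma mat_act_mat_1: "indexed_basis b \<Longrightarrow> mat_act b (mat 1) x = x"
  by (simp add: mat_act_def coords_sum)

section \<open>Power series for the entries of the matrix exponential\<close>

lemma matrix_power_scaleR:
  "((**) (s *\<^sub>R M) ^^ k) (mat 1) = s ^ k *\<^sub>R ((**) M ^^ k) (mat 1)" for M :: "real ^ 'm::finite ^ 'm"
  by (induction k) (auto simp: matrix_matrix_mult_def vec_eq_iff sum_distrib_left mult_ac)

lemma matrix_power_entry_bound:
  fixes M :: "real ^ 'm::finite ^ 'm"
  obtains C where "C \<ge> 0" "\<And>k i j. \<bar>((**) M ^^ k) (mat 1) $ i $ j\<bar> \<le> C ^ k"
proof -
  \<comment> \<open>The sum over all entries dominates every row sum, so each factor
    \<open>M\<close> enlarges the entries at most by \<open>C\<close>.\<close>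
  define C where "C = (\<Sum>i\<in>UNIV. \<Sum>l\<in>UNIV. \<bar>M $ i $ l\<bar>)"
  have "\<bar>((**) M ^^ k) (mat 1) $ i $ j\<bar> \<le> C ^ k" for k i j
  proof (induction k arbitrary: i j)
    case 0
    then show ?case by (simp add: mat_def)
  next
    case (Suc k)
    have "\<bar>((**) M ^^ Suc k) (mat 1) $ i $ j\<bar> \<le> (\<Sum>l\<in>UNIV. \<bar>M $ i $ l * ((**) M ^^ k) (mat 1) $ l $ j\<bar>)"
      by (simp add: matrix_matrix_mult_def sum_abs)
    also have "\<dots> \<le> (\<Sum>l\<in>UNIV. \<bar>M $ i $ l\<bar> * C ^ k)"
      by (intro sum_mono) (simp add: abs_mult Suc mult_left_mono)
    also have "\<dots> \<le> C * C ^ k"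
      unfolding sum_distrib_right[symmetric] C_def
      by (intro mult_right_mono member_le_sum[where f="\<lambda>i. \<Sum>l\<in>UNIV. \<bar>M $ i $ l\<bar>"]) (auto intro!: sum_nonneg zero_le_power)
    finally show ?case by simp
  qed
  moreover have "C \<ge> 0" by (auto simp: C_def intro!: sum_nonneg)
  ultimately show ?thesis using that by blast
qed

lemma summable_matrix_power_entry:
  fixes M :: "real ^ 'm::finite ^ 'm"
  shows "summable (\<lambda>k. \<bar>((**) M ^^ k) (mat 1) $ i $ j / fact k * s ^ k\<bar>)"
proof -
  obtain C where C: "C \<ge> 0" "\<And>k i j. \<bar>((**) M ^^ k) (mat 1) $ i $ j\<bar> \<le> C ^ k"
    using matrix_power_entry_bound by blast
  have "summable (\<lambda>k. (C * \<bar>s\<bar>) ^ k /\<^sub>R fact k)" by (rule summable_exp_generic)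
  then show ?thesis
  proof (rule summable_comparison_test[OF exI[of _ 0], OF allI, OF impI, rotated])
    show "norm \<bar>((**) M ^^ k) (mat 1) $ i $ j / fact k * s ^ k\<bar> \<le> (C * \<bar>s\<bar>) ^ k /\<^sub>R fact k" for k
      using mult_right_mono[OF C(2)[of k i j], of "\<bar>s\<bar> ^ k / fact k"]
      by (simp add: abs_mult power_abs power_mult_distrib field_simps)
  qed
qed

text \<open>The matrix series converges absolutely and taking an entry is continuous and linear, so
  each entry is an ordinary power series in \<open>s\<close>, open to termwise
  differentiation.\<close>

lemma mat_exp_entry:
  fixes M :: "real ^ 'm::finite ^ 'm"
  shows "mat_exp (s *\<^sub>R M) $ i $ j = (\<Sum>k. ((**) M ^^ k) (mat 1) $ i $ j / fact k * s ^ k)"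
proof -
  define T where "T = (\<lambda>k. (s ^ k *\<^sub>R ((**) M ^^ k) (mat 1)) /\<^sub>R fact k :: real ^ 'm ^ 'm)"
  have "summable (\<lambda>k. norm (T k))"
  proof (rule summable_comparison_test[OF exI[of _ 0], OF allI, OF impI])
    show "norm (norm (T k)) \<le> (\<Sum>i\<in>UNIV. \<Sum>j\<in>UNIV. \<bar>((**) M ^^ k) (mat 1) $ i $ j / fact k * s ^ k\<bar>)" for k
    proof -
      have "norm (T k) \<le> (\<Sum>i\<in>UNIV. norm (T k $ i))" unfolding norm_vec_def[of "T k"] by (rule L2_set_le_sum) simp
      also have "\<dots> \<le> (\<Sum>i\<in>UNIV. \<Sum>j\<in>UNIV. \<bar>T k $ i $ j\<bar>)" by (intro sum_mono norm_le_l1_cart)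
      finally show ?thesis by (simp add: T_def divide_inverse mult_ac)
    qed
    show "summable (\<lambda>k. \<Sum>i\<in>UNIV. \<Sum>j\<in>UNIV. \<bar>((**) M ^^ k) (mat 1) $ i $ j / fact k * s ^ k\<bar>)"
      by (intro summable_sum summable_matrix_power_entry)
  qed
  then have T: "summable T" by (rule summable_norm_cancel)
  have bl: "bounded_linear (\<lambda>A :: real ^ 'm ^ 'm. A $ i $ j)"
    by (rule bounded_linear_compose[OF bounded_linear_vec_nth bounded_linear_vec_nth])
  have "mat_exp (s *\<^sub>R M) = (\<Sum>k. T k)" by (simp add: mat_exp_def T_def matrix_power_scaleR)
  then show ?thesis using bounded_linear.suminf[OF bl T] by (simp add: T_def divide_inverse mult_ac)
qed

text \<open>With c_k = M^k/k!, one has (k+1) c_(k+1) = M c_k, so termwise differentiation multiplies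
  by \<open>M\<close> on the left.\<close>

lemma mat_exp_entry_derivative:
  fixes M :: "real ^ 'm::finite ^ 'm"
  shows "((\<lambda>s. mat_exp (s *\<^sub>R M) $ i $ j) has_real_derivative (M ** mat_exp (s *\<^sub>R M)) $ i $ j) (at s)"
proof -
  define c where "c = (\<lambda>i j k. ((**) M ^^ k) (mat 1) $ i $ j / fact k)"
  have sm: "summable (\<lambda>k. c i j k * y ^ k)" for i j y
    using summable_matrix_power_entry[of M i j y] unfolding c_def by (rule summable_rabs_cancel)
  have d: "diffs (c i j) k = (\<Sum>l\<in>UNIV. M $ i $ l * c l j k)" for k
  proof -
    have "diffs (c i j) k = ((**) M ^^ Suc k) (mat 1) $ i $ j / fact k"
      by (simp add: diffs_def c_def field_simps del: funpow.simps of_nat_Suc)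
    then show ?thesis by (simp add: matrix_matrix_mult_def c_def sum_divide_distrib)
  qed
  have "((\<lambda>s. \<Sum>k. c i j k * s ^ k) has_real_derivative (\<Sum>k. diffs (c i j) k * s ^ k)) (at s)"
    by (rule termdiffs_strong_converges_everywhere) (rule sm)
  also have "(\<Sum>k. diffs (c i j) k * s ^ k) = (\<Sum>k. \<Sum>l\<in>UNIV. M $ i $ l * (c l j k * s ^ k))"
    by (simp add: d sum_distrib_right mult.assoc)
  also have "\<dots> = (\<Sum>l\<in>UNIV. \<Sum>k. M $ i $ l * (c l j k * s ^ k))"
    by (intro suminf_sum summable_mult sm)
  also have "\<dots> = (\<Sum>l\<in>UNIV. M $ i $ l * mat_exp (s *\<^sub>R M) $ l $ j)"
    unfolding suminf_mult[OF sm] by (simp add: mat_exp_entry c_def)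
  also have "\<dots> = (M ** mat_exp (s *\<^sub>R M)) $ i $ j" by (simp add: matrix_matrix_mult_def)
  finally show ?thesis by (simp add: mat_exp_entry c_def)
qed

lemma mat_exp_zero: "mat_exp (0 *\<^sub>R M) = mat 1" for M :: "real ^ 'm::finite ^ 'm"
proof -
  have "mat_exp (0 *\<^sub>R M) $ i $ j = mat 1 $ i $ j" for i j
    unfolding mat_exp_entry by (subst powser_zero) simp
  then show ?thesis by (simp add: vec_eq_iff)
qed

text \<open>The curve \<phi>(s) = exp(sM)x solves \<phi>' = M\<phi>, so the derivative of
  \<open>K\<close> along it is a value of \<open>lie_deriv (mat_act b M) K\<close> and
  vanishes.\<close>

lemma mat_exp_invariant:
  fixes K :: "'v::euclidean_space \<Rightarrow> real"
  assumes b: "indexed_basis b" and K: "smooth_on UNIV K" and z: "lie_deriv (mat_act b M) K = (\<lambda>x. 0)"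
  shows "K (mat_act b (mat_exp (s *\<^sub>R M)) x) = K x"
proof -
  define \<phi> where "\<phi> = (\<lambda>s. mat_act b (mat_exp (s *\<^sub>R M)) x)"
  have "(\<phi> has_vector_derivative mat_act b M (\<phi> s)) (at s)" for s
  proof -
    have "(\<phi> has_vector_derivative (\<Sum>i\<in>UNIV. \<Sum>j\<in>UNIV. ((M ** mat_exp (s *\<^sub>R M)) $ i $ j * coords b x $ j) *\<^sub>R b i)) (at s)"
      unfolding \<phi>_def mat_act_sum
      by (intro has_vector_derivative_sum)
        (use mat_exp_entry_derivative in \<open>auto intro!: derivative_eq_intros simp: has_vector_derivative_def has_field_derivative_def\<close>)
    then show ?thesis by (simp add: mat_act_sum[symmetric] mat_act_mult[OF b] \<phi>_def)
  qed
  then have "((\<lambda>s. K (\<phi> s)) has_derivative (\<lambda>h. dird (h *\<^sub>R mat_act b M (\<phi> s)) K (\<phi> s))) (at s)" for s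
    using diff_chain_at[OF _ has_derivative_dird[OF smooth_on_differentiable[OF K UNIV_I]], of \<phi>]
    by (fastforce simp: has_vector_derivative_def o_def)
  moreover have "dird (h *\<^sub>R mat_act b M y) K y = 0" for h y
    using fun_cong[OF z, of y] by (simp add: lie_deriv_def dird_scaleR_arg[OF smooth_on_differentiable[OF K UNIV_I]])
  ultimately have "((\<lambda>s. K (\<phi> s)) has_real_derivative 0) (at s)" for s
    by (simp add: has_field_derivative_def lambda_zero)
  then have "K (\<phi> s) = K (\<phi> 0)" using DERIV_isconst_all by blast
  then show ?thesis by (simp add: \<phi>_def mat_exp_zero mat_act_mat_1[OF b] del: scaleR_zero_left)
qed

text \<open>The condition on \<open>A\<close> is closed and holds for every exponential, hence on
  their closure.\<close>

lemma S_group_invariant: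
  fixes K :: "'v::euclidean_space \<Rightarrow> real"
  assumes b: "indexed_basis b" and K: "smooth_on UNIV K"
    and z: "lie_deriv (mat_act b (transpose (matrix_of b L))) K = (\<lambda>x. 0)" and A: "A \<in> S_group b L"
  shows "K (mat_act b A x) = K x"
proof -
  have "continuous_on UNIV (\<lambda>A. mat_act b A x)"
    unfolding mat_act_sum by (intro continuous_intros)
  then have "continuous_on UNIV (\<lambda>A. K (mat_act b A x))"
    by (rule continuous_on_compose2[OF smooth_on_continuous[OF K]]) simp
  then have "closed {A. K (mat_act b A x) = K x}"
    by (intro closed_Collect_eq continuous_on_const)
  moreover have "{mat_exp (s *\<^sub>R transpose (matrix_of b L)) | s. s \<in> (UNIV :: real set)} \<subseteq> {A. K (mat_act b A x) = K x}"
    using mat_exp_invariant[OF b K z] by auto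
  ultimately show ?thesis using A closure_minimal unfolding S_group_def by blast
qed

section \<open>Formal conjugacy\<close>

lemma flat_at_0: "flat (Suc m) f \<Longrightarrow> f 0 = 0"
  unfolding flat_def by (auto dest: eventually_nhds_x_imp_x)

lemma flat_1_smooth:
  fixes f :: "'a::euclidean_space \<Rightarrow> 'b::euclidean_space"
  assumes "open S" "0 \<in> S" "smooth_on S f" "f 0 = 0"
  shows "flat 1 f"
  using taylor_remainder[OF assms(1-3), of 0] assms(4) by simp

lemma flat_0_smooth:
  assumes "open S" "0 \<in> S" "smooth_on S f"
  shows "flat 0 f"
  using assms(1,2) smooth_on_continuous[OF assms(3)]
  by (auto intro!: flat_continuous simp: continuous_on_eq_continuous_at)

lemma taylor_term_cong:
  "open S \<Longrightarrow> 0 \<in> S \<Longrightarrow> (\<And>x. x \<in> S \<Longrightarrow> f x = g x) \<Longrightarrow> taylor_term f k = taylor_term g k"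
  unfolding taylor_term_def[abs_def] by (intro ext arg_cong[where f="\<lambda>x. x /\<^sub>R fact k"] dird_funpow_cong)

lemma taylor_term_1: "taylor_term f 1 x = dird x f 0"
  by (simp add: taylor_term_def)

lemma taylor_term_sum:
  assumes "open S" "0 \<in> S" "\<And>i. i \<in> I \<Longrightarrow> smooth_on S (f i)"
  shows "taylor_term (\<lambda>x. \<Sum>i\<in>I. f i x) k x = (\<Sum>i\<in>I. taylor_term (f i) k x)"
  using dird_funpow_sum[where S=S and I=I and f=f and y=0 and x=x and k=k and c="\<lambda>_. 1"] assms
  by (simp add: taylor_term_def scaleR_sum_right)

lemma homogeneous_poly_mult_scaleR:
  fixes p :: "'a::euclidean_space \<Rightarrow> real"
  shows "homogeneous_poly k p \<Longrightarrow> homogeneous_poly l q \<Longrightarrow> homogeneous_poly (k + l) (\<lambda>x. p x *\<^sub>R q x)"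
  unfolding homogeneous_poly_def using polynomial_function_mult[of p q] by (auto simp: power_add)

lemma taylor_term_linear:
  fixes f :: "'a::euclidean_space \<Rightarrow> 'b::euclidean_space" and h :: "'b \<Rightarrow> 'c::euclidean_space"
  assumes h: "bounded_linear h" and S: "open S" "0 \<in> S" "smooth_on S f"
  shows "taylor_term (\<lambda>x. h (f x)) k = (\<lambda>x. h (taylor_term f k x))"
proof (rule taylor_term_unique[OF S(1,2) smooth_on_linear_compose[OF h S(1,3)], where p="\<lambda>k x. h (taylor_term f k x)"])
  have "polynomial_function (\<lambda>x. h (p x))" if "polynomial_function p" for p :: "'a \<Rightarrow> 'b"
    using that bounded_linear_compose[OF _ h] unfolding polynomial_function_def o_def by fast
  then show "homogeneous_poly k (\<lambda>x. h (taylor_term f k x))" for k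
    using homogeneous_poly_taylor_term[OF S(1,3,2), of k] linear_cmul[OF bounded_linear.linear[OF h]]
    unfolding homogeneous_poly_def by auto
  show "flat (Suc k) (\<lambda>x. h (f x) - (\<Sum>k\<le>k. h (taylor_term f k x)))"
    using flat_linear[OF h taylor_remainder[OF S, of k]] bounded_linear.linear[OF h]
    by (simp add: linear_diff linear_sum)
qed simp

text \<open>Cauchy product: the sum of the terms of total degree up to \<open>m\<close> differs from
  the product of the functions by order m+1, so uniqueness of the expansion applies.\<close>

lemma taylor_term_scaleR:
  fixes f :: "'a::euclidean_space \<Rightarrow> real" and g :: "'a \<Rightarrow> 'b::euclidean_space"
  assumes S: "open S" "0 \<in> S" and f: "smooth_on S f" and g: "smooth_on S g"
  shows "taylor_term (\<lambda>x. f x *\<^sub>R g x) m = (\<lambda>x. \<Sum>i\<le>m. taylor_term f i x *\<^sub>R taylor_term g (m - i) x)"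
proof (rule taylor_term_unique[OF S, where p="\<lambda>m x. \<Sum>i\<le>m. taylor_term f i x *\<^sub>R taylor_term g (m - i) x"])
  let ?F = "taylor_term f" and ?G = "taylor_term g"
  note hF = homogeneous_poly_taylor_term[OF S(1) f S(2)] and hG = homogeneous_poly_taylor_term[OF S(1) g S(2)]
  have hFG: "homogeneous_poly (i + j) (\<lambda>x. ?F i x *\<^sub>R ?G j x)" for i j
    by (rule homogeneous_poly_mult_scaleR[OF hF hG])
  show "smooth_on S (\<lambda>x. f x *\<^sub>R g x)"
    by (rule smooth_on_bilinear[OF bounded_bilinear_scaleR S(1) f g])
  show "homogeneous_poly k (\<lambda>x. \<Sum>i\<le>k. ?F i x *\<^sub>R ?G (k - i) x)" for k
    using hFG by (intro homogeneous_poly_sum) (metis atMost_iff le_add_diff_inverse)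
  \<comment> \<open>Index pairs of total degree above \<open>m\<close>; their terms vanish to order
    m+1.\<close>
  define D where "D = ({..m} \<times> {..m}) - {(i, j). i + j \<le> m}"
  have "flat (Suc m + 0) (\<lambda>x. (f x - (\<Sum>i\<le>m. ?F i x)) *\<^sub>R g x)"
    by (rule flat_bilinear[OF bounded_bilinear_scaleR taylor_remainder[OF S f] flat_0_smooth[OF S g]])
  moreover have "flat (0 + Suc m) (\<lambda>x. (\<Sum>i\<le>m. ?F i x) *\<^sub>R (g x - (\<Sum>i\<le>m. ?G i x)))"
    by (intro flat_bilinear[OF bounded_bilinear_scaleR _ taylor_remainder[OF S g]] flat_sum flat_mono[OF flat_homogeneous_poly[OF hF]]) auto
  moreover have "flat (Suc m) (\<lambda>x. \<Sum>z\<in>D. ?F (fst z) x *\<^sub>R ?G (snd z) x)"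
    by (intro flat_sum flat_mono[OF flat_homogeneous_poly[OF hFG]]) (auto simp: D_def)
  ultimately have "flat (Suc m) (\<lambda>x. (f x - (\<Sum>i\<le>m. ?F i x)) *\<^sub>R g x + (\<Sum>i\<le>m. ?F i x) *\<^sub>R (g x - (\<Sum>i\<le>m. ?G i x))
      + (\<Sum>z\<in>D. ?F (fst z) x *\<^sub>R ?G (snd z) x))"
    by (intro flat_add) auto
  then show "flat (Suc m) (\<lambda>x. f x *\<^sub>R g x - (\<Sum>k\<le>m. \<Sum>i\<le>k. ?F i x *\<^sub>R ?G (k - i) x))"
  proof (rule flat_cong)
    fix x
    have sub: "{(i, j). i + j \<le> m} \<subseteq> {..m} \<times> {..m}" by auto
    have "(\<Sum>i\<le>m. ?F i x) *\<^sub>R (\<Sum>j\<le>m. ?G j x) = (\<Sum>z\<in>{..m} \<times> {..m}. ?F (fst z) x *\<^sub>R ?G (snd z) x)"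
      by (simp only: scaleR_sum_left, simp only: scaleR_sum_right) (simp add: sum.cartesian_product split_beta)
    also have "\<dots> = (\<Sum>z\<in>D. ?F (fst z) x *\<^sub>R ?G (snd z) x) + (\<Sum>z\<in>{(i, j). i + j \<le> m}. ?F (fst z) x *\<^sub>R ?G (snd z) x)"
      unfolding D_def by (rule sum.subset_diff[OF sub]) simp
    also have "(\<Sum>z\<in>{(i, j). i + j \<le> m}. ?F (fst z) x *\<^sub>R ?G (snd z) x) = (\<Sum>k\<le>m. \<Sum>i\<le>k. ?F i x *\<^sub>R ?G (k - i) x)"
      using sum.triangle_reindex_eq[of "\<lambda>i j. ?F i x *\<^sub>R ?G j x" m] by (simp add: split_beta)
    finally show "(f x - (\<Sum>i\<le>m. ?F i x)) *\<^sub>R g x + (\<Sum>i\<le>m. ?F i x) *\<^sub>R (g x - (\<Sum>i\<le>m. ?G i x))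
      + (\<Sum>z\<in>D. ?F (fst z) x *\<^sub>R ?G (snd z) x) = f x *\<^sub>R g x - (\<Sum>k\<le>m. \<Sum>i\<le>k. ?F i x *\<^sub>R ?G (k - i) x)"
      by (simp add: scaleR_diff_left scaleR_diff_right)
  qed
qed simp

text \<open>Expands an actual smooth conjugacy: both formal expressions have the Taylor term of X o
  \<phi> as degree \<open>m\<close> component, one by substitution, the other by the product rule
  for d\<phi>(Y).\<close>

lemma formally_conjugateI:
  fixes X Y \<phi> :: "'v::euclidean_space \<Rightarrow> 'v"
  assumes W: "open W" "0 \<in> W" and phi: "smooth_on W \<phi>" and Y: "smooth_on W Y" and X: "smooth_on UNIV X"
    and phi0: "\<phi> 0 = 0" and conj: "\<And>y. y \<in> W \<Longrightarrow> dird (Y y) \<phi> y = X (\<phi> y)" and bij: "bij (\<lambda>v. dird v \<phi> 0)"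
  shows "formally_conjugate Y X"
proof -
  let ?T = "taylor_term \<phi>"
  note hT = homogeneous_poly_taylor_term[OF W(1) phi W(2)]
  have Xphi: "smooth_on W (\<lambda>x. X (\<phi> x))" by (rule smooth_on_compose[OF X phi W(1) open_UNIV]) simp
  have compose: "formal_compose (taylor X) ?T m = taylor_term (\<lambda>x. X (\<phi> x)) m" for m
  proof -
    \<comment> \<open>Degree \<open>m\<close> sees only truncations: replacing \<phi> by
      \<open>?z\<close> and \<open>X\<close> by its Taylor polynomial changes the composite by order
      m+1.\<close>
    let ?z = "\<lambda>x. \<Sum>k\<le>m. ?T k x"
    have sz: "smooth_on UNIV ?z" by (intro smooth_on_sum smooth_on_homogeneous_poly[OF hT]) auto
    have "?z 0 = 0" using flat_at_0[OF taylor_remainder[OF W phi, of m]] phi0 by simp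
    then have z: "flat 1 ?z" by (rule flat_1_smooth[OF open_UNIV UNIV_I sz])
    have p: "flat 1 \<phi>" by (rule flat_1_smooth[OF W phi phi0])
    have "flat (0 + Suc m) (\<lambda>x. X (\<phi> x) - X (?z x))"
      by (rule flat_increment[OF open_UNIV UNIV_I X _ p z taylor_remainder[OF W phi]])
        (rule flat_0_smooth[OF open_UNIV UNIV_I smooth_on_dird[OF X]])
    moreover have "flat (Suc m) (\<lambda>x. X (?z x) - (\<Sum>j\<le>m. taylor_term X j (?z x)))"
      by (rule flat_compose[OF taylor_remainder[OF open_UNIV UNIV_I X] z])
    ultimately have f: "flat (Suc m) (\<lambda>x. X (\<phi> x) - (\<Sum>j\<le>m. taylor_term X j (?z x)))"
      using flat_add[of "Suc m" "\<lambda>x. X (\<phi> x) - X (?z x)"] by fastforce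
    have "smooth_on UNIV (\<lambda>x. taylor_term X j (?z x))" for j
      by (rule smooth_on_compose[OF smooth_on_taylor_term[OF open_UNIV X UNIV_I] sz open_UNIV open_UNIV subset_UNIV])
    then have "smooth_on UNIV (\<lambda>x. \<Sum>j\<le>m. taylor_term X j (?z x))" by (intro smooth_on_sum) auto
    from taylor_term_eq[OF W Xphi open_UNIV UNIV_I this f, of m]
    show ?thesis by (simp add: formal_compose_def taylor_conv_taylor_term)
  qed
  have deriv: "formal_deriv_apply ?T (taylor Y) m = taylor_term (\<lambda>x. X (\<phi> x)) m" for m
  proof
    fix x
    have sYi: "smooth_on W (\<lambda>y. Y y \<bullet> i)" for i by (rule smooth_on_linear_compose[OF bounded_linear_inner_left W(1) Y])
    note sD = smooth_on_dird[OF phi]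
    have "taylor_term (\<lambda>x. X (\<phi> x)) m x = taylor_term (\<lambda>y. \<Sum>i\<in>Basis. (Y y \<bullet> i) *\<^sub>R dird i \<phi> y) m x"
    proof (rule fun_cong[OF taylor_term_cong[OF W]])
      fix y assume y: "y \<in> W"
      show "X (\<phi> y) = (\<Sum>i\<in>Basis. (Y y \<bullet> i) *\<^sub>R dird i \<phi> y)"
        using conj[OF y] dird_expand[OF smooth_on_differentiable[OF phi y], of "Y y"] by simp
    qed
    also have "\<dots> = (\<Sum>i\<in>Basis. taylor_term (\<lambda>y. (Y y \<bullet> i) *\<^sub>R dird i \<phi> y) m x)"
      by (rule taylor_term_sum[OF W smooth_on_bilinear[OF bounded_bilinear_scaleR W(1) sYi sD]])
    \<comment> \<open>Differentiation lowers the degree by one, so the degree m - k part of the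
      derivative comes from component \<open>Suc (m - k)\<close> of \<phi>.\<close>
    also have "\<dots> = (\<Sum>i\<in>Basis. \<Sum>k\<le>m. (taylor_term Y k x \<bullet> i) *\<^sub>R dird i (?T (Suc (m - k))) x)"
      by (simp add: taylor_term_scaleR[OF W sYi sD] taylor_term_linear[OF bounded_linear_inner_left W Y]
          dird_taylor_term[OF W(1) phi W(2)])
    also have "\<dots> = (\<Sum>k\<le>m. \<Sum>i\<in>Basis. (taylor_term Y k x \<bullet> i) *\<^sub>R dird i (?T (Suc (m - k))) x)"
      by (rule sum.swap)
    also have "\<dots> = (\<Sum>k\<le>m. dird (taylor_term Y k x) (?T (Suc (m - k))) x)"
      using dird_expand[OF smooth_on_differentiable[OF smooth_on_homogeneous_poly[OF hT] UNIV_I]]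
      by (intro sum.cong refl) metis
    also have "\<dots> = (\<Sum>i\<le>m. dird (taylor_term Y (m - i) x) (?T (Suc i)) x)"
      by (rule sum.reindex_bij_witness[of _ "\<lambda>i. m - i" "\<lambda>i. m - i"]) auto
    finally show "formal_deriv_apply ?T (taylor Y) m x = taylor_term (\<lambda>x. X (\<phi> x)) m x"
      by (simp add: formal_deriv_apply_def taylor_conv_taylor_term dird_def)
  qed
  have "?T 0 = (\<lambda>x. 0)" by (rule ext) (simp add: phi0)
  moreover have "?T 1 = (\<lambda>v. dird v \<phi> 0)"
    by (rule ext) (rule taylor_term_1)
  moreover have "formal_deriv_apply ?T (taylor Y) = formal_compose (taylor X) ?T"
    by (rule ext) (simp only: compose deriv)
  ultimately show ?thesis
    unfolding formally_conjugate_def formal_map_def using hT bij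
    by (intro exI[of _ ?T] conjI allI) (simp_all only:)
qed

text \<open>Both sides are terms of homogeneous expansions of f o g, one by substituting the linear
  map, one by scaling.\<close>

lemma taylor_term_equivariant:
  fixes f :: "'a::euclidean_space \<Rightarrow> 'b::euclidean_space"
  assumes f: "smooth_on UNIV f" and g: "linear g" and fg: "\<And>x. f (g x) = c *\<^sub>R f x"
  shows "taylor_term f k (g x) = c *\<^sub>R taylor_term f k x"
proof -
  have bg: "bounded_linear g" using g by (simp add: linear_conv_bounded_linear)
  note hT = homogeneous_poly_taylor_term[OF open_UNIV f UNIV_I] and rT = taylor_remainder[OF open_UNIV UNIV_I f, of k]
  have s: "smooth_on UNIV (\<lambda>x. f (g x))"
    by (rule smooth_on_compose[OF f smooth_on_bounded_linear[OF bg] open_UNIV open_UNIV subset_UNIV])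
  have "flat 1 g" by (rule flat_linear[OF bg flat_ident])
  from flat_compose[OF rT this]
  have "taylor_term (\<lambda>x. f (g x)) k = (\<lambda>x. taylor_term f k (g x))"
    by (intro taylor_term_unique[OF open_UNIV UNIV_I s, of k "\<lambda>k x. taylor_term f k (g x)"]
        homogeneous_poly_compose_linear[OF hT bg]) auto
  moreover have "flat (Suc k) (\<lambda>x. f (g x) - (\<Sum>k\<le>k. c *\<^sub>R taylor_term f k x))"
    by (rule flat_cong[OF flat_scaleR[OF rT, of c]]) (simp add: fg scaleR_diff_right scaleR_sum_right)
  then have "taylor_term (\<lambda>x. f (g x)) k = (\<lambda>x. c *\<^sub>R taylor_term f k x)"
    by (intro taylor_term_unique[OF open_UNIV UNIV_I s, of k "\<lambda>k x. c *\<^sub>R taylor_term f k x"]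
        homogeneous_poly_scaleR[OF hT]) auto
  ultimately show ?thesis by metis
qed

text \<open>Split \<open>G\<close> into \<beta>(z,z)/2 and \<open>E\<close> of order 3, whose
  increment has order j+2. In the quadratic part, \<beta>(a - x, w) has order j+2 and \<beta>(w, w)
  order 2j, which is at least j+2 because \<open>j \<ge> 2\<close>.\<close>

lemma quadratic_increment:
  fixes G :: "'v::euclidean_space \<Rightarrow> real"
  assumes \<beta>: "bounded_bilinear \<beta>" and sym: "\<And>u v. \<beta> u v = \<beta> v u"
    and G: "smooth_on UNIV G" and flatG: "flat 3 (\<lambda>z. G z - (1/2) * \<beta> z z)"
    and a: "flat 2 (\<lambda>x. a x - x)" and w: "flat j w" and j: "j \<ge> 2"
  shows "flat (j + 2) (\<lambda>x. G (a x + c *\<^sub>R w x) - G (a x) - c * \<beta> x (w x))"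
proof -
  interpret bounded_bilinear \<beta> by (rule \<beta>)
  define E where "E = (\<lambda>z. G z - (1/2) * \<beta> z z)"
  have sE: "smooth_on UNIV E"
    unfolding E_def by (intro smooth_on_diff G smooth_on_mult_left smooth_on_bilinear[OF \<beta>] smooth_on_ident open_UNIV)
  have a1: "flat 1 a"
    using flat_add[OF flat_mono[OF a, of 1] flat_ident] by (auto intro: flat_cong)
  have cw: "flat j (\<lambda>x. c *\<^sub>R w x)" by (rule flat_scaleR[OF w])
  have aw: "flat 1 (\<lambda>x. a x + c *\<^sub>R w x)" using j by (intro flat_add a1 flat_mono[OF cw]) auto
  have "flat 2 (dird i E)" for i
    using flat_dird[OF open_UNIV UNIV_I sE, of 2] flatG by (simp add: E_def numeral_3_eq_3 numeral_2_eq_2)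
  then have "flat (2 + j) (\<lambda>x. E (a x + c *\<^sub>R w x) - E (a x))"
    by (intro flat_increment[OF open_UNIV UNIV_I sE _ aw a1]) (auto intro: flat_cong[OF cw])
  moreover have "flat (2 + j) (\<lambda>x. c *\<^sub>R \<beta> (a x - x) (w x))"
    by (rule flat_scaleR[OF flat_bilinear[OF \<beta> a w]])
  moreover have "flat (2 + j) (\<lambda>x. (c\<^sup>2 / 2) *\<^sub>R \<beta> (w x) (w x))"
    by (rule flat_mono[OF flat_scaleR[OF flat_bilinear[OF \<beta> w w]]]) (use j in auto)
  ultimately have "flat (2 + j) (\<lambda>x. E (a x + c *\<^sub>R w x) - E (a x) + c *\<^sub>R \<beta> (a x - x) (w x) + (c\<^sup>2 / 2) *\<^sub>R \<beta> (w x) (w x))"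
    by (intro flat_add)
  then have "flat (2 + j) (\<lambda>x. G (a x + c *\<^sub>R w x) - G (a x) - c * \<beta> x (w x))"
    by (rule flat_cong)
      (simp add: E_def add_left add_right diff_left scaleR_left scaleR_right sym[of "w _" "a _"] power2_eq_square algebra_simps)
  then show ?thesis by (simp add: add.commute)
qed

section \<open>The normal form\<close>

text \<open>A correction \<open>Q\<close> of degree j+1 shifts both arguments by terms of degree j,
  which changes the two sides only from degree j+1 on; so the earlier \<open>K k\<close> can be
  kept.\<close>

lemma cayley_normal_form:
  fixes H :: "'v::euclidean_space \<Rightarrow> real" and g :: "'i \<Rightarrow> 'v \<Rightarrow> 'v" and s1 s2 :: "'i \<Rightarrow> real"
  assumes w: "symplectic_form \<omega>" and b: "span (range b) = UNIV" and T: "transposed b L L'"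
    and g: "\<And>i. i \<in> G \<Longrightarrow> linear (g i)" "\<And>i. i \<in> G \<Longrightarrow> surj (g i)"
    and s1: "\<And>i. i \<in> G \<Longrightarrow> s1 i * s1 i = 1" and s2: "\<And>i. i \<in> G \<Longrightarrow> s2 i * s2 i = 1"
    and Lg: "\<And>i x. i \<in> G \<Longrightarrow> L (g i x) = s2 i *\<^sub>R g i (L x)" and L'g: "\<And>i x. i \<in> G \<Longrightarrow> L' (g i x) = s2 i *\<^sub>R g i (L' x)"
    and wg: "\<And>i u v. i \<in> G \<Longrightarrow> \<omega> (g i u) (g i v) = s1 i * \<omega> u v"
    and H: "smooth_on UNIV H" and Hg: "\<And>i x. i \<in> G \<Longrightarrow> H (g i x) = s1 i * s2 i * H x"
    and symL: "\<And>u v. \<omega> (L u) v = \<omega> (L v) u"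
    and H2: "flat 3 (\<lambda>z. H z - (1/2) * \<omega> (L z) z)"
    and j: "2 \<le> j"
  shows "\<exists>P K. smooth_on UNIV P \<and> flat 3 P \<and> (\<forall>i\<in>G. \<forall>x. P (g i x) = s1 i * P x) \<and>
    (\<forall>k\<in>{3..j}. homogeneous_poly k (K k) \<and> lie_deriv L' (K k) = (\<lambda>x. 0) \<and> (\<forall>i\<in>G. \<forall>x. K k (g i x) = s1 i * s2 i * K k x)) \<and>
    flat (Suc j) (\<lambda>x. H (x + (1/2) *\<^sub>R ham_field \<omega> P x) -
      ((1/2) * \<omega> (L (x - (1/2) *\<^sub>R ham_field \<omega> P x)) (x - (1/2) *\<^sub>R ham_field \<omega> P x)
        + (\<Sum>k=3..j. K k (x - (1/2) *\<^sub>R ham_field \<omega> P x))))"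
  using j
proof (induction j rule: dec_induct)
  \<comment> \<open>To order 3 the Hamiltonian already equals its quadratic part, so
    \<open>P = 0\<close> and the empty sum suffice.\<close>
  case base
  have "ham_field \<omega> (\<lambda>x. 0) x = 0" for x
    by (rule ham_field_eqI[OF w]) (auto simp: dird_def bounded_bilinear.zero_left[OF symplectic_bilinear[OF w]])
  then show ?case
    using H2 by (intro exI[of _ "\<lambda>x. 0"] exI[of _ "\<lambda>k x. 0"]) (auto intro: smooth_on_const simp: numeral_3_eq_3 numeral_2_eq_2)
next
  case (step j)
  then obtain P K where P: "smooth_on UNIV P" "flat 3 P" "\<And>i x. i \<in> G \<Longrightarrow> P (g i x) = s1 i * P x"
    and K: "\<And>k. k \<in> {3..j} \<Longrightarrow> homogeneous_poly k (K k)" "\<And>k. k \<in> {3..j} \<Longrightarrow> lie_deriv L' (K k) = (\<lambda>x. 0)"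
      "\<And>k i x. k \<in> {3..j} \<Longrightarrow> i \<in> G \<Longrightarrow> K k (g i x) = s1 i * s2 i * K k x"
    and f: "flat (Suc j) (\<lambda>x. H (x + (1/2) *\<^sub>R ham_field \<omega> P x) -
      ((1/2) * \<omega> (L (x - (1/2) *\<^sub>R ham_field \<omega> P x)) (x - (1/2) *\<^sub>R ham_field \<omega> P x)
        + (\<Sum>k=3..j. K k (x - (1/2) *\<^sub>R ham_field \<omega> P x))))"
    by blast
  interpret \<omega>: bounded_bilinear \<omega> by (rule symplectic_bilinear[OF w])
  have lin: "linear L" using T by (simp add: transposed_def)
  define \<beta> where "\<beta> = (\<lambda>u v. \<omega> (L u) v)"
  have \<beta>: "bounded_bilinear \<beta>"
    unfolding \<beta>_def using lin by (intro \<omega>.comp1) (simp add: linear_conv_bounded_linear)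
  define XP where "XP = ham_field \<omega> P"
  \<comment> \<open>The current normal form; \<open>D\<close> compares it with \<open>H\<close> on
    the two half steps, and \<open>R\<close> is the leading part of the discrepancy.\<close>
  define N where "N = (\<lambda>z. (1/2) * \<beta> z z + (\<Sum>k=3..j. K k z))"
  define D where "D = (\<lambda>x. H (x + (1/2) *\<^sub>R XP x) - N (x - (1/2) *\<^sub>R XP x))"
  define R where "R = taylor_term D (Suc j)"
  have sXP: "smooth_on UNIV XP" unfolding XP_def by (rule smooth_on_ham_field[OF w open_UNIV P(1)])
  have fXP: "flat 2 XP" unfolding XP_def
    using flat_ham_field[OF w open_UNIV UNIV_I P(1), of 2] P(2) by (simp add: numeral_3_eq_3 numeral_2_eq_2)
  have sN: "smooth_on UNIV N" unfolding N_def
    by (intro smooth_on_add open_UNIV smooth_on_mult_left smooth_on_bilinear[OF \<beta>] smooth_on_ident smooth_on_sum smooth_on_homogeneous_poly[OF K(1)])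
  have sAp: "smooth_on UNIV (\<lambda>x. x + (1/2) *\<^sub>R XP x)" and sAm: "smooth_on UNIV (\<lambda>x. x - (1/2) *\<^sub>R XP x)"
    by (intro smooth_on_add smooth_on_diff smooth_on_scaleR smooth_on_ident sXP open_UNIV)+
  have sD: "smooth_on UNIV D" unfolding D_def
    by (rule smooth_on_diff[OF open_UNIV smooth_on_compose[OF H sAp open_UNIV open_UNIV subset_UNIV] smooth_on_compose[OF sN sAm open_UNIV open_UNIV subset_UNIV]])
  have fD: "flat (Suc j) D" using f by (simp add: D_def N_def \<beta>_def XP_def)
  have hR: "homogeneous_poly (Suc j) R" unfolding R_def by (rule homogeneous_poly_taylor_term[OF open_UNIV sD UNIV_I])
  have fDR: "flat (Suc (Suc j)) (\<lambda>x. D x - R x)"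
  proof (rule flat_cong[OF taylor_remainder[OF open_UNIV UNIV_I sD, of "Suc j"]])
    have "(\<Sum>k\<le>j. taylor_term D k x) = 0" for x
      using flat_iff_taylor_term[OF open_UNIV UNIV_I sD, of j] fD by (intro sum.neutral) auto
    then show "D x - (\<Sum>k\<le>Suc j. taylor_term D k x) = D x - R x" for x by (simp add: R_def)
  qed
  \<comment> \<open>The half steps commute with the action, and \<open>H\<close> and
    \<open>N\<close> scale by the same sign, which passes to the Taylor term.\<close>
  have Rg: "R (g i x) = s1 i * s2 i * R x" if i: "i \<in> G" for i x
  proof -
    have gX: "XP (g i x) = g i (XP x)" for x
      unfolding XP_def by (rule ham_field_equivariant[where g="g i" and s="s1 i" and P=P and \<omega>=\<omega>, OF w P(1) g[OF i] wg[OF i] P(3)[OF i]])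
    have gA: "g i x + (1/2) *\<^sub>R g i y = g i (x + (1/2) *\<^sub>R y)" "g i x - (1/2) *\<^sub>R g i y = g i (x - (1/2) *\<^sub>R y)" for x y
      using g(1)[OF i] by (simp_all add: linear_add linear_diff linear_cmul)
    have "\<beta> (g i x) (g i x) = s1 i * s2 i * \<beta> x x" for x
      by (simp add: \<beta>_def Lg[OF i] wg[OF i] \<omega>.scaleR_left)
    then have "N (g i x) = s1 i * s2 i * N x" for x
      using K(3)[OF _ i] by (simp add: N_def distrib_left sum_distrib_left mult.left_commute)
    then have "D (g i x) = (s1 i * s2 i) *\<^sub>R D x" for x
      by (simp add: D_def gX gA Hg[OF i] right_diff_distrib)
    then show ?thesis unfolding R_def using taylor_term_equivariant[OF sD g(1)[OF i]] by simp
  qed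
  obtain Q K0 where Q: "homogeneous_poly (Suc j) Q" and K0: "homogeneous_poly (Suc j) K0" "lie_deriv L' K0 = (\<lambda>x. 0)"
    and RQ: "\<And>x. R x = lie_deriv L Q x + K0 x"
    and Qg: "\<And>i x. i \<in> G \<Longrightarrow> Q (g i x) = s1 i * Q x" and K0g: "\<And>i x. i \<in> G \<Longrightarrow> K0 (g i x) = s1 i * s2 i * K0 x"
    by (rule equivariant_fischer_decomposition[where g=g and ?s1.0=s1 and ?s2.0=s2 and G=G and h=R,
          OF b T hR g(1) s1 s2 Lg L'g Rg]) (assumption | rule that)+
  note sQ = smooth_on_homogeneous_poly[OF Q] and sK0 = smooth_on_homogeneous_poly[OF K0(1)]
  define W where "W = ham_field \<omega> Q"
  have fW: "flat j W" unfolding W_def by (rule flat_ham_field[OF w open_UNIV UNIV_I sQ flat_homogeneous_poly[OF Q]])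
  define P' where "P' = (\<lambda>x. P x + Q x)"
  define K' where "K' = K(Suc j := K0)"
  have XP': "ham_field \<omega> P' x = XP x + W x" for x
    unfolding P'_def XP_def W_def
    by (rule ham_field_add[OF w smooth_on_differentiable[OF P(1) UNIV_I] smooth_on_differentiable[OF sQ UNIV_I]])
  have K'j: "K' (Suc j) = K0" "\<And>k. k \<in> {3..j} \<Longrightarrow> K' k = K k" by (auto simp: K'_def)
  have ff: "flat 2 (\<lambda>x. (x + (1/2) *\<^sub>R XP x) - x)" "flat 2 (\<lambda>x. (x - (1/2) *\<^sub>R XP x) - x)"
    using flat_scaleR[OF fXP, of "1/2"] flat_scaleR[OF fXP, of "-1/2"] by simp_all
  \<comment> \<open>The increments in \<open>I1\<close> and \<open>I2\<close> carry +1/2 and -1/2;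
    their difference is \<beta>(x, W x) = -\<open>lie_deriv L Q x\<close>, which cancels the image
    part of \<open>R\<close>.\<close>
  have I1: "flat (j + 2) (\<lambda>x. H ((x + (1/2) *\<^sub>R XP x) + (1/2) *\<^sub>R W x) - H (x + (1/2) *\<^sub>R XP x) - (1/2) * \<beta> x (W x))"
    by (rule quadratic_increment[OF \<beta> _ H _ ff(1) fW step(1)]) (use symL H2 in \<open>auto simp: \<beta>_def\<close>)
  have I2: "flat (j + 2) (\<lambda>x. N ((x - (1/2) *\<^sub>R XP x) + (-1/2) *\<^sub>R W x) - N (x - (1/2) *\<^sub>R XP x) - (-1/2) * \<beta> x (W x))"
  proof (rule quadratic_increment[OF \<beta> _ sN _ ff(2) fW step(1)])
    show "\<beta> u v = \<beta> v u" for u v using symL by (simp add: \<beta>_def)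
    have "flat 3 (\<lambda>z. \<Sum>k=3..j. K k z)" by (intro flat_sum flat_mono[OF flat_homogeneous_poly[OF K(1)]]) auto
    then show "flat 3 (\<lambda>z. N z - (1/2) * \<beta> z z)" by (simp add: N_def)
  qed
  \<comment> \<open>The derivative of \<open>K0\<close> has order j and the argument differs from
    \<open>x\<close> by order 2, so \<open>K0\<close> may be evaluated at \<open>x\<close> up to
    order j+2.\<close>
  have I3: "flat (j + 2) (\<lambda>x. K0 ((x - (1/2) *\<^sub>R XP x) + (-1/2) *\<^sub>R W x) - K0 x)"
  proof (rule flat_increment[OF open_UNIV UNIV_I sK0])
    show "flat j (dird i K0)" for i by (rule flat_dird[OF open_UNIV UNIV_I sK0 flat_homogeneous_poly[OF K0(1)]])
    show f2: "flat 2 (\<lambda>x. (x - (1/2) *\<^sub>R XP x) + (-1/2) *\<^sub>R W x - x)"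
      using flat_add[OF ff(2) flat_mono[OF flat_scaleR[OF fW, of "-1/2"] step(1)]] by (simp add: algebra_simps)
    then show "flat 1 (\<lambda>x. (x - (1/2) *\<^sub>R XP x) + (-1/2) *\<^sub>R W x)"
      using flat_add[OF flat_mono[OF f2, of 1] flat_ident] by (auto intro: flat_cong)
  qed (rule flat_ident)
  have \<beta>W: "\<beta> x (W x) = - lie_deriv L Q x" for x
    using symplectic_skew[OF w, of "L x" "W x"] ham_field_dird[OF w smooth_on_differentiable[OF sQ UNIV_I], of x "L x"]
    by (simp add: \<beta>_def W_def lie_deriv_def)
  define N' where "N' = (\<lambda>z. (1/2) * \<omega> (L z) z + (\<Sum>k=3..Suc j. K' k z))"
  have N': "N' z = N z + K0 z" for z
    using step(1) by (simp add: N'_def N_def \<beta>_def K'j)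
  have "flat (j + 2) (\<lambda>x. (D x - R x) + (H ((x + (1/2) *\<^sub>R XP x) + (1/2) *\<^sub>R W x) - H (x + (1/2) *\<^sub>R XP x) - (1/2) * \<beta> x (W x))
     - (N ((x - (1/2) *\<^sub>R XP x) + (-1/2) *\<^sub>R W x) - N (x - (1/2) *\<^sub>R XP x) - (-1/2) * \<beta> x (W x))
     - (K0 ((x - (1/2) *\<^sub>R XP x) + (-1/2) *\<^sub>R W x) - K0 x))"
    by (rule flat_diff[OF flat_diff[OF flat_add[OF _ I1] I2] I3]) (use fDR in simp)
  then have "flat (j + 2) (\<lambda>x. H (x + (1/2) *\<^sub>R ham_field \<omega> P' x) - N' (x - (1/2) *\<^sub>R ham_field \<omega> P' x))"
  proof (rule flat_cong)
    fix x
    have e: "x + (1/2) *\<^sub>R ham_field \<omega> P' x = (x + (1/2) *\<^sub>R XP x) + (1/2) *\<^sub>R W x"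
      "x - (1/2) *\<^sub>R ham_field \<omega> P' x = (x - (1/2) *\<^sub>R XP x) + (-1/2) *\<^sub>R W x"
      by (simp_all add: XP' scaleR_add_right)
    show "(D x - R x) + (H ((x + (1/2) *\<^sub>R XP x) + (1/2) *\<^sub>R W x) - H (x + (1/2) *\<^sub>R XP x) - (1/2) * \<beta> x (W x))
     - (N ((x - (1/2) *\<^sub>R XP x) + (-1/2) *\<^sub>R W x) - N (x - (1/2) *\<^sub>R XP x) - (-1/2) * \<beta> x (W x))
     - (K0 ((x - (1/2) *\<^sub>R XP x) + (-1/2) *\<^sub>R W x) - K0 x)
      = H (x + (1/2) *\<^sub>R ham_field \<omega> P' x) - N' (x - (1/2) *\<^sub>R ham_field \<omega> P' x)"
      unfolding e N' D_def RQ \<beta>W by simp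
  qed
  moreover have "smooth_on UNIV P'" unfolding P'_def by (intro smooth_on_add P(1) sQ open_UNIV)
  moreover have "flat 3 P'" unfolding P'_def using step(1) by (intro flat_add P(2) flat_mono[OF flat_homogeneous_poly[OF Q]]) simp
  moreover have "P' (g i x) = s1 i * P' x" if "i \<in> G" for i x
    using P(3)[OF that] Qg[OF that] by (simp add: P'_def distrib_left)
  moreover have "homogeneous_poly k (K' k) \<and> lie_deriv L' (K' k) = (\<lambda>x. 0) \<and> (\<forall>i\<in>G. \<forall>x. K' k (g i x) = s1 i * s2 i * K' k x)"
    if "k \<in> {3..Suc j}" for k
    using that K K0 K0g by (cases "k = Suc j") (auto simp: K'_def)
  ultimately show ?case
    unfolding N'_def by (intro exI[of _ P'] exI[of _ K']) simp
qed

text \<open>\<open>h\<close> inverts the half step A_-, and the map in question is A_+ o h. By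
  \<open>cayley_pullback\<close> at h(y) it pulls \<omega> back to the same form as A_- o h, which
  is the identity.\<close>

lemma symplectic_cayley_map:
  fixes P :: "'v::euclidean_space \<Rightarrow> real"
  assumes w: "symplectic_form \<omega>" and P: "smooth_on UNIV P" "flat 3 P"
  obtains V h where "open V" "0 \<in> V" "smooth_on V h" "h 0 = 0"
    "\<And>y. y \<in> V \<Longrightarrow> h y - (1/2) *\<^sub>R ham_field \<omega> P (h y) = y"
    "\<And>y u v. y \<in> V \<Longrightarrow> \<omega> (dird u (\<lambda>y. h y + (1/2) *\<^sub>R ham_field \<omega> P (h y)) y) (dird v (\<lambda>y. h y + (1/2) *\<^sub>R ham_field \<omega> P (h y)) y) = \<omega> u v"
proof -
  define XP where "XP = ham_field \<omega> P"
  have sXP: "smooth_on UNIV XP" unfolding XP_def by (rule smooth_on_ham_field[OF w open_UNIV P(1)])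
  have fXP: "flat (Suc 1) XP" unfolding XP_def
    using flat_ham_field[OF w open_UNIV UNIV_I P(1), of 2] P(2) by (simp add: numeral_3_eq_3 numeral_2_eq_2)
  have dXP: "XP differentiable (at x)" for x by (rule smooth_on_differentiable[OF sXP UNIV_I])
  define F where "F = (\<lambda>x. x - (1/2) *\<^sub>R XP x)"
  have sF: "smooth_on UNIV F" unfolding F_def
    by (intro smooth_on_diff smooth_on_scaleR smooth_on_ident sXP open_UNIV)
  have d0: "dird v (\<lambda>x. x) x = v" for v x :: 'v
    by (simp add: dird_bounded_linear[OF bounded_linear_ident])
  have dF: "dird v F x = v - (1/2) *\<^sub>R dird v XP x" and dA: "dird v (\<lambda>x. x + (1/2) *\<^sub>R XP x) x = v + (1/2) *\<^sub>R dird v XP x" for v x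
    unfolding F_def using dXP[of x] by (simp_all add: dird_diff dird_add dird_scaleR d0 differentiable_scaleR)
  \<comment> \<open>\<open>P\<close> vanishes to order 3, hence its field to order 2 and the
    derivative to order 1, so the linear part of \<open>F\<close> at 0 is the identity.\<close>
  have "flat 1 (dird v XP)" for v by (rule flat_dird[OF open_UNIV UNIV_I sXP fXP])
  then have "dird v F 0 = v" for v using flat_at_0[of 0 "dird v XP"] by (simp add: dF)
  moreover have "F 0 = 0" using flat_at_0[OF fXP] by (simp add: F_def)
  ultimately obtain V h where V: "open V" "0 \<in> V" "smooth_on V h" "h 0 = 0" "\<And>y. y \<in> V \<Longrightarrow> F (h y) = y"
    using smooth_local_inverse[OF sF] by metis
  show ?thesis
  proof (rule that[OF V(1-4)])
    show "h y - (1/2) *\<^sub>R ham_field \<omega> P (h y) = y" if "y \<in> V" for y using V(5)[OF that] by (simp add: F_def XP_def)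
    fix y u v assume y: "y \<in> V"
    have dh: "h differentiable (at y)" by (rule smooth_on_differentiable[OF V(3) y])
    have sA: "smooth_on UNIV (\<lambda>x. x + (1/2) *\<^sub>R XP x)"
      by (intro smooth_on_add smooth_on_scaleR smooth_on_ident sXP open_UNIV)
    have 1: "dird v (\<lambda>y. h y + (1/2) *\<^sub>R XP (h y)) y = dird v h y + (1/2) *\<^sub>R dird (dird v h y) XP (h y)" for v
      using dird_compose[OF dh smooth_on_differentiable[OF sA UNIV_I], of v] by (simp add: dA)
    \<comment> \<open>Differentiates A_-(h y) = y.\<close>
    have 2: "v = dird v h y - (1/2) *\<^sub>R dird (dird v h y) XP (h y)" for v
    proof -
      have "v = dird v (\<lambda>y. F (h y)) y"
        using dird_cong_open[where f="\<lambda>y. F (h y)" and g="\<lambda>y. y" and v=v, OF V(1) V(5) y] by (simp add: d0)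
      then show ?thesis using dird_compose[OF dh smooth_on_differentiable[OF sF UNIV_I], of v] by (simp add: dF)
    qed
    have "\<omega> u v = \<omega> (dird u h y - (1/2) *\<^sub>R dird (dird u h y) XP (h y)) (dird v h y - (1/2) *\<^sub>R dird (dird v h y) XP (h y))"
      using 2 by metis
    then show "\<omega> (dird u (\<lambda>y. h y + (1/2) *\<^sub>R ham_field \<omega> P (h y)) y) (dird v (\<lambda>y. h y + (1/2) *\<^sub>R ham_field \<omega> P (h y)) y) = \<omega> u v"
      using cayley_pullback[OF w P(1), of "dird u h y" "h y" "dird v h y"] 1 by (simp add: XP_def)
  qed
qed

text \<open>In an orthonormal basis the transpose is the \<open>ip\<close>-adjoint of
  \<open>L\<close>; passing to adjoints, with \<open>g\<close> an isometry, turns the relation for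
  \<open>L\<close> into the one for \<open>L'\<close>.\<close>

lemma transpose_equivariant:
  assumes b: "indexed_basis b" and L: "linear L" and ip: "bilinear ip" "\<And>u. u \<noteq> 0 \<Longrightarrow> ip u u > (0::real)"
    and on: "\<And>i j. ip (b i) (b j) = (if i = j then 1 else 0)"
    and g: "linear g" "surj g" and ipg: "\<And>u v. ip (g u) (g v) = ip u v"
    and Lg: "\<And>x. L (g x) = s *\<^sub>R g (L x)"
  defines "L' \<equiv> mat_act b (transpose (matrix_of b L))"
  shows "L' (g x) = s *\<^sub>R g (L' x)"
proof -
  interpret ip: bounded_bilinear ip using ip(1) by (simp add: bilinear_conv_bounded_bilinear)
  have linL': "linear L'" unfolding L'_def by (rule linear_mat_act[OF b])
  have span: "UNIV \<subseteq> span (range b)" using b by (simp add: indexed_basis_def)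
  have bil1: "bilinear (\<lambda>u v. ip (L u) v)"
    using L by (simp add: bilinear_conv_bounded_bilinear linear_conv_bounded_linear ip.comp1)
  have bil2: "bilinear (\<lambda>u v. ip u (L' v))"
    using linL' ip.comp[OF bounded_linear_ident, of L'] by (simp add: bilinear_conv_bounded_bilinear linear_conv_bounded_linear)
  have adj: "ip (L u) v = ip u (L' v)" for u v
  proof (rule bilinear_eq[OF bil1 bil2 span span UNIV_I UNIV_I])
    fix x y assume "x \<in> range b" "y \<in> range b"
    then obtain i k where xy: "x = b i" "y = b k" by auto
    have "ip (L (b i)) (b k) = matrix_of b L $ k $ i"
      unfolding linear_matrix_of[OF b, of L] by (simp add: ip.sum_left ip.scaleR_left on if_distrib cong: if_cong)
    moreover have "ip (b i) (L' (b k)) = matrix_of b L $ k $ i"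
      unfolding L'_def mat_act_basis[OF b] by (simp add: ip.sum_right ip.scaleR_right on transpose_def if_distrib cong: if_cong)
    ultimately show "ip (L x) y = ip x (L' y)" by (simp add: xy)
  qed
  have eq: "ip v (L' (g x)) = ip v (s *\<^sub>R g (L' x))" for v
  proof -
    obtain v' where v: "v = g v'" using g(2) by (metis surjD)
    have "ip v (L' (g x)) = ip (L v) (g x)" by (simp add: adj)
    also have "\<dots> = s * ip v' (L' x)" by (simp add: v Lg ip.scaleR_left ipg adj)
    finally show ?thesis by (simp add: v ip.scaleR_right ipg)
  qed
  have "ip (L' (g x) - s *\<^sub>R g (L' x)) (L' (g x) - s *\<^sub>R g (L' x)) = 0"
    using eq[of "L' (g x) - s *\<^sub>R g (L' x)"] by (simp only: ip.diff_right)
  then show ?thesis using ip(2) by (metis eq_iff_diff_eq_0 less_irrefl)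
qed

lemma Z2_hom_square: "\<sigma> \<in> hom \<Gamma> Z2 \<Longrightarrow> \<gamma> \<in> carrier \<Gamma> \<Longrightarrow> \<sigma> \<gamma> * \<sigma> \<gamma> = 1"
  by (auto simp: hom_def Z2_def Pi_def)

theorem theorem6p3:
  fixes \<Gamma> :: "('g, 'z) monoid_scheme"
    and T :: "'g topology" and E :: "'e::euclidean_space set" and \<A> :: "('g, 'e) chart set"
    and \<rho> :: "'g \<Rightarrow> 'v::euclidean_space \<Rightarrow> 'v"
    and \<sigma>1 \<sigma>2 :: "'g \<Rightarrow> real"
    and \<omega> ip :: "'v \<Rightarrow> 'v \<Rightarrow> real"
    and b :: "'m::finite \<Rightarrow> 'v"
    and X L :: "'v \<Rightarrow> 'v"
    and n r :: nat
  assumes dim: "DIM('v) = 2 * n"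
    and omega: "symplectic_form \<omega>"
    and Gamma: "compact_Lie_group \<Gamma> E T \<A>"
    and action: "linear_Lie_action \<Gamma> T \<rho>"
    and sigma1: "\<sigma>1 \<in> hom \<Gamma> Z2"
    and sigma2: "\<sigma>2 \<in> hom \<Gamma> Z2"
    and semi: "semisymplectic \<Gamma> \<rho> \<sigma>1 \<omega>"
    and inner_prod: "invariant_inner_product \<Gamma> \<rho> ip"
    and basis: "indexed_basis b"
    and orthonormal: "\<forall>i j. ip (b i) (b j) = (if i = j then 1 else 0)"
    and X_smooth: "smooth_on UNIV X"
    and X_ham: "hamiltonian \<omega> X"
    and X_equiv: "equivariant \<Gamma> \<rho> \<sigma>2 X"
    and X_zero: "X 0 = 0"
    and L: "(X has_derivative L) (at 0)"
    and r: "r \<ge> 3"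
    and S_sympl: "acts_symplectically b (S_group b L) \<omega>"
  shows "\<exists>K :: nat \<Rightarrow> 'v \<Rightarrow> real.
    (\<forall>k\<in>{3..r}. K k \<in> sym_poly k (semidirect b \<rho> (S_group b L) \<Gamma>) (semidirect_act b \<rho>)
                        (\<lambda>g. tilde \<sigma>1 g * tilde \<sigma>2 g)) \<and>
    (\<exists>Y U. open U \<and> 0 \<in> U \<and> smooth_on U Y \<and> Y 0 = 0 \<and>
       formally_conjugate Y X \<and>
       (\<lambda>y. norm (Y y - (L y + (\<Sum>k=3..r. ham_field \<omega> (K k) y)))) \<in> O[nhds 0](\<lambda>y. norm y ^ r))"
proof -
  interpret \<omega>: bounded_bilinear \<omega> by (rule symplectic_bilinear[OF omega])
  define L' where "L' = mat_act b (transpose (matrix_of b L))"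
  have linL: "linear L" using L has_derivative_linear by blast
  have T: "transposed b L L'" unfolding L'_def by (rule transposed_transpose_matrix[OF basis linL])
  have span: "span (range b) = UNIV" using basis by (simp add: indexed_basis_def)
  have \<rho>: "linear (\<rho> \<gamma>)" "surj (\<rho> \<gamma>)" if "\<gamma> \<in> carrier \<Gamma>" for \<gamma>
    using action that group_action.surj_prop[of \<Gamma> UNIV \<rho>] by (auto simp: linear_Lie_action_def)
  have semi': "\<omega> (\<rho> \<gamma> u) (\<rho> \<gamma> v) = \<sigma>1 \<gamma> * \<omega> u v" if "\<gamma> \<in> carrier \<Gamma>" for \<gamma> u v
    using semi that by (simp add: semisymplectic_def)
  have X\<rho>: "X (\<rho> \<gamma> x) = \<sigma>2 \<gamma> *\<^sub>R \<rho> \<gamma> (X x)" if "\<gamma> \<in> carrier \<Gamma>" for \<gamma> x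
    using X_equiv that by (simp add: equivariant_def)
  have dX: "dird v X 0 = L v" for v by (rule dird_eq[OF L])
  have Xd: "X differentiable (at x)" for x by (rule smooth_on_differentiable[OF X_smooth UNIV_I])
  have L\<rho>: "L (\<rho> \<gamma> x) = \<sigma>2 \<gamma> *\<^sub>R \<rho> \<gamma> (L x)" if \<gamma>: "\<gamma> \<in> carrier \<Gamma>" for \<gamma> x
  proof -
    have bl: "bounded_linear (\<rho> \<gamma>)" using \<rho>(1)[OF \<gamma>] by (simp add: linear_conv_bounded_linear)
    have "dird x (\<lambda>x. X (\<rho> \<gamma> x)) 0 = L (\<rho> \<gamma> x)"
      using dird_compose[OF bounded_linear_imp_differentiable[OF bl] Xd, where x=0 and v=x]
      by (simp add: dird_bounded_linear[OF bl] linear_0[OF \<rho>(1)[OF \<gamma>]] dX)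
    moreover have "dird x (\<lambda>x. \<sigma>2 \<gamma> *\<^sub>R \<rho> \<gamma> (X x)) 0 = \<sigma>2 \<gamma> *\<^sub>R \<rho> \<gamma> (L x)"
      using dird_linear_compose[OF bounded_linear_compose[OF bounded_linear_scaleR_right bl] Xd, where x=0 and v=x] by (simp add: dX)
    ultimately show ?thesis by (simp add: X\<rho>[OF \<gamma>])
  qed
  have L'\<rho>: "L' (\<rho> \<gamma> x) = \<sigma>2 \<gamma> *\<^sub>R \<rho> \<gamma> (L' x)" if \<gamma>: "\<gamma> \<in> carrier \<Gamma>" for \<gamma> x
    unfolding L'_def using inner_prod orthonormal \<gamma>
    by (intro transpose_equivariant[OF basis linL _ _ _ \<rho>[OF \<gamma>] _ L\<rho>[OF \<gamma>], of ip]) (auto simp: invariant_inner_product_def)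
  obtain H0 where H0: "smooth_on UNIV H0" "X = ham_field \<omega> H0" using X_ham by (auto simp: hamiltonian_def)
  \<comment> \<open>The sign \<sigma>1 \<sigma>2 can be -1, so \<open>H\<close> can only have the
    required symmetry if the free constant makes it vanish at the origin.\<close>
  define H where "H = (\<lambda>x. H0 x - H0 0)"
  have sH: "smooth_on UNIV H" unfolding H_def by (intro smooth_on_diff H0 smooth_on_const open_UNIV)
  have H_diff: "H differentiable (at x)" for x by (rule smooth_on_differentiable[OF sH UNIV_I])
  have dH: "dird v H x = \<omega> (X x) v" for v x
  proof -
    have d: "H0 differentiable (at x)" by (rule smooth_on_differentiable[OF H0(1) UNIV_I])
    have "dird v H x = dird v H0 x" unfolding H_def by (subst dird_diff[OF d]) (auto simp: dird_def)
    then show ?thesis by (simp add: H0(2) ham_field_dird[OF omega d])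
  qed
  have ddH: "dird u (dird v H) x = \<omega> (dird u X x) v" for u v x
    using dird_linear_compose[OF \<omega>.bounded_linear_left Xd, of u v x] by (simp add: dH[abs_def])
  \<comment> \<open>\<omega>(L u, v) is the Hessian of \<open>H\<close> at 0, so this is the
    symmetry of second derivatives.\<close>
  have symL: "\<omega> (L u) v = \<omega> (L v) u" for u v
    using dird_commute[OF open_UNIV UNIV_I sH, of u v 0] by (simp add: ddH dX)
  have H2: "flat 3 (\<lambda>z. H z - (1/2) * \<omega> (L z) z)"
  proof -
    have "taylor_term H 0 x = 0" "taylor_term H 1 x = 0" for x
      by (simp_all add: H_def[THEN fun_cong] taylor_term_def) (simp add: dH X_zero \<omega>.zero_left flip: H_def)
    moreover have "taylor_term H 2 x = (1/2) * \<omega> (L x) x" for x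
      by (simp add: taylor_term_def numeral_2_eq_2 ddH dX)
    moreover have "(\<Sum>k\<le>2. taylor_term H k x) = taylor_term H 0 x + taylor_term H 1 x + taylor_term H 2 x" for x
      by (simp add: numeral_2_eq_2)
    ultimately have eq: "(\<Sum>k\<le>2. taylor_term H k x) = (1/2) * \<omega> (L x) x" for x by simp
    show ?thesis using taylor_remainder[OF open_UNIV UNIV_I sH, of 2, unfolded eq] by simp
  qed
  have H\<rho>: "H (\<rho> \<gamma> x) = \<sigma>1 \<gamma> * \<sigma>2 \<gamma> * H x" if \<gamma>: "\<gamma> \<in> carrier \<Gamma>" for \<gamma> x
  proof -
    have bl: "bounded_linear (\<rho> \<gamma>)" using \<rho>(1)[OF \<gamma>] by (simp add: linear_conv_bounded_linear)
    \<comment> \<open>Its derivative vanishes by the chain rule and the symmetries of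
      \<open>X\<close> and \<omega>, so it is constant, with value 0 at the origin.\<close>
    define D where "D = (\<lambda>x. H (\<rho> \<gamma> x) - (\<sigma>1 \<gamma> * \<sigma>2 \<gamma>) *\<^sub>R H x)"
    have s: "smooth_on UNIV (\<lambda>x. H (\<rho> \<gamma> x))"
      by (rule smooth_on_compose[OF sH smooth_on_bounded_linear[OF bl] open_UNIV open_UNIV subset_UNIV])
    have sD: "smooth_on UNIV D" unfolding D_def by (intro smooth_on_diff smooth_on_scaleR s sH open_UNIV)
    have "dird v D x = 0" for v x
    proof -
      have "dird v (\<lambda>x. H (\<rho> \<gamma> x)) x = \<omega> (X (\<rho> \<gamma> x)) (\<rho> \<gamma> v)"
        using dird_compose[OF bounded_linear_imp_differentiable[OF bl] H_diff, where x=x and v=v] by (simp add: dird_bounded_linear[OF bl] dH)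
      also have "\<dots> = \<sigma>1 \<gamma> * \<sigma>2 \<gamma> * \<omega> (X x) v" by (simp add: X\<rho>[OF \<gamma>] semi'[OF \<gamma>] \<omega>.scaleR_left)
      finally show ?thesis unfolding D_def
        using smooth_on_differentiable[OF s UNIV_I, of x] H_diff[of x] dird_scaleR[OF H_diff, of v "\<sigma>1 \<gamma> * \<sigma>2 \<gamma>" x]
        by (simp add: dird_diff dH)
    qed
    then have "(D has_derivative (\<lambda>v. 0)) (at x)" for x
      using has_derivative_dird[OF smooth_on_differentiable[OF sD UNIV_I], of x] by simp
    then have "D x = D 0" using has_derivative_zero_unique[of UNIV D] by auto
    then show ?thesis by (simp add: D_def H_def linear_0[OF \<rho>(1)[OF \<gamma>]])
  qed
  have r2: "2 \<le> r" using r by simp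
  obtain P K where P: "smooth_on UNIV P" "flat 3 P"
    and K: "\<And>k. k \<in> {3..r} \<Longrightarrow> homogeneous_poly k (K k)" "\<And>k. k \<in> {3..r} \<Longrightarrow> lie_deriv L' (K k) = (\<lambda>x. 0)"
      "\<And>k \<gamma> x. k \<in> {3..r} \<Longrightarrow> \<gamma> \<in> carrier \<Gamma> \<Longrightarrow> K k (\<rho> \<gamma> x) = \<sigma>1 \<gamma> * \<sigma>2 \<gamma> * K k x"
    and f: "flat (Suc r) (\<lambda>x. H (x + (1/2) *\<^sub>R ham_field \<omega> P x) -
      ((1/2) * \<omega> (L (x - (1/2) *\<^sub>R ham_field \<omega> P x)) (x - (1/2) *\<^sub>R ham_field \<omega> P x)
        + (\<Sum>k=3..r. K k (x - (1/2) *\<^sub>R ham_field \<omega> P x))))"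
    using cayley_normal_form[where G="carrier \<Gamma>" and g=\<rho> and ?s1.0=\<sigma>1 and ?s2.0=\<sigma>2 and H=H and j=r, OF omega span T \<rho>
        Z2_hom_square[OF sigma1] Z2_hom_square[OF sigma2] L\<rho> L'\<rho> semi' sH H\<rho> symL H2 r2]
    by blast
  have "K k \<in> sym_poly k (semidirect b \<rho> (S_group b L) \<Gamma>) (semidirect_act b \<rho>) (\<lambda>g. tilde \<sigma>1 g * tilde \<sigma>2 g)"
    if k: "k \<in> {3..r}" for k
  proof -
    have "K k (mat_act b A (\<rho> \<gamma> x)) = \<sigma>1 \<gamma> * \<sigma>2 \<gamma> * K k x" if "A \<in> S_group b L" "\<gamma> \<in> carrier \<Gamma>" for A \<gamma> x
      using S_group_invariant[OF basis smooth_on_homogeneous_poly[OF K(1)[OF k]] K(2)[OF k, unfolded L'_def] that(1)] K(3)[OF k that(2)] by simp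
    then show ?thesis using K(1)[OF k] by (auto simp: sym_poly_def semidirect_def semidirect_act_def tilde_def)
  qed
  moreover
  define N where "N = (\<lambda>z. (1/2) * \<omega> (L z) z + (\<Sum>k=3..r. K k z))"
  obtain V h where V: "open V" "0 \<in> V" "smooth_on V h" "h 0 = 0"
    "\<And>y. y \<in> V \<Longrightarrow> h y - (1/2) *\<^sub>R ham_field \<omega> P (h y) = y"
    "\<And>y u v. y \<in> V \<Longrightarrow> \<omega> (dird u (\<lambda>y. h y + (1/2) *\<^sub>R ham_field \<omega> P (h y)) y) (dird v (\<lambda>y. h y + (1/2) *\<^sub>R ham_field \<omega> P (h y)) y) = \<omega> u v"
    using symplectic_cayley_map[OF omega P] by blast
  define \<phi> where "\<phi> = (\<lambda>y. h y + (1/2) *\<^sub>R ham_field \<omega> P (h y))"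
  have s\<phi>: "smooth_on V \<phi>" unfolding \<phi>_def
    by (intro smooth_on_add smooth_on_scaleR V(1,3) smooth_on_compose[OF smooth_on_ham_field[OF omega open_UNIV P(1)] V(3) V(1) open_UNIV subset_UNIV])
  have \<phi>0: "\<phi> 0 = 0" using V(5)[OF V(2)] by (simp add: \<phi>_def V(4))
  have sp: "\<omega> (dird u \<phi> y) (dird v \<phi> y) = \<omega> u v" if "y \<in> V" for y u v using V(6)[OF that] by (simp add: \<phi>_def)
  have \<phi>d: "\<phi> differentiable (at y)" if "y \<in> V" for y by (rule smooth_on_differentiable[OF s\<phi> that])
  \<comment> \<open>The derivative of \<phi> preserves a non-degenerate form, which forces
    injectivity.\<close>
  have inj\<phi>: "inj (\<lambda>v. dird v \<phi> y)" if y: "y \<in> V" for y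
  proof (rule injI)
    fix u u' assume "dird u \<phi> y = dird u' \<phi> y"
    then show "u = u'" by (intro symplectic_nondegenerate[OF omega]) (metis sp[OF y])
  qed
  have surj\<phi>: "surj (\<lambda>v. dird v \<phi> y)" if y: "y \<in> V" for y
    by (rule linear_injective_imp_surjective[OF linear_dird[OF \<phi>d[OF y]] inj\<phi>[OF y]]) simp
  define H' where "H' = (\<lambda>y. H (\<phi> y))"
  have sH': "smooth_on V H'" unfolding H'_def by (rule smooth_on_compose[OF sH s\<phi> V(1) open_UNIV subset_UNIV])
  have H'd: "H' differentiable (at y)" if "y \<in> V" for y by (rule smooth_on_differentiable[OF sH' that])
  have dH': "dird v H' y = \<omega> (X (\<phi> y)) (dird v \<phi> y)" if y: "y \<in> V" for v y
    unfolding H'_def using dird_compose[OF \<phi>d[OF y] H_diff, of v] by (simp add: dH)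
  define Y where "Y = ham_field \<omega> H'"
  have sY: "smooth_on V Y" unfolding Y_def by (rule smooth_on_ham_field[OF omega V(1) sH'])
  have Y: "\<omega> (Y y) v = dird v H' y" if "y \<in> V" for y v
    unfolding Y_def by (rule ham_field_dird[OF omega H'd[OF that]])
  have Y0: "Y 0 = 0"
    unfolding Y_def by (rule ham_field_eqI[OF omega H'd[OF V(2)]]) (simp add: dH'[OF V(2)] \<phi>0 X_zero \<omega>.zero_left)
  \<comment> \<open>It suffices to test against the vectors \<open>dird v' \<phi> y\<close>, which
    exhaust the space; there invariance of \<omega> identifies the field of H o \<phi> with the
    pullback of \<open>X\<close>.\<close>
  have conj: "dird (Y y) \<phi> y = X (\<phi> y)" if y: "y \<in> V" for y
  proof (rule symplectic_nondegenerate[OF omega])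
    fix v
    obtain v' where v: "v = dird v' \<phi> y" using surj\<phi>[OF y] by (metis surjD)
    show "\<omega> (dird (Y y) \<phi> y) v = \<omega> (X (\<phi> y)) v"
      by (simp add: v sp[OF y] Y[OF y] dH'[OF y])
  qed
  have fc: "formally_conjugate Y X"
    using inj\<phi>[OF V(2)] surj\<phi>[OF V(2)] by (intro formally_conjugateI[OF V(1,2) s\<phi> sY X_smooth \<phi>0 conj]) (auto simp: bij_def)
  have bb: "bounded_bilinear (\<lambda>u v. \<omega> (L u) v)"
    using linL by (intro \<omega>.comp1) (simp add: linear_conv_bounded_linear)
  have sq: "smooth_on UNIV (\<lambda>z. (1/2) * \<omega> (L z) z)"
    by (intro open_UNIV smooth_on_mult_left smooth_on_bilinear[OF bb] smooth_on_ident)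
  have sK: "smooth_on UNIV (K k)" if "k \<in> {3..r}" for k by (rule smooth_on_homogeneous_poly[OF K(1)[OF that]])
  have sN: "smooth_on UNIV N" unfolding N_def by (intro smooth_on_add open_UNIV sq smooth_on_sum sK)
  \<comment> \<open>Identifies the field of \<open>N\<close>; the factor 1/2 is absorbed by the
    symmetry of \<omega>(L u, v).\<close>
  have dN: "dird v N y = \<omega> (L y + (\<Sum>k=3..r. ham_field \<omega> (K k) y)) v" for v y
  proof -
    have sqd: "(\<lambda>z. (1/2) * \<omega> (L z) z) differentiable (at y)" by (rule smooth_on_differentiable[OF sq UNIV_I])
    have Kd: "K k differentiable (at y)" if "k \<in> {3..r}" for k by (rule smooth_on_differentiable[OF sK[OF that] UNIV_I])
    have sumd: "(\<lambda>z. \<Sum>k=3..r. K k z) differentiable (at y)"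
      by (rule smooth_on_differentiable[OF smooth_on_sum[OF open_UNIV sK] UNIV_I])
    have "dird v (\<lambda>z. (1/2) *\<^sub>R \<omega> (L z) z) y = (1/2) *\<^sub>R (\<omega> (L y) v + \<omega> (L v) y)"
      using dird_bilinear[where v=v and x=y, OF bb differentiable_ident differentiable_ident]
        dird_scaleR[where v=v and c="1/2" and x=y, OF smooth_on_differentiable[OF smooth_on_bilinear[OF bb open_UNIV smooth_on_ident smooth_on_ident] UNIV_I]]
      by (simp add: dird_bounded_linear[OF bounded_linear_ident])
    then have "dird v (\<lambda>z. (1/2) * \<omega> (L z) z) y = \<omega> (L y) v" using symL[of v y] by simp
    moreover have "dird v (\<lambda>z. \<Sum>k=3..r. K k z) y = (\<Sum>k=3..r. \<omega> (ham_field \<omega> (K k) y) v)"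
      by (subst dird_sum[OF Kd]) (simp_all add: ham_field_dird[OF omega Kd])
    ultimately show ?thesis unfolding N_def dird_add[OF sqd sumd]
      by (simp only: \<omega>.add_left \<omega>.sum_left)
  qed
  define R where "R = (\<lambda>y. H' y - N y)"
  have sR: "smooth_on V R" unfolding R_def by (intro smooth_on_diff V(1) sH' smooth_on_subset[OF sN]) simp
  \<comment> \<open>Substitutes x = h(y) in \<open>f\<close>, where A_-(h y) = y and A_+(h y) =
    \<phi>(y).\<close>
  have "flat (Suc r) R"
    by (rule flat_cong_open[OF flat_compose[OF f flat_1_smooth[OF V(1-4)]] V(1,2)])
      (simp add: R_def H'_def N_def \<phi>_def V(5))
  \<comment> \<open>Passing from a Hamiltonian to its field costs one order.\<close>
  then have "flat r (ham_field \<omega> R)" by (rule flat_ham_field[OF omega V(1,2) sR])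
  then have "flat r (\<lambda>y. Y y - (L y + (\<Sum>k=3..r. ham_field \<omega> (K k) y)))"
  proof (rule flat_cong_open[OF _ V(1,2)])
    fix y assume y: "y \<in> V"
    show "ham_field \<omega> R y = Y y - (L y + (\<Sum>k=3..r. ham_field \<omega> (K k) y))"
    proof (rule ham_field_eqI[OF omega smooth_on_differentiable[OF sR y]])
      show "\<omega> (Y y - (L y + (\<Sum>k=3..r. ham_field \<omega> (K k) y))) v = dird v R y" for v
        unfolding R_def dird_diff[OF H'd[OF y] smooth_on_differentiable[OF sN UNIV_I]] dN \<omega>.diff_left Y[OF y] ..
    qed
  qed
  then have "(\<lambda>y. norm (Y y - (L y + (\<Sum>k=3..r. ham_field \<omega> (K k) y)))) \<in> O[nhds 0](\<lambda>y. norm y ^ r)"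
    unfolding flat_def by (auto intro: bigoI)
  ultimately show ?thesis using V(1,2) sY Y0 fc by blast
qed

end
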